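(* Assume that $Q^{\mathrm{dyn}}$ has finite time range, that the global foliation satisfies the hyperbolicity condition, and that the dynamical wave equation is shielded in time strips, both in the retarded and in the advanced sense. Let $k=\frac i2(s^\vee-s^\wedge)$ be the causal fundamental solution. Then the following sequence is exact: $$0\to\mathscr W^{**}_0(M,SM)\xrightarrow{\,Q^{\mathrm{dyn}}\,}\mathscr W^*_{\mathrm{tc}}(M,SM)\xrightarrow{\ k\ }\mathscr W_{\mathrm E}(M,SM)\xrightarrow{\,Q^{\mathrm{dyn}}\,}\mathscr W^*_{\mathrm E}(M,SM)\to0 .$$
   Context: Let $(\mathcal H,\langle\cdot|\cdot\rangle_{\mathcal H})$ be a separable complex Hilbert space (scalar product antilinear in the first argument), $n\in\mathbb N$, $\mathcal F\subset\mathrm L(\mathcal H)$ a smooth finite-dimensional manifold of selfadjoint finite-rank operators having exactly $n$ positive and $n$ negative eigenvalues (counting multiplicities) and a fixed trace, $\rho$ a locally finite regular Borel measure on $\mathcal F$ and $M:=\operatorname{supp}\rho$ (spacetime). Past sets. With fixed $\kappa>0$ let $\mathcal L_\kappa(x,y)=\frac1{4n}\sum_{i,j=1}^{2n}(|\lambda_i|-|\lambda_j|)^2+\kappa(\sum_j|\lambda_j|)^2$, where $\lambda_1,\dots,\lambda_{2n}$ are the eigenvalues of $xy$ (non-zero ones with algebraic multiplicity, filled up with zeros). Fix a finite-dimensional subspace $\mathcal H^{\mathrm f}\subset\mathcal H$; for every selfadjoint $A$ with $A(\mathcal H^{\mathrm f})\subset\mathcal H^{\mathrm f}$ and $A|_{(\mathcal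 H^{\mathrm f})^\perp}=0$ consider the vector field $\mathscr C_A(x)=i[A,x]$ and set $g_A(x,y)=|(D_{1,\mathscr C_A}-D_{2,\mathscr C_A})\mathcal L_\kappa(x,y)|$, where $D_1,D_2$ are directional derivatives acting on the first resp. second argument. A Borel set $\Omega\subset M$ is surface layer finite if all $g_A$ are integrable over $\Omega\times(M\setminus\Omega)$; two such sets are causally equivalent if all $g_A$ are integrable over $K\times K$, with $K$ their symmetric difference. It is assumed that there are precisely four equivalence classes $[\varnothing],[M],[\Omega_0],[M\setminus\Omega_0]$ and that $[\Omega_0]$ is distinguished; its elements are the past sets. Wave functions. $S_x:=x(\mathcal H)$ carries the spin inner product $\prec u|v\succ_x=-\langle u|xv\rangle_{\mathcal H}$ and the scalar product $\langle\!\langle u|v\rangle\!\rangle_x=\langle u|\,|x|\,v\rangle_{\mathcal H}$. The Euclidean sign operator $s_x$ is defined by $\langle\!\langle\chi|\xi\rangle\!\rangle_x=\prec\chi|s_x\xi\succ_x$, and $(\mathscr E\psi)(x):=s_x\psi(x)$. A wave function is a map $\psi$ on $M$ with $\psi(x)\in S_x$; it is continuous if $x\mapsto\sqrt{|x|}\psi(x)\in\mathcal H$ is continuous; $C^0(M,SM)$ is the space of continuous wave functions. $C^{\mathrm{vary}}(M,SM)\subset C^0(M,SM)$ is a chosen linear subspace; $C^{\mathrm{vary}}_0$ are its compactly supported elements, $C^{\mathrm{vary}}_{\mathrm{sc}}$ its elements which have compact support in any time strip. Operator. $Q^{\mathrm{dyn}}(x,y):S_y\to S_x$ is a given kernel,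 symmetric in the sense $Q^{\mathrm{dyn}}(x,y)^*=Q^{\mathrm{dyn}}(y,x)$ (adjoints with respect to the spin inner products; a multiple of $\delta(x,y)$ on the diagonal is allowed), and $(Q^{\mathrm{dyn}}\psi)(x)=\int_MQ^{\mathrm{dyn}}(x,y)\psi(y)\,d\rho(y)$. Global foliation. $\eta\in C^\infty(\mathbb R\times M,\mathbb R)$, $0\le\eta\le1$, $\eta_t:=\eta(t,\cdot)$, $\theta_t:=\partial_t\eta(t,\cdot)$, such that for all $t$: (i) $\operatorname{supp}\eta_t$ is a past set; (ii) $\theta_t\ge0$; (iii) there are $t_0,t_1\in\mathbb R$ such that $\theta_t(x)\ne0$ implies $\eta_{t_0}(x)=0$ and $\eta_{t_1}(x)=1$; and (iv) $M=\bigcup_t\operatorname{supp}\theta_t$. Set $d\rho_t=\theta_t\,d\rho$. For $t_0<t_1$ the time strip is $L_{t_0}^{t_1}=\bigcup_{t\in[t_0,t_1]}\operatorname{supp}\theta_t$; with $\eta_I=\eta_{t_1}-\eta_{t_0}$ set $\langle\psi|\phi\rangle_{L^2(L)}=\int_M\langle\!\langle\psi|\phi\rangle\!\rangle_x\,\eta_I(x)\,d\rho(x)$, with Hilbert space $L^2(L,SM)$. In the whole spacetime, $\mathopen{<}\psi|\phi\mathclose{>}_{\mathcal K}=\int_M\prec\psi(x)|\phi(x)\succ_x\,d\rho(x)$. $L^2_{\mathrm{loc,t}}(M,SM)$ denotes the wave functions which are in $L^2(L,SM)$ for every time strip $L$ (convergence: in $L^2(L,SM)$ for every time strip), and $C^{\mathrm{vary}}_{\mathrm{loc,t}}:=C^{\mathrm{vary}}\cap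 L^2_{\mathrm{loc,t}}$. A wave function $\psi\in L^2_{\mathrm{loc,t}}$ is past compact ($\psi\in L^2_{\mathrm{pc}}$) if $\eta_{t_0}\psi=0$ for some $t_0$, future compact ($\psi\in L^2_{\mathrm{fc}}$) if $(1-\eta_{t_0})\psi=0$ for some $t_0$; $L^2_{\mathrm{tc}}=L^2_{\mathrm{pc}}\cap L^2_{\mathrm{fc}}$. Finite time range: there is $r>0$ with $Q^{\mathrm{dyn}}(x,y)=0$ whenever $x\in\operatorname{supp}\theta_{t_0}$, $y\in\operatorname{supp}\theta_{t_1}$ and $|t_1-t_0|>r$; and $Q^{\mathrm{dyn}}(L^2_{\mathrm{loc,t}})\subset L^2_{\mathrm{loc,t}}$. Softened surface layer form: $$\langle\psi|\phi\rangle^t_\rho=-2i\int_Md\rho(x)\int_Md\rho(y)\,\big(\eta_t(x)(1-\eta_t(y))-(1-\eta_t(x))\eta_t(y)\big)\prec\psi(x)|Q^{\mathrm{dyn}}(x,y)\phi(y)\succ_x .$$ By finite time range, only $x,y$ in a bounded time strip contribute, and the form is used for $\psi,\phi\in L^2_{\mathrm{loc,t}}$ (existence of the double integrals, interchange of the order of integration and differentiation in $t$ under the integrals being understood). $\|\psi\|^t_\rho:=\sqrt{\langle\psi|\psi\rangle^t_\rho}$. Hyperbolicity condition: for any compact interval $I=[t_0,t_{\max}]$ there is $C=C(I)>0$ such that for all $t\in I$ and all $\psi\in C^{\mathrm{vary}}_{\mathrm{loc,t}}$, $\langle\psi|\psi\rangle^t_\rho\ge\frac1{C^2}\int_M\langle\!\langle\psi(x)|\psi(x)\rangle\!\rangle_x\,d\rho_t(x)$.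 Canonical retarded weak solution. $\overline C{}_0^{t}:=\{\psi\in C^{\mathrm{vary}}_0\,|\,(1-\eta_t)\psi=0,\ \|\psi\|^{t'}_\rho=0\ \forall t'\ge t\}$. For $L=L_{t_0}^{t_{\max}}$, $\mathcal H_{t_0}^{t_{\max}}$ is the completion of $\overline C{}_0^{t_{\max}}$ with respect to $\langle\!\langle\!\langle\phi|v\rangle\!\rangle\!\rangle=\langle Q^{\mathrm{dyn}}\phi|Q^{\mathrm{dyn}}v\rangle_{L^2(L)}$, identified (by the energy estimate $\|\phi\|_{L^2(L)}\le2C^2(t_{\max}-t_0)\|Q^{\mathrm{dyn}}\phi\|_{L^2(L)}$) with a subspace of $L^2(L,SM)$, functions being extended by zero, with $Q^{\mathrm{dyn}}$ extended to it by continuity. For $w$ with $w|_L\in L^2(L,SM)$ let $V\in\mathcal H_{t_0}^{t_{\max}}$ be the unique vector with $\langle\mathscr Ew|u\rangle_{L^2(L)}=\langle\!\langle\!\langle V|u\rangle\!\rangle\!\rangle$ for all $u\in\mathcal H_{t_0}^{t_{\max}}$, and set $\psi(w)_{t_0}^{t_{\max}}:=\mathscr EQ^{\mathrm{dyn}}V|_L$. Shielded in time strips (retarded sense): for every $t_0<t_1$ there are $t_1'>t_1$, $t_0'<t_0$ such that for all $t_{\max}\ge t_1'$ and all sufficiently small $t_{\min}<t_0'$, with $L=L_{t_{\min}}^{t_1}$, $L'=L_{t_{\min}}^{t_1'}$, for all $\phi_1\in\mathcal H_{t_{\min}}^{t_{\max}}$, $\phi_2\in\mathcal H_{t_0'}^{t_{\max}}$: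 if $\int_{L'}\langle\!\langle Q^{\mathrm{dyn}}\phi_1+(1-\eta_{t_0'})Q^{\mathrm{dyn}}\phi_2|Q^{\mathrm{dyn}}\psi\rangle\!\rangle_x\,d\rho=0$ for all $\psi\in\overline C{}_0^{t_1'}$, then $(Q^{\mathrm{dyn}}\phi_1+(1-\eta_{t_0'})Q^{\mathrm{dyn}}\phi_2)|_L=0$. The advanced versions of test spaces, Hilbert spaces, canonical solutions and shielding are obtained by reversing the time direction: test functions satisfy $\eta_{t}\psi=0$ and $\|\psi\|^{t'}_\rho=0$ for all $t'\le t$ with $t=t_{\min}$ the initial time of the strip, and in the shielding condition $1-\eta_{t_0'}$ is replaced by $\eta_{t_1'}$, $\phi_2$ lies in the advanced space for $[t_{\min},t_1']$, $L=L_{t_0}^{t_{\max}}$, $L'=L_{t_0'}^{t_{\max}}$, the test functions are those for initial time $t_0'$, for all $t_{\min}\le t_0'$ and all sufficiently large $t_{\max}>t_1'$. Green's operators. $s^\wedge:L^2_{\mathrm{pc}}\to L^2_{\mathrm{pc}}$, $s^\wedge(w)=-\lim_{t_{\min}\to-\infty}\lim_{t_{\max}\to\infty}\psi(w)_{t_{\min}}^{t_{\max}}$ (limit in $L^2_{\mathrm{loc,t}}$, which exists if $Q^{\mathrm{dyn}}$ has finite time range, the global foliation satisfies the hyperbolicity condition and the dynamical wave equation is shielded in time strips in the retarded sense). The advanced Green's operator $s^\vee:L^2_{\mathrm{fc}}\to L^2_{\mathrm{fc}}$ is defined in the same way from the advanced canonical solutions. One has $\mathopen{<}Q^{\mathrm{dyn}}\phi|s^\wedge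 w\mathclose{>}_{\mathcal K}=-\mathopen{<}\phi|w\mathclose{>}_{\mathcal K}$ for all $\phi\in C^{\mathrm{vary}}_0$, and similarly for $s^\vee$. Function spaces. $(C^{\mathrm{vary}}_0)^\perp$ is the orthogonal complement of $C^{\mathrm{vary}}_0$ in $L^2_{\mathrm{loc,t}}$ with respect to $\mathopen{<}\cdot|\cdot\mathclose{>}_{\mathcal K}$. Define - $\mathscr W^{**}_0:=\{\psi\in C^{\mathrm{vary}}_0\,|\,s^\vee Q^{\mathrm{dyn}}\psi=s^\wedge Q^{\mathrm{dyn}}\psi=-\psi\}$; - $\mathscr W^*_{\mathrm{tc}}:=\{\psi\in L^2_{\mathrm{tc}}\,|\,s^\vee\psi,s^\wedge\psi\in C^{\mathrm{vary}}_{\mathrm{sc}}\}$ modulo (its elements in) $(C^{\mathrm{vary}}_0)^\perp$; - $\mathscr W_{\mathrm E}:=\{s^\vee\psi_1+s^\wedge\psi_2\,|\,\psi_1\in L^2_{\mathrm{fc}},\ s^\vee\psi_1\in C^{\mathrm{vary}}_{\mathrm{sc}},\ \psi_2\in L^2_{\mathrm{pc}},\ s^\wedge\psi_2\in C^{\mathrm{vary}}_{\mathrm{sc}}\}$; - $\mathscr W^*_{\mathrm E}:=\{\psi_1+\psi_2\,|\,\psi_1\in L^2_{\mathrm{fc}},\ s^\vee\psi_1\in C^{\mathrm{vary}}_{\mathrm{sc}},\ \psi_2\in L^2_{\mathrm{pc}},\ s^\wedge\psi_2\in C^{\mathrm{vary}}_{\mathrm{sc}}\}$ modulo $\big((C^{\mathrm{vary}}_0)^\perp\cap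 L^2_{\mathrm{fc}}\big)+\big((C^{\mathrm{vary}}_0)^\perp\cap L^2_{\mathrm{pc}}\big)$. The maps in the sequence are induced by $Q^{\mathrm{dyn}}$ and $k$ (both Green's operators vanish on $(C^{\mathrm{vary}}_0)^\perp$ intersected with their domains, so $k$ is well-defined on classes; modulo the spaces divided out one has $Q^{\mathrm{dyn}}s^\vee=Q^{\mathrm{dyn}}s^\wedge=-1$). *)

theory Defs
  imports "HOL-Analysis.Analysis" "HOL-Algebra.Exact_Sequence"
begin

section \<open>Separable complex Hilbert spaces\<close>

class complex_hilbert = banach + second_countable_topology +
  fixes scaleC :: "complex \<Rightarrow> 'a \<Rightarrow> 'a"  (infixr \<open>*\<^sub>C\<close> 75)
    and cinner :: "'a \<Rightarrow> 'a \<Rightarrow> complex"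
  assumes scaleC_add_right: "c *\<^sub>C (u + v) = c *\<^sub>C u + c *\<^sub>C v"
    and scaleC_add_left: "(c + d) *\<^sub>C u = c *\<^sub>C u + d *\<^sub>C u"
    and scaleC_scaleC: "c *\<^sub>C d *\<^sub>C u = (c * d) *\<^sub>C u"
    and scaleR_scaleC: "r *\<^sub>R u = complex_of_real r *\<^sub>C u"
    and cinner_commute: "cinner u v = cnj (cinner v u)"
    and cinner_add_right: "cinner u (v + w) = cinner u v + cinner u w"
    and cinner_scaleC_right: "cinner u (c *\<^sub>C v) = c * cinner u v"
    and norm_eq_sqrt_cinner: "norm u = sqrt (Re (cinner u u))"

instantiation complex :: complex_hilbert
begin
definition scaleC_complex :: "complex \<Rightarrow> complex \<Rightarrow> complex" where "scaleC_complex c u = c * u"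
definition cinner_complex :: "complex \<Rightarrow> complex \<Rightarrow> complex" where "cinner_complex u v = cnj u * v"
instance
  by standard
    (auto simp: scaleC_complex_def cinner_complex_def algebra_simps scaleR_conv_of_real
      cmod_def power2_eq_square)
end

global_interpretation complex_vector: vector_space "scaleC :: complex \<Rightarrow> 'a \<Rightarrow> 'a::complex_hilbert"
proof
  show "1 *\<^sub>C (u::'a) = u" for u
    using scaleR_scaleC[of 1 u] by simp
qed (simp_all add: scaleC_add_right scaleC_add_left scaleC_scaleC)

definition cfinite_dim :: "'h::complex_hilbert set \<Rightarrow> bool" where
  "cfinite_dim S \<longleftrightarrow> (\<exists>B. finite B \<and> S \<subseteq> complex_vector.span B)"


section \<open>Operators\<close>

text \<open>Operators are bounded and a priori only real-linear; self-adjointness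
  with respect to the complex scalar product enforces complex linearity.\<close>

type_synonym 'h op = "'h \<Rightarrow>\<^sub>L 'h"

definition selfadjoint :: "'h::complex_hilbert op \<Rightarrow> bool" where
  "selfadjoint A \<longleftrightarrow> (\<forall>u v. cinner (A u) v = cinner u (A v))"

definition positive_op :: "'h::complex_hilbert op \<Rightarrow> bool" where
  "positive_op A \<longleftrightarrow> selfadjoint A \<and> (\<forall>u. 0 \<le> Re (cinner u (A u)))"

definition op_sqrt :: "'h::complex_hilbert op \<Rightarrow> 'h op" where
  "op_sqrt A = (THE B. positive_op B \<and> B o\<^sub>L B = A)"

definition op_abs :: "'h::complex_hilbert op \<Rightarrow> 'h op" where
  "op_abs x = op_sqrt (x o\<^sub>L x)"  \<comment> \<open>used for self-adjoint \<open>x\<close> only\<close>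

definition finite_rank :: "'h::complex_hilbert op \<Rightarrow> bool" where
  "finite_rank A \<longleftrightarrow> cfinite_dim (range A)"

definition alg_mult :: "'h::complex_hilbert op \<Rightarrow> complex \<Rightarrow> nat" where
  "alg_mult T \<mu> = complex_vector.dim (\<Union>k. {u. ((\<lambda>v. T v - \<mu> *\<^sub>C v) ^^ k) u = 0})"

definition eigenvalues :: "'h::complex_hilbert op \<Rightarrow> complex set" where
  "eigenvalues T = {\<mu>. \<exists>u. u \<noteq> 0 \<and> T u = \<mu> *\<^sub>C u}"

definition num_pos_eigenvalues :: "'h::complex_hilbert op \<Rightarrow> nat" where
  "num_pos_eigenvalues x = (\<Sum>\<mu>\<in>{\<mu> \<in> eigenvalues x. \<mu> \<in> \<real> \<and> Re \<mu> > 0}. alg_mult x \<mu>)"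

definition num_neg_eigenvalues :: "'h::complex_hilbert op \<Rightarrow> nat" where
  "num_neg_eigenvalues x = (\<Sum>\<mu>\<in>{\<mu> \<in> eigenvalues x. \<mu> \<in> \<real> \<and> Re \<mu> < 0}. alg_mult x \<mu>)"

definition op_trace :: "'h::complex_hilbert op \<Rightarrow> complex" where
  "op_trace x = (\<Sum>\<mu>\<in>eigenvalues x - {0}. of_nat (alg_mult x \<mu>) * \<mu>)"

definition eigenvalue_list :: "nat \<Rightarrow> 'h::complex_hilbert op \<Rightarrow> complex list" where
  "eigenvalue_list m T =
     (SOME l. length l = m \<and> (\<forall>\<mu>. \<mu> \<noteq> 0 \<longrightarrow> count_list l \<mu> = alg_mult T \<mu>))"

definition lagrangian :: "nat \<Rightarrow> real \<Rightarrow> 'h::complex_hilbert op \<Rightarrow> 'h op \<Rightarrow> real" where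
  "lagrangian n \<kappa> x y = (let l = eigenvalue_list (2 * n) (x o\<^sub>L y) in
     1 / (4 * real n) * (\<Sum>i<2*n. \<Sum>j<2*n. (cmod (l ! i) - cmod (l ! j))\<^sup>2)
     + \<kappa> * (\<Sum>j<2*n. cmod (l ! j))\<^sup>2)"

definition commutator_field :: "'h::complex_hilbert op \<Rightarrow> 'h op \<Rightarrow> 'h op" where
  "commutator_field A x = Blinfun (\<lambda>u. \<i> *\<^sub>C (A (x u) - x (A u)))"

text \<open>Directional derivatives along the vector field \<open>x \<mapsto> \<i>[A,x]\<close> are taken along
  its (unique, global) integral curves, the unitary orbits
  \<open>\<tau> \<mapsto> exp(\<i>\<tau>A) x exp(-\<i>\<tau>A)\<close>. These preserve the spectrum, so that
  the Lagrangian is defined along them.\<close>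

definition has_dir_deriv ::
  "'h::complex_hilbert op \<Rightarrow> ('h op \<Rightarrow> real) \<Rightarrow> 'h op \<Rightarrow> real \<Rightarrow> bool" where
  "has_dir_deriv A f x d \<longleftrightarrow> (\<exists>\<gamma>. \<gamma> 0 = x \<and>
     (\<forall>\<tau>. (\<gamma> has_vector_derivative commutator_field A (\<gamma> \<tau>)) (at \<tau>)) \<and>
     ((\<lambda>\<tau>. f (\<gamma> \<tau>)) has_real_derivative d) (at 0))"

definition dir_deriv :: "'h::complex_hilbert op \<Rightarrow> ('h op \<Rightarrow> real) \<Rightarrow> 'h op \<Rightarrow> real" where
  "dir_deriv A f x = (THE d. has_dir_deriv A f x d)"


section \<open>Smoothness\<close>

text \<open>Iterated Frechet differentiability of all directional derivatives. On open subsets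
  of a Banach space this is equivalent to being \<open>C\<^sup>\<infinity>\<close> in the norm sense (by the uniform
  boundedness principle, each derivative is locally Lipschitz).\<close>

fun smooth_order :: "nat \<Rightarrow> 'a::real_normed_vector set \<Rightarrow> ('a \<Rightarrow> 'b::real_normed_vector) \<Rightarrow> bool" where
  "smooth_order 0 U f \<longleftrightarrow> continuous_on U f"
| "smooth_order (Suc k) U f \<longleftrightarrow> (\<forall>x\<in>U. f differentiable (at x)) \<and>
     (\<forall>v. smooth_order k U (\<lambda>x. frechet_derivative f (at x) v))"

definition smooth_on :: "'a::real_normed_vector set \<Rightarrow> ('a \<Rightarrow> 'b::real_normed_vector) \<Rightarrow> bool" where
  "smooth_on U f \<longleftrightarrow> (\<forall>k. smooth_order k U f)"

text \<open>Embedded submanifolds of finite dimension, described by slice charts.\<close>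

definition smooth_submanifold :: "'a::banach set \<Rightarrow> bool" where
  "smooth_submanifold F \<longleftrightarrow> second_countable (top_of_set F) \<and>
     (\<exists>d. \<forall>x\<in>F. \<exists>U (V::'a set) \<Phi> \<Psi> E. open U \<and> x \<in> U \<and> open V \<and> homeomorphism U V \<Phi> \<Psi> \<and>
        smooth_on U \<Phi> \<and> smooth_on V \<Psi> \<and>
        (\<exists>B. finite B \<and> independent B \<and> card B = d \<and> E = span B) \<and> \<Phi> ` (U \<inter> F) = V \<inter> E)"

text \<open>Smooth functions on an arbitrary subset are the restrictions of smooth
  functions defined on open neighborhoods.\<close>

definition smooth_on_subset :: "'a::real_normed_vector set \<Rightarrow> ('a \<Rightarrow> 'b::real_normed_vector) \<Rightarrow> bool" where
  "smooth_on_subset S f \<longleftrightarrow> (\<forall>p\<in>S. \<exists>W g. open W \<and> p \<in> W \<and> smooth_on W g \<and> (\<forall>q\<in>W \<inter> S. g q = f q))"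


section \<open>The data\<close>

text \<open>Wave functions on spacetime \<open>M\<close> are represented by functions on all operators which
  vanish outside \<open>M\<close> (see \<open>wave_function\<close> below).\<close>

type_synonym 'h wave = "'h op \<Rightarrow> 'h"

text \<open>The kernel \<open>Q\<^sup>d\<^sup>y\<^sup>n(x,y)\<close> is \<open>kern x y + diagc * \<delta>(x,y)\<close>, where only the action of
  \<open>kern x y\<close> on the spin space at \<open>y\<close> matters. \<open>pastset\<close> is a representative
  of the distinguished class of past sets, \<open>fsub\<close> is the finite-dimensional subspace
  of the Hilbert space from which the operators \<open>A\<close> are formed.\<close>

record (overloaded) ('h::complex_hilbert) wave_dynamics =
  spindim :: nat
  trconst :: real
  ops :: "'h op set"
  rho :: "'h op measure"
  kappa :: real
  fsub :: "'h set"
  pastset :: "'h op set"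
  Cvary :: "'h wave set"
  kern :: "'h op \<Rightarrow> 'h op \<Rightarrow> 'h \<Rightarrow> 'h"
  diagc :: real
  eta :: "real \<Rightarrow> 'h op \<Rightarrow> real"


section \<open>Spacetime and past sets\<close>

definition spacetime :: "'h::complex_hilbert wave_dynamics \<Rightarrow> 'h op set" where
  "spacetime S = {x \<in> ops S. \<forall>U. open U \<and> x \<in> U \<longrightarrow> emeasure (rho S) (U \<inter> ops S) \<noteq> 0}"

definition operator_manifold :: "'h::complex_hilbert wave_dynamics \<Rightarrow> bool" where
  "operator_manifold S \<longleftrightarrow> 0 < spindim S \<and> smooth_submanifold (ops S) \<and>
     (\<forall>x\<in>ops S. selfadjoint x \<and> finite_rank x \<and>
        num_pos_eigenvalues x = spindim S \<and> num_neg_eigenvalues x = spindim S \<and>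
        op_trace x = of_real (trconst S))"

definition locally_finite_regular_measure :: "'h::complex_hilbert wave_dynamics \<Rightarrow> bool" where
  "locally_finite_regular_measure S \<longleftrightarrow>
     sets (rho S) = sets (restrict_space borel (ops S)) \<and>
     (\<forall>x\<in>ops S. \<exists>U. open U \<and> x \<in> U \<and> emeasure (rho S) (U \<inter> ops S) < \<infinity>) \<and>
     (\<forall>B\<in>sets (rho S).
        emeasure (rho S) B = (INF U\<in>{U. open U \<and> B \<subseteq> U}. emeasure (rho S) (U \<inter> ops S)) \<and>
        emeasure (rho S) B = (SUP K\<in>{K. compact K \<and> K \<subseteq> B}. emeasure (rho S) K))"

abbreviation lagr :: "'h::complex_hilbert wave_dynamics \<Rightarrow> 'h op \<Rightarrow> 'h op \<Rightarrow> real" where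
  "lagr S \<equiv> lagrangian (spindim S) (kappa S)"

definition generators :: "'h::complex_hilbert wave_dynamics \<Rightarrow> 'h op set" where
  "generators S = {A. selfadjoint A \<and> A ` fsub S \<subseteq> fsub S \<and>
     (\<forall>u. (\<forall>v\<in>fsub S. cinner v u = 0) \<longrightarrow> A u = 0)}"

definition layer_integrand ::
  "'h::complex_hilbert wave_dynamics \<Rightarrow> 'h op \<Rightarrow> 'h op \<Rightarrow> 'h op \<Rightarrow> real" where
  "layer_integrand S A x y =
     \<bar>dir_deriv A (\<lambda>z. lagr S z y) x - dir_deriv A (\<lambda>z. lagr S x z) y\<bar>"

definition layer_integrable ::
  "'h::complex_hilbert wave_dynamics \<Rightarrow> 'h op set \<Rightarrow> 'h op set \<Rightarrow> bool" where
  "layer_integrable S X Y \<longleftrightarrow> (\<forall>A\<in>generators S.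
     set_integrable (rho S \<Otimes>\<^sub>M rho S) (X \<times> Y) (\<lambda>(x, y). layer_integrand S A x y))"

definition surface_layer_finite :: "'h::complex_hilbert wave_dynamics \<Rightarrow> 'h op set \<Rightarrow> bool" where
  "surface_layer_finite S \<Omega> \<longleftrightarrow> \<Omega> \<in> sets (rho S) \<and> \<Omega> \<subseteq> spacetime S \<and>
     layer_integrable S \<Omega> (spacetime S - \<Omega>)"

definition causal_rel :: "'h::complex_hilbert wave_dynamics \<Rightarrow> ('h op set \<times> 'h op set) set" where
  "causal_rel S = {(\<Omega>, \<Omega>'). surface_layer_finite S \<Omega> \<and> surface_layer_finite S \<Omega>' \<and>
     layer_integrable S (sym_diff \<Omega> \<Omega>') (sym_diff \<Omega> \<Omega>')}"

definition past_sets :: "'h::complex_hilbert wave_dynamics \<Rightarrow> 'h op set set" where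
  "past_sets S = causal_rel S `` {pastset S}"

definition causal_structure :: "'h::complex_hilbert wave_dynamics \<Rightarrow> bool" where
  "causal_structure S \<longleftrightarrow> kappa S > 0 \<and>
     complex_vector.subspace (fsub S) \<and> cfinite_dim (fsub S) \<and>
     (\<forall>A\<in>generators S. \<forall>x\<in>spacetime S. \<forall>y\<in>spacetime S.
        (\<exists>d. has_dir_deriv A (\<lambda>z. lagr S z y) x d) \<and> (\<exists>d. has_dir_deriv A (\<lambda>z. lagr S x z) y d)) \<and>
     surface_layer_finite S (pastset S) \<and>
     (let cls = {causal_rel S `` {{}}, causal_rel S `` {spacetime S},
                 causal_rel S `` {pastset S}, causal_rel S `` {spacetime S - pastset S}}
      in {\<Omega>. surface_layer_finite S \<Omega>} // causal_rel S = cls \<and> card cls = 4)"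


section \<open>Wave functions\<close>

definition spin_space :: "'h::complex_hilbert op \<Rightarrow> 'h set" where
  "spin_space x = range x"

definition spin_inner :: "'h::complex_hilbert op \<Rightarrow> 'h \<Rightarrow> 'h \<Rightarrow> complex" where
  "spin_inner x u v = - cinner u (x v)"

definition eucl_inner :: "'h::complex_hilbert op \<Rightarrow> 'h \<Rightarrow> 'h \<Rightarrow> complex" where
  "eucl_inner x u v = cinner u (op_abs x v)"

definition eucl_sign :: "'h::complex_hilbert op \<Rightarrow> 'h \<Rightarrow> 'h" where
  "eucl_sign x u = (THE v. v \<in> spin_space x \<and> (\<forall>\<zeta>\<in>spin_space x. eucl_inner x \<zeta> u = spin_inner x \<zeta> v))"

definition wave_function :: "'h::complex_hilbert wave_dynamics \<Rightarrow> 'h wave \<Rightarrow> bool" where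
  "wave_function S \<psi> \<longleftrightarrow>
     (\<forall>x\<in>spacetime S. \<psi> x \<in> spin_space x) \<and> (\<forall>x. x \<notin> spacetime S \<longrightarrow> \<psi> x = 0)"

definition sign_op :: "'h::complex_hilbert wave_dynamics \<Rightarrow> 'h wave \<Rightarrow> 'h wave" where
  "sign_op S \<psi> = (\<lambda>x. if x \<in> spacetime S then eucl_sign x (\<psi> x) else 0)"

definition continuous_waves :: "'h::complex_hilbert wave_dynamics \<Rightarrow> 'h wave set" where
  "continuous_waves S = {\<psi>. wave_function S \<psi> \<and>
     continuous_on (spacetime S) (\<lambda>x. op_sqrt (op_abs x) (\<psi> x))}"

definition measurable_wave :: "'h::complex_hilbert wave_dynamics \<Rightarrow> 'h wave \<Rightarrow> bool" where
  "measurable_wave S \<psi> \<longleftrightarrow> wave_function S \<psi> \<and>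
     (\<lambda>x. op_sqrt (op_abs x) (\<psi> x)) \<in> borel_measurable (rho S)"

definition wave_subspace :: "'h::complex_hilbert wave set \<Rightarrow> bool" where
  "wave_subspace X \<longleftrightarrow> (\<lambda>x. 0) \<in> X \<and> (\<forall>\<psi>\<in>X. \<forall>\<phi>\<in>X. (\<lambda>x. \<psi> x + \<phi> x) \<in> X) \<and>
     (\<forall>c. \<forall>\<psi>\<in>X. (\<lambda>x. c *\<^sub>C \<psi> x) \<in> X)"

text \<open>Compactness of the support is expressed by the vanishing outside a compact subset.\<close>

definition Cvary0 :: "'h::complex_hilbert wave_dynamics \<Rightarrow> 'h wave set" where
  "Cvary0 S = {\<psi> \<in> Cvary S. \<exists>K. compact K \<and> K \<subseteq> spacetime S \<and> (\<forall>x. x \<notin> K \<longrightarrow> \<psi> x = 0)}"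


section \<open>Time strips and the spaces of square integrable wave functions\<close>

definition theta :: "'h::complex_hilbert wave_dynamics \<Rightarrow> real \<Rightarrow> 'h op \<Rightarrow> real" where
  "theta S t x = deriv (\<lambda>s. eta S s x) t"

definition supp_on :: "'h::complex_hilbert wave_dynamics \<Rightarrow> ('h op \<Rightarrow> real) \<Rightarrow> 'h op set" where
  "supp_on S f = spacetime S \<inter> closure {x \<in> spacetime S. f x \<noteq> 0}"

definition global_foliation :: "'h::complex_hilbert wave_dynamics \<Rightarrow> bool" where
  "global_foliation S \<longleftrightarrow>
     smooth_on_subset (UNIV \<times> spacetime S) (\<lambda>(t, x). eta S t x) \<and>
     (\<forall>t. \<forall>x\<in>spacetime S. 0 \<le> eta S t x \<and> eta S t x \<le> 1) \<and>
     (\<forall>t. supp_on S (eta S t) \<in> past_sets S) \<and>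
     (\<forall>t. \<forall>x\<in>spacetime S. theta S t x \<ge> 0) \<and>
     (\<forall>t. \<exists>t0 t1. \<forall>x\<in>spacetime S. theta S t x \<noteq> 0 \<longrightarrow> eta S t0 x = 0 \<and> eta S t1 x = 1) \<and>
     spacetime S = (\<Union>t. supp_on S (theta S t))"

definition time_strip :: "'h::complex_hilbert wave_dynamics \<Rightarrow> real \<Rightarrow> real \<Rightarrow> 'h op set" where
  "time_strip S t0 t1 = (\<Union>t\<in>{t0..t1}. supp_on S (theta S t))"

definition L2_inner ::
  "'h::complex_hilbert wave_dynamics \<Rightarrow> real \<Rightarrow> real \<Rightarrow> 'h wave \<Rightarrow> 'h wave \<Rightarrow> complex" where
  "L2_inner S t0 t1 \<psi> \<phi> =
     (LINT x|rho S. of_real (eta S t1 x - eta S t0 x) * eucl_inner x (\<psi> x) (\<phi> x))"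

definition L2_norm :: "'h::complex_hilbert wave_dynamics \<Rightarrow> real \<Rightarrow> real \<Rightarrow> 'h wave \<Rightarrow> real" where
  "L2_norm S t0 t1 \<psi> = sqrt (Re (L2_inner S t0 t1 \<psi> \<psi>))"

definition L2_strip :: "'h::complex_hilbert wave_dynamics \<Rightarrow> real \<Rightarrow> real \<Rightarrow> 'h wave set" where
  "L2_strip S t0 t1 = {\<psi>. measurable_wave S \<psi> \<and>
     integrable (rho S) (\<lambda>x. of_real (eta S t1 x - eta S t0 x) * eucl_inner x (\<psi> x) (\<psi> x))}"

definition L2_tendsto :: "'h::complex_hilbert wave_dynamics \<Rightarrow> real \<Rightarrow> real \<Rightarrow>
    ('i \<Rightarrow> 'h wave) \<Rightarrow> 'h wave \<Rightarrow> 'i filter \<Rightarrow> bool" where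
  "L2_tendsto S t0 t1 f g N \<longleftrightarrow> (\<forall>\<^sub>F i in N. f i \<in> L2_strip S t0 t1) \<and> g \<in> L2_strip S t0 t1 \<and>
     ((\<lambda>i. L2_norm S t0 t1 (\<lambda>x. f i x - g x)) \<longlongrightarrow> 0) N"

definition L2_loc :: "'h::complex_hilbert wave_dynamics \<Rightarrow> 'h wave set" where
  "L2_loc S = {\<psi>. \<forall>t0 t1. t0 < t1 \<longrightarrow> \<psi> \<in> L2_strip S t0 t1}"

definition L2_pc :: "'h::complex_hilbert wave_dynamics \<Rightarrow> 'h wave set" where
  "L2_pc S = {\<psi> \<in> L2_loc S. \<exists>t. AE x in rho S. eta S t x *\<^sub>R \<psi> x = 0}"

definition L2_fc :: "'h::complex_hilbert wave_dynamics \<Rightarrow> 'h wave set" where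
  "L2_fc S = {\<psi> \<in> L2_loc S. \<exists>t. AE x in rho S. (1 - eta S t x) *\<^sub>R \<psi> x = 0}"

definition L2_tc :: "'h::complex_hilbert wave_dynamics \<Rightarrow> 'h wave set" where
  "L2_tc S = L2_pc S \<inter> L2_fc S"

definition L2_null :: "'h::complex_hilbert wave_dynamics \<Rightarrow> 'h wave set" where
  "L2_null S = {\<psi> \<in> L2_loc S. AE x in rho S. \<psi> x = 0}"

definition Cvary_loc :: "'h::complex_hilbert wave_dynamics \<Rightarrow> 'h wave set" where
  "Cvary_loc S = Cvary S \<inter> L2_loc S"

definition Cvary_sc :: "'h::complex_hilbert wave_dynamics \<Rightarrow> 'h wave set" where
  "Cvary_sc S = {\<psi> \<in> Cvary S. \<forall>t0 t1. t0 < t1 \<longrightarrow>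
     (\<exists>K. compact K \<and> K \<subseteq> spacetime S \<and> (\<forall>x\<in>time_strip S t0 t1 - K. \<psi> x = 0))}"

definition krein_inner :: "'h::complex_hilbert wave_dynamics \<Rightarrow> 'h wave \<Rightarrow> 'h wave \<Rightarrow> complex" where
  "krein_inner S \<psi> \<phi> = (LINT x|rho S. spin_inner x (\<psi> x) (\<phi> x))"

definition Cvary0_perp :: "'h::complex_hilbert wave_dynamics \<Rightarrow> 'h wave set" where
  "Cvary0_perp S = {w \<in> L2_loc S. \<forall>\<phi>\<in>Cvary0 S. krein_inner S \<phi> w = 0}"


section \<open>The dynamical operator\<close>

definition symmetric_kernel :: "'h::complex_hilbert wave_dynamics \<Rightarrow> bool" where
  "symmetric_kernel S \<longleftrightarrow> (\<forall>x\<in>spacetime S. \<forall>y\<in>spacetime S.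
     (\<forall>u\<in>spin_space y. kern S x y u \<in> spin_space x) \<and>
     (\<forall>u\<in>spin_space y. \<forall>v\<in>spin_space y. kern S x y (u + v) = kern S x y u + kern S x y v) \<and>
     (\<forall>c. \<forall>u\<in>spin_space y. kern S x y (c *\<^sub>C u) = c *\<^sub>C kern S x y u) \<and>
     (\<forall>u\<in>spin_space x. \<forall>v\<in>spin_space y. spin_inner x u (kern S x y v) = spin_inner y (kern S y x u) v))"

definition Qdyn :: "'h::complex_hilbert wave_dynamics \<Rightarrow> 'h wave \<Rightarrow> 'h wave" where
  "Qdyn S \<psi> = (\<lambda>x. if x \<in> spacetime S
     then (LINT y|rho S. kern S x y (\<psi> y)) + diagc S *\<^sub>R \<psi> x else 0)"

definition finite_time_range :: "'h::complex_hilbert wave_dynamics \<Rightarrow> bool" where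
  "finite_time_range S \<longleftrightarrow>
     (\<exists>r>0. \<forall>t0 t1. \<bar>t1 - t0\<bar> > r \<longrightarrow>
        (\<forall>x\<in>supp_on S (theta S t0). \<forall>y\<in>supp_on S (theta S t1). \<forall>u\<in>spin_space y. kern S x y u = 0)) \<and>
     (\<forall>\<psi>\<in>L2_loc S. (AE x in rho S. integrable (rho S) (\<lambda>y. kern S x y (\<psi> y))) \<and> Qdyn S \<psi> \<in> L2_loc S)"

text \<open>The diagonal part of the kernel drops out of the surface layer form, since the
  softened characteristic function vanishes for \<open>x = y\<close>.\<close>

definition layer_weight :: "'h::complex_hilbert wave_dynamics \<Rightarrow> real \<Rightarrow> 'h op \<Rightarrow> 'h op \<Rightarrow> real" where
  "layer_weight S t x y = eta S t x * (1 - eta S t y) - (1 - eta S t x) * eta S t y"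

definition surface_layer_form ::
  "'h::complex_hilbert wave_dynamics \<Rightarrow> real \<Rightarrow> 'h wave \<Rightarrow> 'h wave \<Rightarrow> complex" where
  "surface_layer_form S t \<psi> \<phi> = - 2 * \<i> * (LINT x|rho S. LINT y|rho S.
     of_real (layer_weight S t x y) * spin_inner x (\<psi> x) (kern S x y (\<phi> y)))"

definition surface_layer_norm :: "'h::complex_hilbert wave_dynamics \<Rightarrow> real \<Rightarrow> 'h wave \<Rightarrow> real" where
  "surface_layer_norm S t \<psi> = sqrt (Re (surface_layer_form S t \<psi> \<psi>))"

text \<open>Existence of the double integrals in the sense that Fubini's theorem applies.\<close>

definition double_integrals_exist :: "'h::complex_hilbert wave_dynamics \<Rightarrow> bool" where
  "double_integrals_exist S \<longleftrightarrow>
     (\<forall>t. \<forall>\<psi>\<in>L2_loc S. \<forall>\<phi>\<in>L2_loc S. integrable (rho S \<Otimes>\<^sub>M rho S)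
        (\<lambda>(x, y). of_real (layer_weight S t x y) * spin_inner x (\<psi> x) (kern S x y (\<phi> y)))) \<and>
     (\<forall>\<psi>\<in>L2_tc S. \<forall>\<phi>\<in>L2_loc S. integrable (rho S \<Otimes>\<^sub>M rho S)
        (\<lambda>(x, y). spin_inner x (\<psi> x) (kern S x y (\<phi> y))))"

definition hyperbolicity_condition :: "'h::complex_hilbert wave_dynamics \<Rightarrow> bool" where
  "hyperbolicity_condition S \<longleftrightarrow> (\<forall>t0 tmax. \<exists>C>0. \<forall>t\<in>{t0..tmax}. \<forall>\<psi>\<in>Cvary_loc S.
     integrable (rho S) (\<lambda>x. theta S t x * Re (eucl_inner x (\<psi> x) (\<psi> x))) \<and>
     Re (surface_layer_form S t \<psi> \<psi>)
       \<ge> 1 / C\<^sup>2 * (LINT x|rho S. theta S t x * Re (eucl_inner x (\<psi> x) (\<psi> x))))"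

definition wave_setting :: "'h::complex_hilbert wave_dynamics \<Rightarrow> bool" where
  "wave_setting S \<longleftrightarrow> operator_manifold S \<and> locally_finite_regular_measure S \<and> causal_structure S \<and>
     Cvary S \<subseteq> continuous_waves S \<and> wave_subspace (Cvary S) \<and>
     global_foliation S \<and> symmetric_kernel S \<and> double_integrals_exist S"


section \<open>Canonical solutions and shielding\<close>

definition test_ret :: "'h::complex_hilbert wave_dynamics \<Rightarrow> real \<Rightarrow> 'h wave set" where
  "test_ret S t = {\<psi> \<in> Cvary0 S. (\<forall>x. (1 - eta S t x) *\<^sub>R \<psi> x = 0) \<and>
     (\<forall>t'\<ge>t. surface_layer_norm S t' \<psi> = 0)}"

definition test_adv :: "'h::complex_hilbert wave_dynamics \<Rightarrow> real \<Rightarrow> 'h wave set" where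
  "test_adv S t = {\<psi> \<in> Cvary0 S. (\<forall>x. eta S t x *\<^sub>R \<psi> x = 0) \<and>
     (\<forall>t'\<le>t. surface_layer_norm S t' \<psi> = 0)}"

text \<open>Elements of the completion of the test space \<open>T\<close> are given as pairs \<open>(V, g)\<close>, where \<open>V\<close> is
  the associated vector of \<open>L\<^sup>2(L)\<close> and \<open>g\<close> is the value on it of the continuous extension of
  the dynamical operator. Due to the energy estimate, the norm \<open>\<parallel>Q \<phi>\<parallel>\<close> in \<open>L\<^sup>2(L)\<close> is equivalent
  to the graph norm, so that these pairs do form the completion.\<close>

definition strip_space :: "'h::complex_hilbert wave_dynamics \<Rightarrow> 'h wave set \<Rightarrow> real \<Rightarrow> real \<Rightarrow>
    ('h wave \<times> 'h wave) set" where
  "strip_space S T t0 t1 = {(V, g).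
     (\<forall>x. eta S t1 x - eta S t0 x = 0 \<longrightarrow> V x = 0 \<and> g x = 0) \<and>
     (\<exists>\<phi>::nat \<Rightarrow> 'h wave. (\<forall>k. \<phi> k \<in> T) \<and>
        L2_tendsto S t0 t1 \<phi> V sequentially \<and>
        L2_tendsto S t0 t1 (\<lambda>k. Qdyn S (\<phi> k)) g sequentially)}"

abbreviation space_ret :: "'h::complex_hilbert wave_dynamics \<Rightarrow> real \<Rightarrow> real \<Rightarrow> ('h wave \<times> 'h wave) set" where
  "space_ret S tmin tmax \<equiv> strip_space S (test_ret S tmax) tmin tmax"

abbreviation space_adv :: "'h::complex_hilbert wave_dynamics \<Rightarrow> real \<Rightarrow> real \<Rightarrow> ('h wave \<times> 'h wave) set" where
  "space_adv S tmin tmax \<equiv> strip_space S (test_adv S tmin) tmin tmax"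

definition is_canonical :: "'h::complex_hilbert wave_dynamics \<Rightarrow> 'h wave set \<Rightarrow> real \<Rightarrow> real \<Rightarrow>
    'h wave \<Rightarrow> 'h wave \<Rightarrow> bool" where
  "is_canonical S T t0 t1 w \<psi> \<longleftrightarrow> w \<in> L2_strip S t0 t1 \<and>
     (\<exists>V g. (V, g) \<in> strip_space S T t0 t1 \<and>
        (\<forall>(u, h)\<in>strip_space S T t0 t1.
           L2_inner S t0 t1 (sign_op S w) u = L2_inner S t0 t1 g h) \<and>
        \<psi> = sign_op S g)"

text \<open>In the condition \<open>orth_on\<close> the integrand is required to be integrable, since otherwise
  the Bochner integral would be zero by convention.\<close>

definition orth_on :: "'h::complex_hilbert wave_dynamics \<Rightarrow> 'h op set \<Rightarrow> 'h wave \<Rightarrow> 'h wave \<Rightarrow> bool" where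
  "orth_on S X u v \<longleftrightarrow> set_integrable (rho S) X (\<lambda>x. eucl_inner x (u x) (v x)) \<and>
     (LINT x:X|rho S. eucl_inner x (u x) (v x)) = 0"

definition shielded_ret :: "'h::complex_hilbert wave_dynamics \<Rightarrow> bool" where
  "shielded_ret S \<longleftrightarrow> (\<forall>t0 t1. t0 < t1 \<longrightarrow> (\<exists>t1' t0'. t1' > t1 \<and> t0' < t0 \<and>
     (\<forall>tmax\<ge>t1'. \<forall>\<^sub>F tmin in at_bot. tmin < t0' \<and>
        (\<forall>(V1, g1)\<in>space_ret S tmin tmax. \<forall>(V2, g2)\<in>space_ret S t0' tmax.
           let u = (\<lambda>x. g1 x + (1 - eta S t0' x) *\<^sub>R g2 x) in
             (\<forall>\<psi>\<in>test_ret S t1'. orth_on S (time_strip S tmin t1') u (Qdyn S \<psi>)) \<longrightarrow>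
             (AE x in rho S. x \<in> time_strip S tmin t1 \<longrightarrow> u x = 0)))))"

definition shielded_adv :: "'h::complex_hilbert wave_dynamics \<Rightarrow> bool" where
  "shielded_adv S \<longleftrightarrow> (\<forall>t0 t1. t0 < t1 \<longrightarrow> (\<exists>t1' t0'. t1' > t1 \<and> t0' < t0 \<and>
     (\<forall>tmin\<le>t0'. \<forall>\<^sub>F tmax in at_top. tmax > t1' \<and>
        (\<forall>(V1, g1)\<in>space_adv S tmin tmax. \<forall>(V2, g2)\<in>space_adv S tmin t1'.
           let u = (\<lambda>x. g1 x + eta S t1' x *\<^sub>R g2 x) in
             (\<forall>\<psi>\<in>test_adv S t0'. orth_on S (time_strip S t0' tmax) u (Qdyn S \<psi>)) \<longrightarrow>
             (AE x in rho S. x \<in> time_strip S t0 tmax \<longrightarrow> u x = 0)))))"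


section \<open>Green's operators\<close>

text \<open>\<open>green_ret S w u\<close> states that the iterated limit defining the retarded Green's operator
  exists for \<open>w\<close> and that \<open>u\<close> represents it (\<open>u\<close> is unique up to null functions). For fixed
  \<open>tmin\<close> the canonical solutions live in the future of \<open>tmin\<close> only, so that the inner limit
  is taken in \<open>L\<^sup>2(L)\<close> for all time strips \<open>L\<close> therein.\<close>

definition green_ret :: "'h::complex_hilbert wave_dynamics \<Rightarrow> 'h wave \<Rightarrow> 'h wave \<Rightarrow> bool" where
  "green_ret S w u \<longleftrightarrow> w \<in> L2_pc S \<and> u \<in> L2_pc S \<and>
     (\<exists>f v.
       (\<forall>\<^sub>F tmin in at_bot.
          (\<forall>\<^sub>F tmax in at_top. is_canonical S (test_ret S tmax) tmin tmax w (f tmin tmax)) \<and>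
          (\<forall>t0 t1. tmin \<le> t0 \<and> t0 < t1 \<longrightarrow> L2_tendsto S t0 t1 (f tmin) (v tmin) at_top)) \<and>
       (\<forall>t0 t1. t0 < t1 \<longrightarrow> L2_tendsto S t0 t1 v (\<lambda>x. - u x) at_bot))"

definition green_adv :: "'h::complex_hilbert wave_dynamics \<Rightarrow> 'h wave \<Rightarrow> 'h wave \<Rightarrow> bool" where
  "green_adv S w u \<longleftrightarrow> w \<in> L2_fc S \<and> u \<in> L2_fc S \<and>
     (\<exists>f v.
       (\<forall>\<^sub>F tmax in at_top.
          (\<forall>\<^sub>F tmin in at_bot. is_canonical S (test_adv S tmin) tmin tmax w (f tmax tmin)) \<and>
          (\<forall>t0 t1. t0 < t1 \<and> t1 \<le> tmax \<longrightarrow> L2_tendsto S t0 t1 (f tmax) (v tmax) at_bot)) \<and>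
       (\<forall>t0 t1. t0 < t1 \<longrightarrow> L2_tendsto S t0 t1 v (\<lambda>x. - u x) at_top))"

definition s_ret :: "'h::complex_hilbert wave_dynamics \<Rightarrow> 'h wave \<Rightarrow> 'h wave" where
  "s_ret S w = (SOME u. green_ret S w u)"

definition s_adv :: "'h::complex_hilbert wave_dynamics \<Rightarrow> 'h wave \<Rightarrow> 'h wave" where
  "s_adv S w = (SOME u. green_adv S w u)"

definition causal_fundamental_solution :: "'h::complex_hilbert wave_dynamics \<Rightarrow> 'h wave \<Rightarrow> 'h wave" where
  "causal_fundamental_solution S w = (\<lambda>x. (\<i> / 2) *\<^sub>C (s_adv S w x - s_ret S w x))"


section \<open>The spaces of the exact sequence\<close>

text \<open>Equalities of Green's operators and memberships like \<open>s\<^sup>\<or>\<psi> \<in> C\<^sup>v\<^sup>a\<^sup>r\<^sup>y\<^sub>s\<^sub>c\<close> refer to equivalence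
  classes of functions which coincide almost everywhere.\<close>

definition W0_space :: "'h::complex_hilbert wave_dynamics \<Rightarrow> 'h wave set" where
  "W0_space S = {\<psi> \<in> Cvary0 S.
     green_adv S (Qdyn S \<psi>) (\<lambda>x. - \<psi> x) \<and> green_ret S (Qdyn S \<psi>) (\<lambda>x. - \<psi> x)}"

definition Wtc_space :: "'h::complex_hilbert wave_dynamics \<Rightarrow> 'h wave set" where
  "Wtc_space S = {\<psi> \<in> L2_tc S. (\<exists>u\<in>Cvary_sc S. green_adv S \<psi> u) \<and> (\<exists>u\<in>Cvary_sc S. green_ret S \<psi> u)}"

definition WE_space :: "'h::complex_hilbert wave_dynamics \<Rightarrow> 'h wave set" where
  "WE_space S = {\<zeta> \<in> L2_loc S. \<exists>\<psi>1\<in>L2_fc S. \<exists>\<psi>2\<in>L2_pc S. \<exists>u1\<in>Cvary_sc S. \<exists>u2\<in>Cvary_sc S.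
     green_adv S \<psi>1 u1 \<and> green_ret S \<psi>2 u2 \<and> (AE x in rho S. \<zeta> x = u1 x + u2 x)}"

definition WE_star_space :: "'h::complex_hilbert wave_dynamics \<Rightarrow> 'h wave set" where
  "WE_star_space S = {(\<lambda>x. \<psi>1 x + \<psi>2 x) | \<psi>1 \<psi>2.
     \<psi>1 \<in> L2_fc S \<and> (\<exists>u\<in>Cvary_sc S. green_adv S \<psi>1 u) \<and>
     \<psi>2 \<in> L2_pc S \<and> (\<exists>u\<in>Cvary_sc S. green_ret S \<psi>2 u)}"

definition Wtc_null :: "'h::complex_hilbert wave_dynamics \<Rightarrow> 'h wave set" where
  "Wtc_null S = Wtc_space S \<inter> Cvary0_perp S"

definition WE_star_null :: "'h::complex_hilbert wave_dynamics \<Rightarrow> 'h wave set" where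
  "WE_star_null S = {(\<lambda>x. n1 x + n2 x) | n1 n2.
     n1 \<in> Cvary0_perp S \<inter> L2_fc S \<and> n2 \<in> Cvary0_perp S \<inter> L2_pc S}"

definition wave_group :: "'h::complex_hilbert wave set \<Rightarrow> 'h wave monoid" where
  "wave_group X = \<lparr>carrier = X, monoid.mult = (\<lambda>\<psi> \<phi> x. \<psi> x + \<phi> x), one = (\<lambda>x. 0)\<rparr>"

abbreviation quot :: "'h::complex_hilbert wave set \<Rightarrow> 'h wave set \<Rightarrow> 'h wave set monoid" where
  "quot X Y \<equiv> wave_group X Mod Y"

text \<open>The map induced by \<open>f\<close> between quotients; the value \<open>induced f Y' A\<close> is a single coset of \<open>Y'\<close>
  if and only if \<open>f\<close> respects the equivalence relations on \<open>A\<close>.\<close>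

definition induced ::
  "('h::complex_hilbert wave \<Rightarrow> 'h wave) \<Rightarrow> 'h wave set \<Rightarrow> 'h wave set \<Rightarrow> 'h wave set" where
  "induced f Y' A = (\<Union>\<psi>\<in>A. Y' #>\<^bsub>wave_group UNIV\<^esub> f \<psi>)"

definition coset_scale :: "'h::complex_hilbert wave set \<Rightarrow> complex \<Rightarrow> 'h wave set \<Rightarrow> 'h wave set" where
  "coset_scale Y c = induced (\<lambda>\<psi> x. c *\<^sub>C \<psi> x) Y"

definition chomogeneous :: "'h::complex_hilbert wave set \<Rightarrow> 'h wave set \<Rightarrow>
    'h wave set \<Rightarrow> 'h wave set \<Rightarrow> ('h wave set \<Rightarrow> 'h wave set) \<Rightarrow> bool" where
  "chomogeneous X Y X' Y' F \<longleftrightarrow> (\<forall>c. \<forall>A\<in>carrier (quot X Y).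
     coset_scale Y c A \<in> carrier (quot X Y) \<and>
     coset_scale Y' c (F A) \<in> carrier (quot X' Y') \<and>
     F (coset_scale Y c A) = coset_scale Y' c (F A))"

abbreviation W_0 :: "'h::complex_hilbert wave_dynamics \<Rightarrow> 'h wave set monoid" where
  "W_0 S \<equiv> quot (W0_space S) {\<lambda>x. 0}"

abbreviation W_tc_star :: "'h::complex_hilbert wave_dynamics \<Rightarrow> 'h wave set monoid" where
  "W_tc_star S \<equiv> quot (Wtc_space S) (Wtc_null S)"

abbreviation W_E :: "'h::complex_hilbert wave_dynamics \<Rightarrow> 'h wave set monoid" where
  "W_E S \<equiv> quot (WE_space S) (L2_null S)"

abbreviation W_E_star :: "'h::complex_hilbert wave_dynamics \<Rightarrow> 'h wave set monoid" where
  "W_E_star S \<equiv> quot (WE_star_space S) (WE_star_null S)"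

abbreviation zero_space :: "'h::complex_hilbert wave set monoid" where
  "zero_space \<equiv> quot {\<lambda>x. 0} {\<lambda>x. 0}"

text \<open>In \<open>exact_seq\<close>, the groups and the maps are listed from right to left. Exactness as a
  sequence of complex vector spaces is exactness as a sequence of additive groups together with
  the complex homogeneity of the maps.\<close>

end

theory Submission
  imports Defs
begin

text \<open>
  The limits defining the Green's operators are additive, unique almost everywhere and zero on
  functions orthogonal to the test functions. Testing the canonical solutions with a fixed
  \<open>\<phi> \<in> C\<^sup>v\<^sup>a\<^sup>r\<^sup>y\<^sub>0\<close>, for which \<open>Q \<phi>\<close> has compact time support, one obtains
  \<open><Q \<phi>|s w> = - <\<phi>|w>\<close> in the limit, and by symmetry of \<open>Q\<close> that \<open>Q s w = - w\<close> modulo the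
  orthogonal complement. Exactness is then algebra, except for one point: a function lying in the
  images of both Green's operators is supported in a time strip, so that spatial compactness
  makes it an element of \<open>C\<^sup>v\<^sup>a\<^sup>r\<^sup>y\<^sub>0\<close>.

  To have the spin inner product measurable, \<open>sgn x\<close> is obtained as a strong limit of
  polynomials in \<open>x\<close>. The advanced statements follow from the retarded ones by time reversal.
\<close>

section \<open>Complex Hilbert spaces\<close>

text \<open>Each space of the sequence carries witnesses for its Green's limits, so the proof works
  with the relations \<open>green_ret\<close> and \<open>green_adv\<close>; chosen values enter only
  through \<open>causal_fundamental_solution\<close>. That a limit vanishes is an energy argument:
  inserting the canonical vector V into its own defining equation gives the squared norm of Q V as
  the Krein product of w and V, and V is an L2 limit of test functions, to which w is orthogonal. By
  linearity this yields uniqueness and invariance modulo the orthogonal complement. Most equations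
  hold only almost everywhere, because the integrals defining Q converge only there; where a
  function must lie in \<open>Cvary0\<close>, continuity and M = supp rho make them pointwise. At
  \<open>W_E\<close> the two error terms of Q s = -1 live in different spaces, one future compact
  and one past compact; moving each to its own side produces a single source that is both, hence
  time compact. The factor i/2 of k is then undone by -2i.\<close>

lemma cinner_add_left: "cinner (u + v) w = cinner u w + cinner (v::'h::complex_hilbert) w"
  by (metis cinner_commute cinner_add_right complex_cnj_add)

lemma cinner_scaleC_left: "cinner (c *\<^sub>C u) w = cnj c * cinner (u::'h::complex_hilbert) w"
  by (metis cinner_commute cinner_scaleC_right complex_cnj_mult)

lemma cinner_scaleR_right: "cinner u (r *\<^sub>R v) = of_real r * cinner u (v::'h::complex_hilbert)"
  by (simp add: scaleR_scaleC cinner_scaleC_right)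

lemma cinner_scaleR_left: "cinner (r *\<^sub>R u) v = of_real r * cinner u (v::'h::complex_hilbert)"
  by (simp add: scaleR_scaleC cinner_scaleC_left)

lemma cinner_zero_right [simp]: "cinner u (0::'h::complex_hilbert) = 0"
  using cinner_scaleR_right[of u 0 0] by simp

lemma cinner_zero_left [simp]: "cinner (0::'h::complex_hilbert) u = 0"
  using cinner_scaleR_left[of 0 0 u] by simp

lemma cinner_self: "cinner u u = of_real ((norm (u::'h::complex_hilbert))\<^sup>2)"
proof -
  have "Im (cinner u u) = 0"
    by (metis add_0 cinner_commute complex_cnj_cancel_iff complex_is_Real_iff Reals_cnj_iff)
  moreover have "Re (cinner u u) \<ge> 0"
    using norm_ge_zero[of u] unfolding norm_eq_sqrt_cinner by simp
  ultimately show ?thesis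
    by (simp add: complex_eq_iff norm_eq_sqrt_cinner)
qed

lemma cinner_diff_right: "cinner u (v - w) = cinner u v - cinner u (w::'h::complex_hilbert)"
  using cinner_add_right[of u v "- w"] cinner_scaleR_right[of u "-1" w] by simp

lemma cinner_diff_left: "cinner (u - v) w = cinner u w - cinner (v::'h::complex_hilbert) w"
  using cinner_add_left[of u "- v" w] cinner_scaleR_left[of "-1" v w] by simp

lemma norm_scaleC: "norm (c *\<^sub>C u) = cmod c * norm (u::'h::complex_hilbert)"
proof -
  have "of_real ((norm (c *\<^sub>C u))\<^sup>2) = cinner (c *\<^sub>C u) (c *\<^sub>C u)"
    by (simp add: cinner_self)
  also have "\<dots> = (cnj c * c) * of_real ((norm u)\<^sup>2)"
    by (subst cinner_self[symmetric]) (simp add: cinner_scaleC_left cinner_scaleC_right)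
  also have "\<dots> = of_real ((cmod c * norm u)\<^sup>2)"
    by (simp add: complex_norm_square[symmetric] mult.commute power_mult_distrib)
  finally have "(norm (c *\<^sub>C u))\<^sup>2 = (cmod c * norm u)\<^sup>2"
    using of_real_eq_iff by blast
  then show ?thesis by simp
qed

lemma Cauchy_Schwarz_cinner: "cmod (cinner u v) \<le> norm u * norm (v::'h::complex_hilbert)"
proof (cases "v = 0")
  case False
  \<comment> \<open>The vector c v is the orthogonal projection of u onto v; the inequality is then
    the non-negativity of the squared norm of u - c v.\<close>
  define c where "c = cinner v u / of_real ((norm v)\<^sup>2)"
  have nz: "norm v > 0" using False by simp
  have cu: "cinner u v = cnj (cinner v u)" by (rule cinner_commute)
  have "of_real ((norm (u - c *\<^sub>C v))\<^sup>2) = cinner (u - c *\<^sub>C v) (u - c *\<^sub>C v)"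
    by (simp only: cinner_self)
  also have "\<dots> = cinner u u - c * cinner u v - cnj c * cinner v u + cnj c * c * cinner v v"
    by (simp add: cinner_diff_left cinner_diff_right cinner_scaleC_left cinner_scaleC_right
      algebra_simps)
  also have "cnj c * c * cinner v v = cnj c * cinner v u"
    using nz by (simp add: cinner_self c_def power2_eq_square)
  also have "cinner u u - c * cinner u v - cnj c * cinner v u + cnj c * cinner v u
      = of_real ((norm u)\<^sup>2) - c * cnj (cinner v u)"
    by (simp add: cinner_self) (simp add: cu)
  also have "c * cnj (cinner v u) = of_real ((cmod (cinner u v))\<^sup>2 / (norm v)\<^sup>2)"
    using complex_norm_square[of "cinner v u"] by (simp add: c_def cu)
  finally have "(norm (u - c *\<^sub>C v))\<^sup>2 = (norm u)\<^sup>2 - (cmod (cinner u v))\<^sup>2 / (norm v)\<^sup>2"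
    by (metis of_real_diff of_real_eq_iff)
  then have "(cmod (cinner u v))\<^sup>2 / (norm v)\<^sup>2 \<le> (norm u)\<^sup>2"
    by (metis diff_ge_0_iff_ge zero_le_power2)
  then have "(cmod (cinner u v))\<^sup>2 \<le> (norm u * norm v)\<^sup>2"
    using nz by (simp add: divide_simps power_mult_distrib)
  then show ?thesis
    by (rule power2_le_imp_le) simp
qed simp

lemma bounded_bilinear_cinner:
  "bounded_bilinear (cinner :: 'h::complex_hilbert \<Rightarrow> 'h \<Rightarrow> complex)"
  by standard (use Cauchy_Schwarz_cinner in \<open>auto simp: cinner_add_left cinner_add_right
    cinner_scaleR_left cinner_scaleR_right scaleR_conv_of_real intro!: exI[of _ 1]\<close>)

lemmas cinner_sum_left = bounded_bilinear.sum_left[OF bounded_bilinear_cinner]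
lemmas cinner_sum_right = bounded_bilinear.sum_right[OF bounded_bilinear_cinner]
lemmas cinner_minus_left = bounded_bilinear.minus_left[OF bounded_bilinear_cinner]
lemmas cinner_minus_right = bounded_bilinear.minus_right[OF bounded_bilinear_cinner]
lemmas continuous_on_cinner [continuous_intros] =
  bounded_bilinear.continuous_on[OF bounded_bilinear_cinner]

lemma bounded_linear_scaleC: "bounded_linear (\<lambda>u::'h::complex_hilbert. c *\<^sub>C u)"
  by (rule bounded_linear_intro[of _ "cmod c"])
    (auto simp: scaleC_add_right scaleR_scaleC scaleC_scaleC norm_scaleC mult.commute)

lemma bounded_linear_scaleC_left: "bounded_linear (\<lambda>c. c *\<^sub>C (u::'h::complex_hilbert))"
  by (rule bounded_linear_intro[of _ "norm u"])
    (auto simp: scaleC_add_left scaleR_scaleC[where ?'a='h] scaleC_scaleC norm_scaleC scaleR_conv_of_real)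

lemma scaleC_diff_right: "c *\<^sub>C (u - v) = c *\<^sub>C u - c *\<^sub>C (v::'h::complex_hilbert)"
  by (rule complex_vector.scale_right_diff_distrib)

lemma cinner_ext: "(\<And>w. cinner w u = cinner w v) \<Longrightarrow> u = (v::'h::complex_hilbert)"
  using cinner_self[of "u - v"] by (simp add: cinner_diff_right)

lemma norm_eq_0_cinner: "cinner u u = 0 \<Longrightarrow> u = (0::'h::complex_hilbert)"
  by (simp add: cinner_self)


section \<open>The spectral theorem for self-adjoint operators of finite rank\<close>

definition orthonormal :: "'h::complex_hilbert set \<Rightarrow> bool" where
  "orthonormal B \<longleftrightarrow> (\<forall>b\<in>B. \<forall>c\<in>B. cinner b c = (if b = c then 1 else 0))"

lemma orthonormal_cinner: "orthonormal B \<Longrightarrow> b \<in> B \<Longrightarrow> c \<in> B \<Longrightarrow> cinner b c = (if b = c then 1 else 0)"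
  by (simp add: orthonormal_def)

lemma orthonormal_norm: "orthonormal B \<Longrightarrow> b \<in> B \<Longrightarrow> norm b = 1"
  using cinner_self[of b] orthonormal_cinner[of B b b] 
  by (metis of_real_eq_1_iff norm_ge_zero power2_eq_1_iff neg_0_le_iff_le not_one_le_zero)

lemma orthonormal_coeff:
  assumes "orthonormal B" "finite B" "b \<in> B"
  shows "cinner b (\<Sum>c\<in>B. f c *\<^sub>C c) = f b"
proof -
  have "cinner b (\<Sum>c\<in>B. f c *\<^sub>C c) = (\<Sum>c\<in>B. if b = c then f c else 0)"
    by (auto simp: cinner_sum_right cinner_scaleC_right orthonormal_cinner[OF assms(1,3)]
      intro!: sum.cong)
  also have "\<dots> = f b"
    using assms by simp
  finally show ?thesis .
qed

lemma span_orthonormal: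
  assumes "orthonormal B" "finite B"
  shows "u \<in> complex_vector.span B \<longleftrightarrow> u = (\<Sum>b\<in>B. cinner b u *\<^sub>C b)"
proof
  assume "u \<in> complex_vector.span B"
  then obtain f where f: "u = (\<Sum>b\<in>B. f b *\<^sub>C b)"
    using complex_vector.span_finite[OF assms(2)] by auto
  have "cinner b u = f b" if "b \<in> B" for b
    using orthonormal_coeff[OF assms that] f by simp
  then show "u = (\<Sum>b\<in>B. cinner b u *\<^sub>C b)"
    by (subst f) (auto intro!: sum.cong)
next
  assume "u = (\<Sum>b\<in>B. cinner b u *\<^sub>C b)"
  then show "u \<in> complex_vector.span B"
    by (metis (no_types, lifting) complex_vector.span_sum complex_vector.span_scale
      complex_vector.span_base)
qed

lemma orthonormal_insert:
  assumes "orthonormal B" "norm w = 1" "\<And>b. b \<in> B \<Longrightarrow> cinner b w = 0"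
  shows "orthonormal (insert w B)"
proof -
  have "cinner w b = 0" if "b \<in> B" for b
    using assms(3)[OF that] by (subst cinner_commute) simp
  moreover have "w \<notin> B"
    using assms(2) assms(3)[of w] by (auto simp: cinner_self)
  ultimately show ?thesis
    using assms by (auto simp: orthonormal_def cinner_self)
qed

text \<open>Gram-Schmidt; a vector that already equals its projection p adds nothing to the
  basis.\<close>

lemma orthonormal_basis_exists:
  assumes "finite A"
  shows "\<exists>B. finite B \<and> orthonormal B \<and> A \<subseteq> complex_vector.span B"
  using assms
proof (induction A)
  case empty
  then show ?case by (intro exI[of _ "{}"]) (simp add: orthonormal_def)
next
  case (insert v A)
  then obtain B where B: "finite B" "orthonormal B" "A \<subseteq> complex_vector.span B" by blast
  define p where "p = (\<Sum>b\<in>B. cinner b v *\<^sub>C b)"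
  have p: "p \<in> complex_vector.span B"
    unfolding p_def by (intro complex_vector.span_sum complex_vector.span_scale
      complex_vector.span_base)
  show ?case
  proof (cases "v = p")
    case True
    then show ?thesis using B p by blast
  next
    case False
    define w where "w = inverse (norm (v - p)) *\<^sub>R (v - p)"
    have "cinner b (v - p) = 0" if "b \<in> B" for b
      using orthonormal_coeff[OF B(2,1) that] by (simp add: p_def cinner_diff_right)
    then have "cinner b w = 0" if "b \<in> B" for b
      using that by (simp add: w_def cinner_scaleR_right)
    moreover have "norm w = 1" using False by (simp add: w_def)
    ultimately have "orthonormal (insert w B)"
      using orthonormal_insert B(2) by blast
    moreover have "v = p + of_real (norm (v - p)) *\<^sub>C w"
      using False by (simp add: w_def flip: scaleR_scaleC)
    then have "v \<in> complex_vector.span (insert w B)"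
      using p complex_vector.span_mono[of B "insert w B"]
      by (metis complex_vector.span_add complex_vector.span_base complex_vector.span_scale
        insertI1 subset_iff subset_insertI)
    moreover have "A \<subseteq> complex_vector.span (insert w B)"
      using B(3) complex_vector.span_mono[of B "insert w B"] by blast
    ultimately show ?thesis
      using B(1) by (intro exI[of _ "insert w B"]) auto
  qed
qed

lemma orthonormal_independent:
  assumes "orthonormal B" "finite B"
  shows "complex_vector.independent B"
proof -
  have "f b = 0" if "(\<Sum>b\<in>B. f b *\<^sub>C b) = 0" "b \<in> B" for f b
    using orthonormal_coeff[OF assms that(2), of f] that(1) by simp
  then show ?thesis
    using complex_vector.dependent_finite[OF assms(2)] by blast
qed

text \<open>The coefficients of a vector of the unit ball with respect to B are bounded by 1, so the
  ball sits inside a finite sum of compact discs; the span is closed as the fixed point set of a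
  continuous map.\<close>

lemma compact_cball_span:
  fixes B :: "'h::complex_hilbert set"
  assumes "orthonormal B" "finite B"
  shows "compact (cball 0 1 \<inter> complex_vector.span B)"
proof -
  have "\<exists>K. compact K \<and> (\<forall>f. (\<forall>b\<in>A. cmod (f b) \<le> 1) \<longrightarrow> (\<Sum>b\<in>A. f b *\<^sub>C b) \<in> K)"
    if "finite A" for A :: "'h set"
    using that
  proof (induction A)
    case empty
    then show ?case by (intro exI[of _ "{0}"]) simp
  next
    case (insert a A)
    then obtain K where K: "compact K"
      "\<And>f. (\<forall>b\<in>A. cmod (f b) \<le> 1) \<Longrightarrow> (\<Sum>b\<in>A. f b *\<^sub>C b) \<in> K" by blast
    define D where "D = (\<lambda>c. c *\<^sub>C a) ` cball 0 1"
    have "compact D"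
      unfolding D_def by (intro compact_continuous_image compact_cball
        linear_continuous_on bounded_linear_scaleC_left)
    then have "compact {x + y |x y. x \<in> D \<and> y \<in> K}"
      using K(1) by (rule compact_sums)
    moreover have "(\<Sum>b\<in>insert a A. f b *\<^sub>C b) \<in> {x + y |x y. x \<in> D \<and> y \<in> K}"
      if "\<forall>b\<in>insert a A. cmod (f b) \<le> 1" for f
    proof -
      have "f a *\<^sub>C a \<in> D" using that by (auto simp: D_def)
      moreover have "(\<Sum>b\<in>A. f b *\<^sub>C b) \<in> K" using that K(2)[of f] by auto
      ultimately show ?thesis using insert(1,2) by auto
    qed
    ultimately show ?case by blast
  qed
  then obtain K where K: "compact K"
    "\<And>f. (\<forall>b\<in>B. cmod (f b) \<le> 1) \<Longrightarrow> (\<Sum>b\<in>B. f b *\<^sub>C b) \<in> K"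
    using assms(2) by blast
  have "cball 0 1 \<inter> complex_vector.span B \<subseteq> K"
  proof
    fix u assume u: "u \<in> cball 0 1 \<inter> complex_vector.span B"
    have "cmod (cinner b u) \<le> 1" if "b \<in> B" for b
      using Cauchy_Schwarz_cinner[of b u] orthonormal_norm[OF assms(1) that] u by simp
    then show "u \<in> K"
      using K(2)[of "\<lambda>b. cinner b u"] u span_orthonormal[OF assms, of u] by simp
  qed
  moreover have "closed {u::'h. u = (\<Sum>b\<in>B. cinner b u *\<^sub>C b)}"
    by (intro closed_Collect_eq continuous_intros
      bounded_linear.continuous_on[OF bounded_linear_scaleC_left])
  moreover have "complex_vector.span B = {u. u = (\<Sum>b\<in>B. cinner b u *\<^sub>C b)}"
    using span_orthonormal[OF assms] by blast
  ultimately have cl: "closed (complex_vector.span B)" and sub: "cball 0 1 \<inter> complex_vector.span B \<subseteq> K"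
    by (simp_all only:)
  have "cball 0 1 \<inter> complex_vector.span B = K \<inter> (cball 0 1 \<inter> complex_vector.span B)"
    using sub by blast
  moreover have "compact (K \<inter> (cball 0 1 \<inter> complex_vector.span B))"
    using K(1) cl by (intro compact_Int_closed closed_Int closed_cball)
  ultimately show ?thesis
    by simp
qed

lemma selfadjointD: "selfadjoint A \<Longrightarrow> cinner (blinfun_apply A u) v = cinner u (blinfun_apply A v)"
  by (simp add: selfadjoint_def)

lemma selfadjoint_scaleC:
  assumes "selfadjoint (A::'h::complex_hilbert op)"
  shows "blinfun_apply A (c *\<^sub>C u) = c *\<^sub>C blinfun_apply A u"
  by (rule cinner_ext) (simp add: selfadjointD[OF assms, symmetric] cinner_scaleC_right)

text \<open>A maximizer v of norm (x u) on the unit ball of a finite-dimensional space containing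
  the range satisfies x (x v) = m^2 v, with m the maximum. Factoring x^2 - m^2 yields an
  eigenvector: x v + m v for the eigenvalue m if it is non-zero, and otherwise v itself for
  -m.\<close>

lemma selfadjoint_eigenvector_exists:
  fixes x :: "'h::complex_hilbert op"
  assumes sa: "selfadjoint x" and fr: "finite_rank x" and nz: "x \<noteq> 0"
  shows "\<exists>\<mu> c. \<mu> \<noteq> 0 \<and> norm c = 1 \<and> x c = \<mu> *\<^sub>R c"
proof -
  obtain A where A: "finite A" "range x \<subseteq> complex_vector.span A"
    using fr by (auto simp: finite_rank_def cfinite_dim_def)
  obtain B where B: "finite B" "orthonormal B" "A \<subseteq> complex_vector.span B"
    using orthonormal_basis_exists[OF A(1)] by blast
  have rg: "x u \<in> complex_vector.span B" for u
    using A(2) B(3) complex_vector.span_minimal[OF B(3) complex_vector.subspace_span] by blast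
  define K where "K = cball 0 1 \<inter> complex_vector.span B"
  have "compact K" unfolding K_def by (rule compact_cball_span[OF B(2,1)])
  moreover have "0 \<in> K" by (simp add: K_def complex_vector.span_zero)
  ultimately obtain v where v: "v \<in> K" "\<And>u. u \<in> K \<Longrightarrow> norm (x u) \<le> norm (x v)"
    using continuous_attains_sup[of K "\<lambda>u. norm (x u)"]
    by (metis (no_types) empty_iff linear_continuous_on blinfun.bounded_linear_right
      continuous_on_norm)
  define m where "m = norm (x v)"
  have bd: "norm (x u) \<le> m * norm u" if u: "u \<in> complex_vector.span B" for u
  proof (cases "u = 0")
    case False
    have "inverse (norm u) *\<^sub>R u \<in> K"
      using u False by (simp add: K_def scaleR_scaleC[where u = u] complex_vector.span_scale norm_scaleC norm_inverse del: of_real_inverse)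
    then have "norm (x (inverse (norm u) *\<^sub>R u)) \<le> m"
      using v(2) by (simp add: m_def)
    then show ?thesis using False
      by (simp add: blinfun.scaleR_right divide_simps mult.commute)
  qed (simp add: blinfun.zero_right)
  obtain u where u: "x u \<noteq> 0"
    using nz by (metis blinfun_eqI zero_blinfun.rep_eq)
  \<comment> \<open>The vector x u lies in the span and is not annihilated by x, so the maximum m is
    positive.\<close>
  have "x (x u) \<noteq> 0"
    using selfadjointD[OF sa, of u "x u"] u norm_eq_0_cinner[of "x u"] by auto
  then have m0: "m > 0"
    using bd[OF rg, of u] u by (cases "m = 0") (auto simp: m_def)
  have nv: "norm v \<le> 1" using v(1) by (simp add: K_def)
  \<comment> \<open>Expanding the square bounds the squared norm of the defect by m^4 - 2 m^4 + m^4
    = 0.\<close>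
  have "complex_of_real ((norm (x (x v) - m\<^sup>2 *\<^sub>R v))\<^sup>2)
      = cinner (x (x v)) (x (x v)) - of_real (m\<^sup>2) * cinner (x (x v)) v
        - of_real (m\<^sup>2) * cinner v (x (x v)) + of_real (m\<^sup>2 * m\<^sup>2) * cinner v v"
    by (simp only: cinner_self[symmetric] cinner_diff_left cinner_diff_right cinner_scaleR_left
      cinner_scaleR_right) (simp add: algebra_simps)
  also have "\<dots> = of_real ((norm (x (x v)))\<^sup>2 - 2 * m\<^sup>2 * m\<^sup>2 + m\<^sup>2 * m\<^sup>2 * (norm v)\<^sup>2)"
    using selfadjointD[OF sa, of "x v" v] selfadjointD[OF sa, of v "x v"]
    by (simp add: cinner_self m_def)
  finally have "(norm (x (x v) - m\<^sup>2 *\<^sub>R v))\<^sup>2 = (norm (x (x v)))\<^sup>2 - 2 * m\<^sup>2 * m\<^sup>2 + m\<^sup>2 * m\<^sup>2 * (norm v)\<^sup>2"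
    using of_real_eq_iff by blast
  moreover have "(norm (x (x v)))\<^sup>2 \<le> m\<^sup>2 * m\<^sup>2"
    using bd[OF rg[of v]] by (metis m_def norm_ge_zero power_mono power_mult_distrib)
  moreover have "m\<^sup>2 * m\<^sup>2 * (norm v)\<^sup>2 \<le> m\<^sup>2 * m\<^sup>2"
    using nv by (simp add: mult_left_le power_le_one)
  ultimately have "(norm (x (x v) - m\<^sup>2 *\<^sub>R v))\<^sup>2 \<le> 0" by linarith
  then have xx: "x (x v) = m\<^sup>2 *\<^sub>R v" by simp
  have v0: "v \<noteq> 0" using m0 by (auto simp: m_def blinfun.zero_right)
  have "\<exists>\<mu> c. \<mu> \<noteq> 0 \<and> c \<noteq> 0 \<and> x c = \<mu> *\<^sub>R c"
  proof (cases "x v + m *\<^sub>R v = 0")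
    case True
    then have "x v = (-m) *\<^sub>R v" by (simp add: eq_neg_iff_add_eq_0)
    then show ?thesis using m0 v0 by (metis neg_equal_0_iff_equal less_irrefl)
  next
    case False
    have "x (x v + m *\<^sub>R v) = m *\<^sub>R (x v + m *\<^sub>R v)"
      by (simp add: blinfun.add_right blinfun.scaleR_right xx scaleR_add_right power2_eq_square)
    then show ?thesis using m0 False by (metis less_irrefl)
  qed
  then obtain \<mu> c where c: "\<mu> \<noteq> 0" "c \<noteq> 0" "x c = \<mu> *\<^sub>R c" by blast
  then have "x (inverse (norm c) *\<^sub>R c) = \<mu> *\<^sub>R (inverse (norm c) *\<^sub>R c)"
    by (simp add: blinfun.scaleR_right)
  then show ?thesis using c(1,2)
    by (intro exI[of _ \<mu>] exI[of _ "inverse (norm c) *\<^sub>R c"]) auto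
qed

definition rank_one :: "'h::complex_hilbert \<Rightarrow> 'h op" where
  "rank_one b = Blinfun (\<lambda>u. cinner b u *\<^sub>C b)"

lemma rank_one_apply [simp]: "blinfun_apply (rank_one b) u = cinner b u *\<^sub>C b"
proof -
  have "bounded_linear (\<lambda>u. cinner b u *\<^sub>C b)"
    by (intro bounded_linear_compose[OF bounded_linear_scaleC_left]
      bounded_bilinear.bounded_linear_right[OF bounded_bilinear_cinner])
  then show ?thesis by (simp add: rank_one_def bounded_linear_Blinfun_apply)
qed

text \<open>The kernel is not represented in B: on the orthogonal complement of B the result is zero
  whatever f 0 is. So the constant function 1 gives the projection onto the span of B, and
  reciprocals may be used freely once all values of \<open>l\<close> are non-zero.\<close>

definition spectral_calculus :: "'h::complex_hilbert set \<Rightarrow> ('h \<Rightarrow> real) \<Rightarrow> (real \<Rightarrow> real) \<Rightarrow> 'h op" where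
  "spectral_calculus B l f = (\<Sum>b\<in>B. f (l b) *\<^sub>R rank_one b)"

definition diagonalizes :: "'h::complex_hilbert set \<Rightarrow> ('h \<Rightarrow> real) \<Rightarrow> 'h op \<Rightarrow> bool" where
  "diagonalizes B l x \<longleftrightarrow> finite B \<and> orthonormal B \<and> (\<forall>b\<in>B. l b \<noteq> 0) \<and> x = spectral_calculus B l (\<lambda>t. t)"

lemma spectral_calculus_apply:
  "finite B \<Longrightarrow> blinfun_apply (spectral_calculus B l f) u = (\<Sum>b\<in>B. f (l b) *\<^sub>R (cinner b u *\<^sub>C b))"
  by (simp add: spectral_calculus_def blinfun.sum_left blinfun.scaleR_left)

lemma spectral_calculus_selfadjoint: "selfadjoint (spectral_calculus B l f)"
proof (cases "finite B")
  case True
  show ?thesis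
    unfolding selfadjoint_def spectral_calculus_apply[OF True]
  proof (intro allI)
    fix u v
    have "cinner (f (l b) *\<^sub>R (cinner b u *\<^sub>C b)) v = cinner u (f (l b) *\<^sub>R (cinner b v *\<^sub>C b))" for b
      using cinner_commute[of u b]
      by (simp add: cinner_scaleR_left cinner_scaleR_right cinner_scaleC_left cinner_scaleC_right)
    then show "cinner (\<Sum>b\<in>B. f (l b) *\<^sub>R (cinner b u *\<^sub>C b)) v
        = cinner u (\<Sum>b\<in>B. f (l b) *\<^sub>R (cinner b v *\<^sub>C b))"
      by (simp add: cinner_sum_left cinner_sum_right)
  qed
qed (simp add: spectral_calculus_def selfadjoint_def)

text \<open>A finite orthonormal family of eigenvectors with non-zero eigenvalues lies in the range
  of x, so its cardinality is bounded and a largest one exists. If the remainder y after splitting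
  off its diagonal part D were non-zero, an eigenvector of y would enlarge the family.\<close>

lemma spectral_theorem:
  fixes x :: "'h::complex_hilbert op"
  assumes sa: "selfadjoint x" and fr: "finite_rank x"
  shows "\<exists>B l. diagonalizes B l x"
proof -
  obtain A where A: "finite A" "range x \<subseteq> complex_vector.span A"
    using fr by (auto simp: finite_rank_def cfinite_dim_def)
  define P where "P B \<longleftrightarrow> finite B \<and> orthonormal B \<and> (\<exists>l. \<forall>b\<in>B. l b \<noteq> 0 \<and> x b = l b *\<^sub>R b)" for B
  have "B \<subseteq> complex_vector.span A" if "P B" for B
  proof
    fix b assume "b \<in> B"
    then obtain \<mu> :: real where "\<mu> \<noteq> 0" "x b = \<mu> *\<^sub>R b" using \<open>P B\<close> by (auto simp: P_def)
    then have "b = of_real (inverse \<mu>) *\<^sub>C x b" by (simp del: of_real_inverse flip: scaleR_scaleC)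
    then show "b \<in> complex_vector.span A"
      using A(2) complex_vector.span_scale by (metis rangeI subset_iff)
  qed
  then have bound: "card B < Suc (card A)" if "P B" for B
    using complex_vector.independent_span_bound[OF A(1)] orthonormal_independent that
    by (metis P_def le_imp_less_Suc)
  have "P {}" by (simp add: P_def orthonormal_def)
  then obtain B where B: "P B" "\<And>C. P C \<Longrightarrow> card C \<le> card B"
    using ex_has_greatest_nat[of P "{}" card] bound by (metis less_imp_le)
  then obtain l where l: "finite B" "orthonormal B" "\<And>b. b \<in> B \<Longrightarrow> l b \<noteq> 0"
    "\<And>b. b \<in> B \<Longrightarrow> x b = l b *\<^sub>R b"
    by (auto simp: P_def)
  define D where "D = spectral_calculus B l (\<lambda>t. t)"
  define y where "y = x - D"
  have say: "selfadjoint y"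
    using sa spectral_calculus_selfadjoint[of B l "\<lambda>t. t"]
    by (simp add: selfadjoint_def y_def D_def blinfun.diff_left cinner_diff_left cinner_diff_right)
  have "range y \<subseteq> complex_vector.span (A \<union> B)"
  proof
    fix z assume "z \<in> range y"
    then obtain u where "z = x u - D u" by (auto simp: y_def blinfun.diff_left)
    moreover have "x u \<in> complex_vector.span (A \<union> B)"
      using A(2) complex_vector.span_mono[of A "A \<union> B"] by blast
    moreover have "D u \<in> complex_vector.span (A \<union> B)"
      unfolding D_def spectral_calculus_apply[OF l(1)] scaleR_scaleC
      by (intro complex_vector.span_sum complex_vector.span_scale complex_vector.span_base) simp
    ultimately show "z \<in> complex_vector.span (A \<union> B)"
      by (simp add: complex_vector.span_diff)
  qed
  then have fry: "finite_rank y"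
    using A(1) l(1) unfolding finite_rank_def cfinite_dim_def by blast
  have Db: "D b = l b *\<^sub>R b" if "b \<in> B" for b
  proof -
    have "D b = (\<Sum>c\<in>B. (if c = b then l b *\<^sub>R b else 0))"
      unfolding D_def spectral_calculus_apply[OF l(1)]
      using that by (intro sum.cong) (auto simp: orthonormal_cinner[OF l(2)])
    then show ?thesis using that l(1) by simp
  qed
  have yb: "y b = 0" if "b \<in> B" for b
    using Db l(4) that by (simp add: y_def blinfun.diff_left)
  have "y = 0"
  proof (rule ccontr)
    assume "y \<noteq> 0"
    then obtain \<mu> c where c: "\<mu> \<noteq> 0" "norm c = 1" "y c = \<mu> *\<^sub>R c"
      using selfadjoint_eigenvector_exists[OF say fry] by blast
    \<comment> \<open>Self-adjointness of y: an eigenvector for a non-zero eigenvalue is orthogonal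
      to the kernel of y, which contains B.\<close>
    have orth: "cinner b c = 0" if "b \<in> B" for b
      using selfadjointD[OF say, of b c] yb[OF that] c(1,3) by (simp add: cinner_scaleR_right)
    have "D c = 0"
      using orth by (simp add: D_def spectral_calculus_apply[OF l(1)])
    then have xc: "x c = \<mu> *\<^sub>R c" using c(3) by (simp add: y_def blinfun.diff_left)
    have cB: "c \<notin> B" using orth[of c] c(2) by (auto simp: cinner_self)
    have "P (insert c B)"
      unfolding P_def using l c(1) xc cB orthonormal_insert[OF l(2) c(2) orth]
      by (auto intro!: exI[of _ "l(c := \<mu>)"] split: if_splits)
    from B(2)[OF this] show False using cB l(1) by simp
  qed
  then show ?thesis
    using l(1-3) by (intro exI[of _ B] exI[of _ l]) (simp add: diagonalizes_def y_def D_def)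
qed

lemma spectral_calculus_compose:
  assumes "finite B" "orthonormal B"
  shows "spectral_calculus B l f o\<^sub>L spectral_calculus B l g = spectral_calculus B l (\<lambda>t. f t * g t)"
proof (rule blinfun_eqI)
  fix u
  have "cinner b (spectral_calculus B l g u) = of_real (g (l b)) * cinner b u" if "b \<in> B" for b
    using orthonormal_coeff[OF assms(2,1) that, of "\<lambda>c. of_real (g (l c)) * cinner c u"]
    by (simp add: spectral_calculus_apply[OF assms(1)] scaleR_scaleC scaleC_scaleC)
  then show "blinfun_apply (spectral_calculus B l f o\<^sub>L spectral_calculus B l g) u
      = blinfun_apply (spectral_calculus B l (\<lambda>t. f t * g t)) u"
    by (auto simp: spectral_calculus_apply[OF assms(1)] scaleR_scaleC scaleC_scaleC mult.assoc
      intro!: sum.cong)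
qed

lemma spectral_calculus_compose_apply:
  assumes "finite B" "orthonormal B"
  shows "blinfun_apply (spectral_calculus B l f) (blinfun_apply (spectral_calculus B l g) u)
    = blinfun_apply (spectral_calculus B l (\<lambda>t. f t * g t)) u"
  using spectral_calculus_compose[OF assms, of l f g] by (metis blinfun_apply_blinfun_compose)

lemma spectral_calculus_basis:
  assumes "finite B" "orthonormal B" "b \<in> B"
  shows "blinfun_apply (spectral_calculus B l f) b = f (l b) *\<^sub>R b"
proof -
  have "blinfun_apply (spectral_calculus B l f) b = (\<Sum>c\<in>B. if c = b then f (l b) *\<^sub>R b else 0)"
    unfolding spectral_calculus_apply[OF assms(1)]
    using assms(3) by (intro sum.cong) (auto simp: orthonormal_cinner[OF assms(2)])
  then show ?thesis using assms by simp
qed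

lemma spectral_calculus_cong:
  "(\<And>b. b \<in> B \<Longrightarrow> f (l b) = g (l b)) \<Longrightarrow> spectral_calculus B l f = spectral_calculus B l g"
  by (simp add: spectral_calculus_def)

lemma spectral_calculus_positive:
  assumes "finite B" "\<And>b. b \<in> B \<Longrightarrow> f (l b) \<ge> 0"
  shows "positive_op (spectral_calculus B l f)"
proof -
  have "Re (cinner u (f (l b) *\<^sub>R (cinner b u *\<^sub>C b))) \<ge> 0" if "b \<in> B" for u b
  proof -
    have "cinner u (f (l b) *\<^sub>R (cinner b u *\<^sub>C b)) = of_real (f (l b)) * (cinner b u * cnj (cinner b u))"
      using cinner_commute[of u b] by (simp add: cinner_scaleR_right cinner_scaleC_right)
    also have "\<dots> = of_real (f (l b) * (cmod (cinner b u))\<^sup>2)"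
      by (metis complex_norm_square of_real_mult)
    finally show ?thesis using assms(2)[OF that] by simp
  qed
  then show ?thesis
    unfolding positive_op_def
    by (auto simp: spectral_calculus_selfadjoint spectral_calculus_apply[OF assms(1)]
      cinner_sum_right intro!: sum_nonneg)
qed

text \<open>Since \<open>op_sqrt\<close> is a definite description, every positive root R has to be
  identified. With a^2 the eigenvalue at b, the vector w = R b - a b satisfies R w = - a w, and
  positivity of R leaves only w = 0 or a = 0; in the second case R (R b) = 0, and self-adjointness
  gives R b = 0.\<close>

lemma op_sqrt_spectral_calculus:
  assumes fin: "finite B" and on: "orthonormal B" and nn: "\<And>b. b \<in> B \<Longrightarrow> f (l b) \<ge> 0"
  shows "op_sqrt (spectral_calculus B l f) = spectral_calculus B l (\<lambda>t. sqrt (f t))"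
  unfolding op_sqrt_def
proof (rule the_equality, intro conjI)
  show "positive_op (spectral_calculus B l (\<lambda>t. sqrt (f t)))"
    using spectral_calculus_positive[OF fin] nn by simp
  show "spectral_calculus B l (\<lambda>t. sqrt (f t)) o\<^sub>L spectral_calculus B l (\<lambda>t. sqrt (f t))
      = spectral_calculus B l f"
    unfolding spectral_calculus_compose[OF fin on] using nn by (intro spectral_calculus_cong) simp
next
  fix R assume R: "positive_op R \<and> R o\<^sub>L R = spectral_calculus B l f"
  then have sa: "selfadjoint R" and pos: "Re (cinner u (R u)) \<ge> 0" for u
    by (auto simp: positive_op_def)
  have RR: "R (R u) = spectral_calculus B l f u" for u
    using R by (metis blinfun_apply_blinfun_compose)
  have ker: "R u = 0" if "R (R u) = 0" for u
    using selfadjointD[OF sa, of u "R u"] that norm_eq_0_cinner[of "R u"] by simp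
  have ev: "R b = sqrt (f (l b)) *\<^sub>R b" if b: "b \<in> B" for b
  proof -
    define a where "a = sqrt (f (l b))"
    define w where "w = R b - a *\<^sub>R b"
    have RRb: "R (R b) = a\<^sup>2 *\<^sub>R b"
      using RR spectral_calculus_basis[OF fin on b] nn[OF b] by (simp add: a_def)
    have "R w = - a *\<^sub>R w"
      by (simp add: w_def blinfun.diff_right blinfun.scaleR_right RRb scaleR_diff_right
        power2_eq_square)
    then have "a * (norm w)\<^sup>2 \<le> 0"
      using pos[of w] by (simp add: cinner_minus_right cinner_scaleR_right cinner_self)
    moreover have "a \<ge> 0" using nn[OF b] by (simp add: a_def)
    ultimately have "a = 0 \<or> w = 0"
      by (metis mult_le_0_iff norm_eq_zero not_less order_antisym power2_eq_square zero_eq_power2 zero_le_power2)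
    then show ?thesis
    proof
      assume "a = 0"
      then show ?thesis using ker[of b] RRb by (simp add: a_def[symmetric])
    qed (simp add: w_def a_def)
  qed
  show "R = spectral_calculus B l (\<lambda>t. sqrt (f t))"
  proof (rule blinfun_eqI)
    fix u
    \<comment> \<open>The part of u orthogonal to B is annihilated by R^2, hence by R.\<close>
    define r where "r = u - (\<Sum>b\<in>B. cinner b u *\<^sub>C b)"
    have "cinner b r = 0" if "b \<in> B" for b
      using orthonormal_coeff[OF on fin that] by (simp add: r_def cinner_diff_right)
    then have "R (R r) = 0"
      by (simp add: RR spectral_calculus_apply[OF fin])
    then have "R r = 0" by (rule ker)
    moreover have "R u = R r + (\<Sum>b\<in>B. R (cinner b u *\<^sub>C b))"
      by (simp add: r_def blinfun.diff_right blinfun.sum_right)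
    ultimately have "R u = (\<Sum>b\<in>B. cinner b u *\<^sub>C R b)"
      by (simp add: selfadjoint_scaleC[OF sa])
    also have "\<dots> = spectral_calculus B l (\<lambda>t. sqrt (f t)) u"
      unfolding spectral_calculus_apply[OF fin]
      by (intro sum.cong) (simp_all add: ev scaleR_scaleC scaleC_scaleC mult.commute)
    finally show "R u = spectral_calculus B l (\<lambda>t. sqrt (f t)) u" .
  qed
qed

lemma op_abs_spectral_calculus:
  assumes "diagonalizes B l x"
  shows "op_abs x = spectral_calculus B l abs"
proof -
  have B: "finite B" "orthonormal B" "x = spectral_calculus B l (\<lambda>t. t)"
    using assms by (auto simp: diagonalizes_def)
  have "x o\<^sub>L x = spectral_calculus B l (\<lambda>t. t * t)"
    using spectral_calculus_compose[OF B(1,2)] B(3) by blast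
  then show ?thesis
    using op_sqrt_spectral_calculus[OF B(1,2), of "\<lambda>t. t * t" l]
    by (simp add: op_abs_def)
qed

text \<open>\<open>op_half x\<close> is \<open>\<bar>x\<bar>\<^sup>1\<^sup>/\<^sup>2\<close>. It identifies the spin space at \<open>x\<close>, equipped with its Euclidean
  scalar product, with a subspace of the Hilbert space; there the spin inner product is
  represented by \<open>- op_sgn x\<close>.\<close>

definition op_half :: "'h::complex_hilbert op \<Rightarrow> 'h op" where
  "op_half x = op_sqrt (op_abs x)"

definition op_sgn :: "'h::complex_hilbert op \<Rightarrow> 'h op" where
  "op_sgn x = (SOME J. \<exists>B l. diagonalizes B l x \<and> J = spectral_calculus B l sgn)"

context
  fixes x :: "'h::complex_hilbert op"
  assumes sa: "selfadjoint x" and fr: "finite_rank x"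
begin

lemma spectral_calculus_obtain:
  obtains B l where "finite B" "orthonormal B" "\<And>b. b \<in> B \<Longrightarrow> l b \<noteq> 0"
    "x = spectral_calculus B l (\<lambda>t. t)" "op_abs x = spectral_calculus B l abs"
    "op_half x = spectral_calculus B l (\<lambda>t. sqrt \<bar>t\<bar>)" "op_sgn x = spectral_calculus B l sgn"
proof -
  have "\<exists>B l. diagonalizes B l x \<and> op_sgn x = spectral_calculus B l sgn"
  proof -
    have "\<exists>J B l. diagonalizes B l x \<and> J = spectral_calculus B l sgn"
      using spectral_theorem[OF sa fr] by blast
    from someI_ex[OF this] show ?thesis unfolding op_sgn_def .
  qed
  then obtain B l where *: "diagonalizes B l x" "op_sgn x = spectral_calculus B l sgn" by blast
  have B: "finite B" "orthonormal B" using *(1) by (auto simp: diagonalizes_def)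
  have "op_half x = spectral_calculus B l (\<lambda>t. sqrt \<bar>t\<bar>)"
    unfolding op_half_def op_abs_spectral_calculus[OF *(1)]
    by (rule op_sqrt_spectral_calculus[OF B]) simp
  then show ?thesis
    using that[of B l] * op_abs_spectral_calculus[OF *(1)] by (auto simp: diagonalizes_def)
qed

lemma eucl_inner_op_half: "eucl_inner x u v = cinner (op_half x u) (op_half x v)"
proof -
  obtain B l where B: "finite B" "orthonormal B" "op_abs x = spectral_calculus B l abs"
    "op_half x = spectral_calculus B l (\<lambda>t. sqrt \<bar>t\<bar>)"
    using spectral_calculus_obtain by metis
  show ?thesis
    by (simp add: eucl_inner_def B(3,4) selfadjointD[OF spectral_calculus_selfadjoint]
      spectral_calculus_compose_apply[OF B(1,2)])
qed

lemma op_sgn_selfadjoint: "selfadjoint (op_sgn x)"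
  by (metis spectral_calculus_obtain spectral_calculus_selfadjoint)

lemma op_half_selfadjoint: "selfadjoint (op_half x)"
  by (metis spectral_calculus_obtain spectral_calculus_selfadjoint)

lemma op_half_op_sgn: "op_half x (op_sgn x u) = op_sgn x (op_half x u)"
proof -
  obtain B l where B: "finite B" "orthonormal B" "op_sgn x = spectral_calculus B l sgn"
    "op_half x = spectral_calculus B l (\<lambda>t. sqrt \<bar>t\<bar>)"
    using spectral_calculus_obtain by metis
  show ?thesis
    by (simp add: B(3,4) spectral_calculus_compose_apply[OF B(1,2)] mult.commute)
qed

lemma spin_inner_op_half: "spin_inner x u v = - cinner (op_half x u) (op_sgn x (op_half x v))"
proof -
  obtain B l where B: "finite B" "orthonormal B" "op_sgn x = spectral_calculus B l sgn"
    "op_half x = spectral_calculus B l (\<lambda>t. sqrt \<bar>t\<bar>)" "x = spectral_calculus B l (\<lambda>t. t)"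
    using spectral_calculus_obtain by metis
  have "sqrt \<bar>t\<bar> * (sgn t * sqrt \<bar>t\<bar>) = t" for t :: real
    by (simp add: sgn_if)
  then have "x v = op_half x (op_sgn x (op_half x v))"
    unfolding B(3,4) by (subst B(5)) (simp only: spectral_calculus_compose_apply[OF B(1,2)])
  then show ?thesis
    by (simp add: spin_inner_def selfadjointD[OF op_half_selfadjoint])
qed

text \<open>P is the orthogonal projection onto the range, the spectral function constant 1. All its
  relations are collected in one statement because every use of
  \<open>spectral_calculus_obtain\<close> may produce another basis, while P has to be the same in
  all of them.\<close>

lemma spin_space_projection: "\<exists>P. (\<forall>u. u \<in> spin_space x \<longleftrightarrow> blinfun_apply P u = u) \<and>
    (\<forall>u. op_half x u = 0 \<longrightarrow> blinfun_apply P u = 0) \<and> (\<forall>u. x u = 0 \<longrightarrow> blinfun_apply P u = 0) \<and>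
    (\<forall>u. blinfun_apply P (op_half x u) = op_half x u) \<and>
    (\<forall>u. blinfun_apply P (op_sgn x u) = op_sgn x u) \<and>
    (\<forall>u. op_sgn x (op_sgn x u) = blinfun_apply P u) \<and> (\<forall>u. norm (blinfun_apply P u) \<le> norm u)"
proof -
  obtain B l where B: "finite B" "orthonormal B" "\<And>b. b \<in> B \<Longrightarrow> l b \<noteq> 0"
    "x = spectral_calculus B l (\<lambda>t. t)" "op_sgn x = spectral_calculus B l sgn"
    "op_half x = spectral_calculus B l (\<lambda>t. sqrt \<bar>t\<bar>)"
    using spectral_calculus_obtain by metis
  define P where "P = spectral_calculus B l (\<lambda>t. 1)"
  note comp = spectral_calculus_compose_apply[OF B(1,2)]
  have Pf: "P (spectral_calculus B l f u) = spectral_calculus B l f u" for f u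
    by (simp add: P_def comp)
  \<comment> \<open>A function without zeros off 0 can be inverted up to P, as all values of
    \<open>l\<close> are non-zero.\<close>
  have fP: "spectral_calculus B l (\<lambda>t. inverse (f t)) (spectral_calculus B l f u) = P u"
    if "\<And>t. t \<noteq> 0 \<Longrightarrow> f t \<noteq> 0" for f u
  proof -
    have "spectral_calculus B l (\<lambda>t. inverse (f t) * f t) = P"
      unfolding P_def using that B(3) by (intro spectral_calculus_cong) simp
    then show ?thesis by (simp only: comp)
  qed
  have fP': "spectral_calculus B l f (spectral_calculus B l (\<lambda>t. inverse (f t)) u) = P u"
    if "\<And>t. t \<noteq> 0 \<Longrightarrow> f t \<noteq> 0" for f u
    using fP[of f u, OF that] by (simp add: comp mult.commute)
  have zero: "P u = 0" if "spectral_calculus B l f u = 0" "\<And>t. t \<noteq> 0 \<Longrightarrow> f t \<noteq> 0" for f u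
    using fP[of f u, OF that(2)] that(1) by (simp add: blinfun.zero_right)
  have norm: "norm (P u) \<le> norm u" for u
  proof -
    have "complex_of_real ((norm (P u))\<^sup>2) = cinner u (P (P u))"
      using selfadjointD[OF spectral_calculus_selfadjoint] by (simp only: cinner_self[symmetric] P_def)
    also have "P (P u) = P u" by (simp add: Pf[unfolded P_def] P_def)
    finally have "(norm (P u))\<^sup>2 \<le> norm u * norm (P u)"
      using Cauchy_Schwarz_cinner[of u "P u"]
      by (metis norm_of_real abs_of_nonneg zero_le_power2)
    then show ?thesis
      by (cases "P u = 0") (auto simp: power2_eq_square)
  qed
  have "u \<in> spin_space x \<longleftrightarrow> P u = u" for u
  proof
    assume "u \<in> spin_space x"
    then obtain v where "u = x v" by (auto simp: spin_space_def)
    then show "P u = u" using Pf[of "\<lambda>t. t" v] by (simp add: B(4)[symmetric])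
  next
    assume "P u = u"
    then have "u = x (spectral_calculus B l (\<lambda>t. inverse t) u)"
      using fP'[of "\<lambda>t. t" u] by (simp add: B(4)[symmetric])
    then show "u \<in> spin_space x" unfolding spin_space_def by blast
  qed
  moreover have "op_sgn x (op_sgn x u) = P u" for u
  proof -
    have "spectral_calculus B l (\<lambda>t. sgn t * sgn t) = P"
      unfolding P_def using B(3) by (intro spectral_calculus_cong) (simp add: sgn_if)
    then show ?thesis by (simp add: B(5) comp)
  qed
  ultimately show ?thesis
    using zero[of "\<lambda>t. sqrt \<bar>t\<bar>"] zero[of "\<lambda>t. t"] Pf norm
    by (intro exI[of _ P]) (simp add: B(5,6) B(4)[symmetric])
qed

lemma op_half_eq_0: "u \<in> spin_space x \<Longrightarrow> op_half x u = 0 \<Longrightarrow> u = 0"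
  using spin_space_projection by metis

lemma op_half_spin_space: "op_half x u \<in> spin_space x"
  using spin_space_projection by metis

lemma op_sgn_spin_space: "op_sgn x u \<in> spin_space x"
  using spin_space_projection by metis

lemma op_sgn_involution: "u \<in> spin_space x \<Longrightarrow> op_sgn x (op_sgn x u) = u"
  using spin_space_projection by metis

lemma norm_op_sgn_le: "norm (op_sgn x u) \<le> norm u"
proof -
  obtain P :: "'h op" where P: "\<And>u. op_sgn x (op_sgn x u) = P u" "\<And>u. norm (blinfun_apply P u) \<le> norm u"
    using spin_space_projection by metis
  have "complex_of_real ((norm (op_sgn x u))\<^sup>2) = cinner u (P u)"
    using selfadjointD[OF op_sgn_selfadjoint, of u "op_sgn x u"] P(1)
    by (simp only: cinner_self[symmetric])
  then have "(norm (op_sgn x u))\<^sup>2 \<le> norm u * norm (P u)"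
    using Cauchy_Schwarz_cinner[of u "P u"] by (metis norm_of_real abs_of_nonneg zero_le_power2)
  also have "\<dots> \<le> (norm u)\<^sup>2"
    using P(2)[of u] by (simp add: power2_eq_square mult_left_mono)
  finally show ?thesis by (rule power2_le_imp_le) simp
qed

lemma norm_op_sgn: "u \<in> spin_space x \<Longrightarrow> norm (op_sgn x u) = norm u"
  using norm_op_sgn_le[of u] norm_op_sgn_le[of "op_sgn x u"] op_sgn_involution[of u] by simp

text \<open>The minus sign stems from the one in \<open>spin_inner\<close>. Uniqueness is the
  nondegeneracy of the spin inner product: the difference d of two solutions, paired with x d,
  satisfies x d = 0, and x is injective on its range.\<close>

lemma eucl_sign_eq: "eucl_sign x u = - op_sgn x u"
  unfolding eucl_sign_def
proof (rule the_equality)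
  have in_spin: "- op_sgn x u \<in> spin_space x"
    using op_sgn_spin_space[of "-u"] by (simp add: blinfun.minus_right)
  have inv: "op_sgn x (op_sgn x (op_half x u)) = op_half x u"
    by (rule op_sgn_involution[OF op_half_spin_space])
  show sol: "- op_sgn x u \<in> spin_space x \<and> (\<forall>\<zeta>\<in>spin_space x. eucl_inner x \<zeta> u = spin_inner x \<zeta> (- op_sgn x u))"
    using in_spin inv by (simp add: eucl_inner_op_half spin_inner_op_half blinfun.minus_right
      op_half_op_sgn cinner_minus_right)
  fix v assume v: "v \<in> spin_space x \<and> (\<forall>\<zeta>\<in>spin_space x. eucl_inner x \<zeta> u = spin_inner x \<zeta> v)"
  define d where "d = v - (- op_sgn x u)"
  have d: "d \<in> spin_space x"
  proof -
    obtain a b where "v = x a" "- op_sgn x u = x b"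
      using v in_spin by (auto simp: spin_space_def)
    then have "d = x (a - b)" by (simp add: d_def blinfun.diff_right)
    then show ?thesis by (simp add: spin_space_def)
  qed
  have "spin_inner x \<zeta> d = 0" if "\<zeta> \<in> spin_space x" for \<zeta>
    using v sol that
    by (simp add: d_def spin_inner_def blinfun.diff_right cinner_diff_right del: diff_minus_eq_add)
  from this[of "x d"] have "x d = 0"
    using norm_eq_0_cinner[of "x d"] by (simp add: spin_inner_def spin_space_def)
  then have "d = 0" using d spin_space_projection by metis
  then show "v = - op_sgn x u" by (simp add: d_def eq_neg_iff_add_eq_0)
qed

lemma eucl_inner_eucl_sign: "eucl_inner x (eucl_sign x u) v = spin_inner x u v"
  by (simp add: eucl_sign_eq eucl_inner_op_half spin_inner_op_half blinfun.minus_right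
    op_half_op_sgn cinner_minus_left selfadjointD[OF op_sgn_selfadjoint])

end

lemma spin_space_add: "u \<in> spin_space x \<Longrightarrow> v \<in> spin_space x \<Longrightarrow> u + v \<in> spin_space x"
  unfolding spin_space_def by (auto simp flip: blinfun.add_right)

lemma spin_space_zero [simp]: "0 \<in> spin_space x"
  unfolding spin_space_def by (metis blinfun.zero_right rangeI)

lemma spin_inner_zero [simp]: "spin_inner x 0 v = 0" "spin_inner x u 0 = 0"
  by (simp_all add: spin_inner_def blinfun.zero_right)

lemma spin_inner_add: "spin_inner x (u + v) w = spin_inner x u w + spin_inner x v w"
  "spin_inner x u (v + w) = spin_inner x u v + spin_inner x u w"
  by (simp_all add: spin_inner_def cinner_add_left cinner_add_right blinfun.add_right)

lemma spin_inner_scaleR: "spin_inner x (r *\<^sub>R u) w = of_real r * spin_inner x u w"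
  "spin_inner x u (r *\<^sub>R w) = of_real r * spin_inner x u w"
  by (simp_all add: spin_inner_def cinner_scaleR_left cinner_scaleR_right blinfun.scaleR_right)

lemma bounded_linear_spin_inner_left: "bounded_linear (\<lambda>u. spin_inner x u v)"
  unfolding spin_inner_def
  by (intro bounded_linear_minus bounded_bilinear.bounded_linear_left[OF bounded_bilinear_cinner])

lemma bounded_linear_spin_inner_right: "bounded_linear (\<lambda>v. spin_inner x u v)"
  unfolding spin_inner_def
  by (intro bounded_linear_minus bounded_linear_compose[OF
    bounded_bilinear.bounded_linear_right[OF bounded_bilinear_cinner]] blinfun.bounded_linear_right)

text \<open>\<open>sgn_poly x j\<close> is \<open>c x (1 - c\<^sup>2 x\<^sup>2)\<^sup>j\<close> with \<open>c = 1 / (1 + \<parallel>x\<parallel>)\<close>. The binomial series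
  of \<open>s (s\<^sup>2)\<^sup>-\<^sup>1\<^sup>/\<^sup>2 = sgn s\<close> in powers of \<open>1 - s\<^sup>2\<close> then approximates \<open>op_sgn x\<close> strongly by
  norm continuous functions of \<open>x\<close>.\<close>

fun sgn_poly :: "'h::complex_hilbert op \<Rightarrow> nat \<Rightarrow> 'h op" where
  "sgn_poly x 0 = inverse (1 + norm x) *\<^sub>R x"
| "sgn_poly x (Suc j) = sgn_poly x j - (inverse (1 + norm x))\<^sup>2 *\<^sub>R (x o\<^sub>L (x o\<^sub>L sgn_poly x j))"

lemma continuous_on_sgn_poly: "continuous_on A (\<lambda>x. sgn_poly x j)"
proof (induction j)
  case 0
  have "1 + norm x \<noteq> 0" for x :: "'a op"
    using norm_ge_zero[of x] by linarith
  then show ?case by (auto intro!: continuous_intros)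
next
  case (Suc j)
  have "1 + norm x \<noteq> 0" for x :: "'a op"
    using norm_ge_zero[of x] by linarith
  with Suc show ?case
    by (auto intro!: continuous_intros bounded_bilinear.continuous_on[OF bounded_bilinear_blinfun_compose])
qed

text \<open>Binomial series of (1 + z)^(-1/2) at z = s^2 - 1. This z has modulus below 1 only if s
  is non-zero; for s = 0 every term carries the factor s.\<close>

lemma sgn_series:
  fixes s :: real
  assumes "\<bar>s\<bar> < 1"
  shows "(\<lambda>m. \<Sum>j<m. (((-1/2) gchoose j) * (-1) ^ j) * (s * (1 - s\<^sup>2) ^ j)) \<longlonglongrightarrow> sgn s"
proof (cases "s = 0")
  case False
  have s2: "0 < s\<^sup>2" "s\<^sup>2 < 1" using False assms by (auto simp: abs_square_less_1)
  have "(\<lambda>j. ((-1/2) gchoose j) * (-(1 - s\<^sup>2)) ^ j) sums (1 + (-(1 - s\<^sup>2))) powr (-1/2)"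
    by (rule gen_binomial_real) (use s2 in auto)
  then have "(\<lambda>j. s * (((-1/2) gchoose j) * (-(1 - s\<^sup>2)) ^ j)) sums (s * (s\<^sup>2) powr (-1/2))"
    by (intro sums_mult) simp
  moreover have "(s\<^sup>2) powr (-1/2) = inverse \<bar>s\<bar>"
    using s2 by (simp add: powr_minus powr_half_sqrt)
  moreover have "s * inverse \<bar>s\<bar> = sgn s"
    using False by (simp add: sgn_if)
  ultimately have "(\<lambda>j. s * (((-1/2) gchoose j) * (-(1 - s\<^sup>2)) ^ j)) sums sgn s"
    by simp
  moreover have "(- (1 - s\<^sup>2)) ^ j = (-1) ^ j * (1 - s\<^sup>2) ^ j" for j
    by (metis mult_minus1 power_mult_distrib)
  ultimately show ?thesis
    by (simp add: sums_def mult_ac)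
qed simp

lemma op_sgn_limit:
  fixes x :: "'h::complex_hilbert op"
  assumes "selfadjoint x" "finite_rank x"
  shows "(\<lambda>m. \<Sum>j<m. (((-1/2) gchoose j) * (-1) ^ j) *\<^sub>R sgn_poly x j u) \<longlonglongrightarrow> op_sgn x u"
proof -
  obtain B l where B: "finite B" "orthonormal B" "x = spectral_calculus B l (\<lambda>t. t)"
    "op_sgn x = spectral_calculus B l sgn"
    using spectral_calculus_obtain[OF assms] by metis
  define c where "c = inverse (1 + norm x)"
  have c: "c > 0" unfolding c_def by (simp add: add_pos_nonneg)
  have mult_x: "x o\<^sub>L spectral_calculus B l g = spectral_calculus B l (\<lambda>t. t * g t)" for g
    by (subst B(3)) (rule spectral_calculus_compose[OF B(1,2)])
  have poly: "sgn_poly x j = spectral_calculus B l (\<lambda>t. (c * t) * (1 - (c * t)\<^sup>2) ^ j)" for j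
  proof (induction j)
    case 0
    have "sgn_poly x 0 = c *\<^sub>R spectral_calculus B l (\<lambda>t. t)"
      by (simp add: c_def flip: B(3))
    also have "\<dots> = spectral_calculus B l (\<lambda>t. (c * t) * (1 - (c * t)\<^sup>2) ^ 0)"
      by (simp add: spectral_calculus_def scaleR_sum_right)
    finally show ?case .
  next
    case (Suc j)
    define f where "f t = (c * t) * (1 - (c * t)\<^sup>2) ^ j" for t
    have "sgn_poly x (Suc j) = spectral_calculus B l f - c\<^sup>2 *\<^sub>R spectral_calculus B l (\<lambda>t. t * (t * f t))"
      using Suc by (simp add: c_def[symmetric] f_def[symmetric] mult_x)
    also have "\<dots> = spectral_calculus B l (\<lambda>t. f t - c\<^sup>2 * (t * (t * f t)))"
      by (simp add: spectral_calculus_def scaleR_sum_right scaleR_diff_left sum_subtractf)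
    also have "(\<lambda>t. f t - c\<^sup>2 * (t * (t * f t))) = (\<lambda>t. (c * t) * (1 - (c * t)\<^sup>2) ^ Suc j)"
      by (rule ext) (simp add: f_def algebra_simps power2_eq_square)
    finally show ?case .
  qed
  \<comment> \<open>The normalization by 1 + norm x puts the eigenvalues strictly inside the
    interval (-1, 1), where \<open>sgn_series\<close> applies, and does not change their
    sign.\<close>
  have bound: "\<bar>c * l b\<bar> < 1" if "b \<in> B" for b
  proof -
    have "x b = l b *\<^sub>R b" by (subst B(3)) (rule spectral_calculus_basis[OF B(1,2) that])
    then have "\<bar>l b\<bar> \<le> norm x"
      using norm_blinfun[of x b] orthonormal_norm[OF B(2) that] by simp
    then have "\<bar>l b\<bar> < 1 + norm x" by simp
    then show ?thesis
      using c norm_ge_zero[of x] by (simp add: abs_mult c_def field_simps)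
  qed
  have "(\<lambda>m. \<Sum>b\<in>B. (\<Sum>j<m. (((-1/2) gchoose j) * (-1) ^ j) * ((c * l b) * (1 - (c * l b)\<^sup>2) ^ j))
      *\<^sub>R (cinner b u *\<^sub>C b)) \<longlonglongrightarrow> (\<Sum>b\<in>B. sgn (c * l b) *\<^sub>R (cinner b u *\<^sub>C b))"
    by (intro tendsto_sum tendsto_scaleR tendsto_const sgn_series bound)
  moreover have "(\<Sum>b\<in>B. sgn (c * l b) *\<^sub>R (cinner b u *\<^sub>C b)) = op_sgn x u"
    using c by (simp add: B(4) spectral_calculus_apply[OF B(1)] sgn_mult)
  moreover have "(\<Sum>b\<in>B. (\<Sum>j<m. (((-1/2) gchoose j) * (-1) ^ j) * ((c * l b) * (1 - (c * l b)\<^sup>2) ^ j))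
      *\<^sub>R (cinner b u *\<^sub>C b)) = (\<Sum>j<m. (((-1/2) gchoose j) * (-1) ^ j) *\<^sub>R sgn_poly x j u)" for m
    unfolding poly spectral_calculus_apply[OF B(1)] scaleR_sum_left scaleR_sum_right
    by (subst sum.swap) simp
  ultimately show ?thesis by simp
qed

section \<open>Weighted square integrable functions\<close>

lemma norm_add_sq_le: "(norm (u + v))\<^sup>2 \<le> 2 * (norm u)\<^sup>2 + 2 * (norm (v::'b::real_normed_vector))\<^sup>2"
proof -
  have "(norm (u + v))\<^sup>2 \<le> (norm u + norm v)\<^sup>2"
    by (rule power_mono[OF norm_triangle_ineq]) simp
  also have "\<dots> \<le> 2 * (norm u)\<^sup>2 + 2 * (norm v)\<^sup>2"
    using zero_le_power2[of "norm u - norm v"] by (simp add: power2_sum power2_diff)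
  finally show ?thesis .
qed

text \<open>The minimizing s is sqrt B / sqrt A. If A or B vanishes, the infimum may be approached
  only as s tends to infinity or to 0, which is why the bound is shown up to every e > 0.\<close>

lemma le_sqrt_mult_if_scaled:
  fixes X A B :: real
  assumes "A \<ge> 0" "B \<ge> 0" and *: "\<And>s. s > 0 \<Longrightarrow> 2 * X \<le> s * A + B / s"
  shows "X \<le> sqrt A * sqrt B"
proof (rule field_le_epsilon)
  fix e :: real assume e: "e > 0"
  define d where "d = e / (sqrt A + sqrt B + e + 1)"
  show "X \<le> sqrt A * sqrt B + e"
  proof (cases "A = 0 \<or> B = 0")
    case False
    then have pos: "A > 0" "B > 0" using assms(1,2) by auto
    define a b where "a = sqrt A" and "b = sqrt B"
    have ab: "a > 0" "b > 0" "A = a * a" "B = b * b"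
      using pos by (simp_all add: a_def b_def)
    have "2 * X \<le> b / a * A + B / (b / a)"
      using ab by (intro *) simp
    also have "\<dots> = 2 * (a * b)"
      using ab by (simp add: field_simps)
    finally show ?thesis using e by (simp add: a_def b_def)
  next
    case True
    then show ?thesis
    proof
      assume "A = 0"
      then have "2 * X \<le> B / ((B + 1) / e)"
        using *[of "(B + 1) / e"] e assms(2) by simp
      also have "\<dots> \<le> e" using assms(2) e by (simp add: field_simps)
      finally show ?thesis using \<open>A = 0\<close> e by simp
    next
      assume "B = 0"
      then have "2 * X \<le> e / (A + 1) * A"
        using *[of "e / (A + 1)"] e assms(1) by simp
      also have "\<dots> \<le> e" using assms(1) e by (simp add: field_simps)
      finally show ?thesis using \<open>B = 0\<close> e by simp
    qed
  qed
qed

lemma borel_measurable_cinner [measurable]: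
  fixes F G :: "'a \<Rightarrow> 'h::complex_hilbert"
  assumes "F \<in> borel_measurable N" "G \<in> borel_measurable N"
  shows "(\<lambda>x. cinner (F x) (G x)) \<in> borel_measurable N"
  using assms by (rule borel_measurable_continuous_Pair) (intro continuous_intros)

text \<open>The map g is assumed measurable only at each fixed vector. For a simple f finitely many
  such vectors occur; a general f is a pointwise limit of simple ones, and each \<open>g x\<close>
  is continuous.\<close>

lemma borel_measurable_blinfun_apply_simple_limit:
  fixes g :: "'a \<Rightarrow> 'h::{real_normed_vector, second_countable_topology} \<Rightarrow>\<^sub>L 'k::real_normed_vector"
  assumes g: "\<And>v. (\<lambda>x. g x v) \<in> borel_measurable N" and f: "f \<in> borel_measurable N"
  shows "(\<lambda>x. g x (f x)) \<in> borel_measurable N"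
proof -
  obtain F where F: "\<And>i. simple_function N (F i)"
    "\<And>x. x \<in> space N \<Longrightarrow> (\<lambda>i. F i x) \<longlonglongrightarrow> f x"
    using borel_measurable_implies_sequence_metric[OF f, of 0] by blast
  have "(\<lambda>x. g x (F i x)) \<in> borel_measurable N" for i
  proof (rule measurable_compose_countable'[where f = "\<lambda>v x. g x v" and g = "F i"])
    show "F i \<in> measurable N (count_space (F i ` space N))"
      using F(1)[of i] unfolding simple_function_def
      by (subst measurable_count_space_eq2) auto
    show "countable (F i ` space N)"
      using F(1)[of i] by (simp add: simple_function_def countable_finite)
  qed (rule g)
  then show ?thesis
    by (rule borel_measurable_LIMSEQ_metric[where f = "\<lambda>i x. g x (F i x)"])
      (intro blinfun.tendsto tendsto_const F(2))
qed

text \<open>Pointwise, twice the modulus of the scalar product of F and G is at most s |F|^2 + |G|^2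
  / s for every s > 0. The choice s = 1 gives a dominating function, and optimizing over s after
  integration gives the product of norms.\<close>

lemma weighted_Cauchy_Schwarz:
  fixes F G :: "'a \<Rightarrow> 'h::complex_hilbert" and w :: "'a \<Rightarrow> real"
  assumes [measurable]: "F \<in> borel_measurable N" "G \<in> borel_measurable N" "w \<in> borel_measurable N"
    and w: "\<And>x. w x \<ge> 0"
    and F: "integrable N (\<lambda>x. w x * (norm (F x))\<^sup>2)" and G: "integrable N (\<lambda>x. w x * (norm (G x))\<^sup>2)"
  shows "integrable N (\<lambda>x. of_real (w x) * cinner (F x) (G x))"
    and "cmod (LINT x|N. of_real (w x) * cinner (F x) (G x))
      \<le> sqrt (LINT x|N. w x * (norm (F x))\<^sup>2) * sqrt (LINT x|N. w x * (norm (G x))\<^sup>2)"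
proof -
  have am_gm: "2 * cmod (of_real (w x) * cinner (F x) (G x))
      \<le> s * (w x * (norm (F x))\<^sup>2) + (w x * (norm (G x))\<^sup>2) / s" if s: "s > 0" for s x
  proof -
    have "0 \<le> (sqrt s * norm (F x) - norm (G x) / sqrt s)\<^sup>2" by simp
    also have "\<dots> = s * (norm (F x))\<^sup>2 + (norm (G x))\<^sup>2 / s - 2 * (norm (F x) * norm (G x))"
      using s by (simp add: power2_diff power_mult_distrib power_divide)
    finally have "2 * cmod (cinner (F x) (G x)) \<le> s * (norm (F x))\<^sup>2 + (norm (G x))\<^sup>2 / s"
      using Cauchy_Schwarz_cinner[of "F x" "G x"] by linarith
    from mult_left_mono[OF this w[of x]] show ?thesis
      using w[of x] by (simp add: norm_mult algebra_simps)
  qed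
  show int: "integrable N (\<lambda>x. of_real (w x) * cinner (F x) (G x))"
  proof (rule Bochner_Integration.integrable_bound)
    show "integrable N (\<lambda>x. w x * (norm (F x))\<^sup>2 + w x * (norm (G x))\<^sup>2)"
      using F G by (rule Bochner_Integration.integrable_add)
    have "cmod (of_real (w x) * cinner (F x) (G x)) \<le> w x * (norm (F x))\<^sup>2 + w x * (norm (G x))\<^sup>2" for x
    proof -
      have "0 \<le> w x * (norm (F x))\<^sup>2" "0 \<le> w x * (norm (G x))\<^sup>2"
        using w[of x] by simp_all
      with am_gm[of 1 x] norm_ge_zero[of "of_real (w x) * cinner (F x) (G x)"] show ?thesis
        unfolding mult_1 div_by_1 by linarith
    qed
    then show "AE x in N. cmod (of_real (w x) * cinner (F x) (G x))
        \<le> norm (w x * (norm (F x))\<^sup>2 + w x * (norm (G x))\<^sup>2)"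
      unfolding real_norm_def by (intro AE_I2 order_trans[OF _ abs_ge_self])
  qed measurable
  have "(LINT x|N. cmod (of_real (w x) * cinner (F x) (G x)))
      \<le> sqrt (LINT x|N. w x * (norm (F x))\<^sup>2) * sqrt (LINT x|N. w x * (norm (G x))\<^sup>2)"
  proof (rule le_sqrt_mult_if_scaled)
    fix s :: real assume s: "s > 0"
    have "(LINT x|N. 2 * cmod (of_real (w x) * cinner (F x) (G x)))
        \<le> (LINT x|N. s * (w x * (norm (F x))\<^sup>2) + (w x * (norm (G x))\<^sup>2) / s)"
      by (intro integral_mono am_gm[OF s] Bochner_Integration.integrable_add integrable_norm
        integrable_mult_right integrable_divide int F G)
    then show "2 * (LINT x|N. cmod (of_real (w x) * cinner (F x) (G x)))
        \<le> s * (LINT x|N. w x * (norm (F x))\<^sup>2) + (LINT x|N. w x * (norm (G x))\<^sup>2) / s"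
      using F G by simp
  next
    show "0 \<le> (LINT x|N. w x * (norm (F x))\<^sup>2)" "0 \<le> (LINT x|N. w x * (norm (G x))\<^sup>2)"
      using w by simp_all
  qed
  then show "cmod (LINT x|N. of_real (w x) * cinner (F x) (G x))
      \<le> sqrt (LINT x|N. w x * (norm (F x))\<^sup>2) * sqrt (LINT x|N. w x * (norm (G x))\<^sup>2)"
    by (rule order_trans[OF integral_norm_bound])
qed


section \<open>Spacetime, foliation and wave functions\<close>

text \<open>The assumptions of the locale are invariant under time reversal
  \<open>\<eta>\<^sub>t \<mapsto> 1 - \<eta>\<^sub>-\<^sub>t\<close>, which exchanges the retarded and the advanced objects.\<close>

locale wave_dyn =
  fixes S :: "'h::complex_hilbert wave_dynamics"
  assumes ops_selfadjoint: "x \<in> ops S \<Longrightarrow> selfadjoint x"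
    and ops_finite_rank: "x \<in> ops S \<Longrightarrow> finite_rank x"
    and second_countable_ops: "second_countable (top_of_set (ops S))"
    and measure_rho: "locally_finite_regular_measure S"
    and Cvary_continuous: "Cvary S \<subseteq> continuous_waves S"
    and Cvary_subspace: "wave_subspace (Cvary S)"
    and eta_bounds: "x \<in> spacetime S \<Longrightarrow> 0 \<le> eta S t x \<and> eta S t x \<le> 1"
    and eta_deriv: "x \<in> spacetime S \<Longrightarrow> ((\<lambda>s. eta S s x) has_real_derivative theta S t x) (at t)"
    and eta_continuous: "continuous_on (spacetime S) (eta S t)"
    and theta_continuous: "continuous_on (spacetime S) (theta S t)"
    and theta_nonneg: "x \<in> spacetime S \<Longrightarrow> theta S t x \<ge> 0"
    and theta_range: "\<exists>t0 t1. \<forall>x\<in>spacetime S. theta S t x \<noteq> 0 \<longrightarrow> eta S t0 x = 0 \<and> eta S t1 x = 1"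
    and spacetime_theta: "spacetime S = (\<Union>t. supp_on S (theta S t))"
    and kern_symmetric: "symmetric_kernel S"
    and double_integral: "\<lbrakk>\<psi> \<in> L2_tc S; \<phi> \<in> L2_loc S\<rbrakk> \<Longrightarrow> integrable (rho S \<Otimes>\<^sub>M rho S)
        (\<lambda>(x, y). spin_inner x (\<psi> x) (kern S x y (\<phi> y)))"
    and finite_range: "finite_time_range S"
begin

section \<open>Topology and measure theory of spacetime\<close>

lemma spacetime_ops: "x \<in> spacetime S \<Longrightarrow> x \<in> ops S"
  by (simp add: spacetime_def)

lemma spacetime_selfadjoint: "x \<in> spacetime S \<Longrightarrow> selfadjoint x"
  and spacetime_finite_rank: "x \<in> spacetime S \<Longrightarrow> finite_rank x"
  using spacetime_ops ops_selfadjoint ops_finite_rank by blast+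

text \<open>Every subset of the second countable manifold is Lindelof. The lemma is applied to open
  null sets and to open sets of finite measure.\<close>

lemma countable_cover:
  assumes "A \<subseteq> ops S" "\<And>x. x \<in> A \<Longrightarrow> \<exists>U. open U \<and> x \<in> U \<and> P U"
  shows "\<exists>\<U>. countable \<U> \<and> (\<forall>U\<in>\<U>. open U \<and> P U) \<and> A \<subseteq> \<Union>\<U>"
proof -
  have "second_countable (top_of_set A)"
    using second_countable_subtopology[OF second_countable_ops, of A] assms(1)
    by (simp add: subtopology_subtopology Int_absorb1)
  then have L: "Lindelof_space (top_of_set A)"
    by (rule second_countable_imp_Lindelof_space)
  have "\<exists>\<V>. countable \<V> \<and> \<V> \<subseteq> {A \<inter> U |U. open U \<and> P U} \<and> \<Union>\<V> = topspace (top_of_set A)"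
  proof (rule Lindelof_spaceD[OF L])
    show "openin (top_of_set A) W" if "W \<in> {A \<inter> U |U. open U \<and> P U}" for W
      using that by (auto intro: openin_open_Int)
    show "\<Union> {A \<inter> U |U. open U \<and> P U} = topspace (top_of_set A)"
    proof
      show "topspace (top_of_set A) \<subseteq> \<Union> {A \<inter> U |U. open U \<and> P U}"
      proof
        fix x assume "x \<in> topspace (top_of_set A)"
        then have "x \<in> A" by simp
        with assms(2) obtain U where "open U" "x \<in> U" "P U" by blast
        with \<open>x \<in> A\<close> show "x \<in> \<Union> {A \<inter> U |U. open U \<and> P U}" by blast
      qed
    qed auto
  qed
  then obtain \<V> where V: "countable \<V>" "\<V> \<subseteq> {A \<inter> U |U. open U \<and> P U}" "\<Union>\<V> = A"
    by auto
  then have "\<forall>W\<in>\<V>. \<exists>U. open U \<and> P U \<and> W = A \<inter> U" by blast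
  then obtain h where h: "\<And>W. W \<in> \<V> \<Longrightarrow> open (h W) \<and> P (h W) \<and> W = A \<inter> h W"
    by metis
  have "A \<subseteq> \<Union>(h ` \<V>)"
  proof
    fix x assume "x \<in> A"
    then obtain W where "W \<in> \<V>" "x \<in> W" using V(3) by blast
    then show "x \<in> \<Union>(h ` \<V>)" using h[of W] by blast
  qed
  then show ?thesis
    using V(1) h by (intro exI[of _ "h ` \<V>"]) auto
qed

lemma sets_rho: "sets (rho S) = sets (restrict_space borel (ops S))"
  using measure_rho by (simp add: locally_finite_regular_measure_def)

lemma space_rho [simp]: "space (rho S) = ops S"
  using sets_eq_imp_space_eq[OF sets_rho] by (simp add: space_restrict_space)

lemma open_Int_ops: "open U \<Longrightarrow> U \<inter> ops S \<in> sets (rho S)"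
  unfolding sets_rho by (auto simp: sets_restrict_space)

lemma closed_Int_ops: "closed U \<Longrightarrow> U \<inter> ops S \<in> sets (rho S)"
  unfolding sets_rho by (auto simp: sets_restrict_space)

lemma locally_finite: "x \<in> ops S \<Longrightarrow> \<exists>U. open U \<and> x \<in> U \<and> emeasure (rho S) (U \<inter> ops S) < \<infinity>"
  using measure_rho by (simp add: locally_finite_regular_measure_def)

lemma spacetime_closed_Int: "\<exists>T. closed T \<and> spacetime S = T \<inter> ops S"
proof -
  define W where "W = \<Union>{U. open U \<and> emeasure (rho S) (U \<inter> ops S) = 0}"
  have "open W" unfolding W_def by auto
  moreover have "spacetime S = (- W) \<inter> ops S"
    unfolding spacetime_def W_def by blast
  ultimately show ?thesis by (metis closed_def double_complement)
qed

lemma spacetime_sets [measurable]: "spacetime S \<in> sets (rho S)"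
  using spacetime_closed_Int closed_Int_ops by metis

text \<open>The complement of the support is covered by open null sets, of which countably many
  suffice. Almost everywhere arguments may thus be restricted to spacetime, where
  \<open>eta\<close>, \<open>theta\<close> and \<open>kern\<close> are controlled.\<close>

lemma AE_spacetime: "AE x in rho S. x \<in> spacetime S"
proof -
  have "\<exists>\<U>. countable \<U> \<and> (\<forall>U\<in>\<U>. open U \<and> emeasure (rho S) (U \<inter> ops S) = 0) \<and> ops S - spacetime S \<subseteq> \<Union>\<U>"
    by (rule countable_cover) (auto simp: spacetime_def)
  then obtain \<U> where U: "countable \<U>" "\<And>U. U \<in> \<U> \<Longrightarrow> open U \<and> emeasure (rho S) (U \<inter> ops S) = 0"
    "ops S - spacetime S \<subseteq> \<Union>\<U>" by blast
  have "AE x in rho S. \<forall>U\<in>\<U>. x \<notin> U \<inter> ops S"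
  proof (subst AE_ball_countable[OF U(1)], intro ballI AE_not_in null_setsI)
    fix V assume "V \<in> \<U>"
    from U(2)[OF this] show "emeasure (rho S) (V \<inter> ops S) = 0" "V \<inter> ops S \<in> sets (rho S)"
      using open_Int_ops by auto
  qed
  then show ?thesis
    using AE_space by eventually_elim (use U(3) in auto)
qed

text \<open>Required by Fubini's theorem for the double integral over the kernel.\<close>

lemma sigma_finite_rho: "sigma_finite_measure (rho S)"
proof
  have "\<exists>\<U>. countable \<U> \<and> (\<forall>U\<in>\<U>. open U \<and> emeasure (rho S) (U \<inter> ops S) < \<infinity>) \<and> ops S \<subseteq> \<Union>\<U>"
    using locally_finite by (intro countable_cover) auto
  then obtain \<U> where U: "countable \<U>" "\<And>U. U \<in> \<U> \<Longrightarrow> open U \<and> emeasure (rho S) (U \<inter> ops S) < \<infinity>"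
    "ops S \<subseteq> \<Union>\<U>" by blast
  show "\<exists>A. countable A \<and> A \<subseteq> sets (rho S) \<and> \<Union>A = space (rho S) \<and> (\<forall>a\<in>A. emeasure (rho S) a \<noteq> \<infinity>)"
  proof (intro exI conjI)
    show "countable ((\<lambda>V. V \<inter> ops S) ` \<U>)" using U(1) by simp
    show "(\<lambda>V. V \<inter> ops S) ` \<U> \<subseteq> sets (rho S)" using U(2) open_Int_ops by blast
    show "\<Union> ((\<lambda>V. V \<inter> ops S) ` \<U>) = space (rho S)" using U(3) by auto
    show "\<forall>a\<in>(\<lambda>V. V \<inter> ops S) ` \<U>. emeasure (rho S) a \<noteq> \<infinity>" 
      using U(2) less_imp_neq by blast
  qed
qed

lemma compact_finite_measure:
  assumes "compact K" "K \<subseteq> spacetime S"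
  shows "K \<in> sets (rho S)" "emeasure (rho S) K < \<infinity>"
proof -
  have K: "K \<subseteq> ops S" using assms(2) spacetime_ops by blast
  show "K \<in> sets (rho S)"
    using closed_Int_ops[OF compact_imp_closed[OF assms(1)]] K by (simp add: Int_absorb2)
  have "\<forall>x\<in>K. \<exists>U. open U \<and> x \<in> U \<and> emeasure (rho S) (U \<inter> ops S) < \<infinity>"
    using locally_finite K by blast
  then obtain U where U: "\<forall>x\<in>K. open (U x) \<and> x \<in> U x \<and> emeasure (rho S) (U x \<inter> ops S) < \<infinity>"
    by (rule bchoice[THEN exE])
  obtain C where C: "C \<subseteq> K" "finite C" "K \<subseteq> (\<Union>x\<in>C. U x)"
    by (rule compactE_image[OF assms(1), of K U]) (use U in auto)
  have meas: "U x \<inter> ops S \<in> sets (rho S)" if "x \<in> C" for x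
    using open_Int_ops U C(1) that by blast
  have "emeasure (rho S) K \<le> emeasure (rho S) (\<Union>x\<in>C. U x \<inter> ops S)"
    using C(3) K meas C(2) by (intro emeasure_mono sets.finite_UN) auto
  also have "\<dots> \<le> (\<Sum>x\<in>C. emeasure (rho S) (U x \<inter> ops S))"
    using C(2) meas by (intro emeasure_subadditive_finite) auto
  also have "\<dots> < \<infinity>"
  proof -
    have "emeasure (rho S) (U x \<inter> ops S) < \<infinity>" if "x \<in> C" for x
      using U C(1) that by auto
    then show ?thesis using C(2) by simp
  qed
  finally show "emeasure (rho S) K < \<infinity>" .
qed

lemma borel_measurable_on_spacetime:
  fixes f :: "'h op \<Rightarrow> 'b::{real_normed_vector}"
  assumes "continuous_on (spacetime S) f"
  shows "(\<lambda>x. if x \<in> spacetime S then f x else 0) \<in> borel_measurable (rho S)"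
proof -
  \<comment> \<open>Both sides are the Borel sets cut down to spacetime, because spacetime is a
    subset of \<open>ops S\<close>.\<close>
  have "sets (restrict_space (rho S) {x. x \<in> spacetime S}) = sets (restrict_space borel (spacetime S))"
  proof -
    have "spacetime S \<inter> (ops S \<inter> X) = spacetime S \<inter> X" for X
      using spacetime_ops by blast
    then show ?thesis
      by (simp add: sets_restrict_space sets_rho image_image)
  qed
  then have "f \<in> borel_measurable (restrict_space (rho S) {x. x \<in> spacetime S})"
    using borel_measurable_continuous_on_restrict[OF assms] measurable_cong_sets by blast
  moreover have "{x \<in> space (rho S). x \<in> spacetime S} \<in> sets (rho S)"
    by measurable
  ultimately show ?thesis
    by (subst measurable_If_restrict_space_iff) auto
qed

lemma borel_measurable_op_sgn:
  assumes "f \<in> borel_measurable (rho S)"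
  shows "(\<lambda>x. op_sgn x (f x)) \<in> borel_measurable (rho S)"
proof (rule borel_measurable_LIMSEQ_metric)
  show "(\<lambda>m. \<Sum>j<m. (((-1/2) gchoose j) * (-1) ^ j) *\<^sub>R sgn_poly x j (f x)) \<longlonglongrightarrow> op_sgn x (f x)"
    if "x \<in> space (rho S)" for x
    using that ops_selfadjoint ops_finite_rank by (intro op_sgn_limit) auto
  have "(\<lambda>x. sgn_poly x j (f x)) \<in> borel_measurable (rho S)" for j
  proof (rule borel_measurable_blinfun_apply_simple_limit[OF _ assms])
    fix v
    have "continuous_on (ops S) (\<lambda>x. sgn_poly x j v)"
      by (intro continuous_intros continuous_on_sgn_poly)
    then show "(\<lambda>x. sgn_poly x j v) \<in> borel_measurable (rho S)"
      using borel_measurable_continuous_on_restrict measurable_cong_sets[OF sets_rho refl] by blast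
  qed
  then show "(\<lambda>x. \<Sum>j<m. (((-1/2) gchoose j) * (-1) ^ j) *\<^sub>R sgn_poly x j (f x)) \<in> borel_measurable (rho S)" for m
    by (intro borel_measurable_sum borel_measurable_scaleR borel_measurable_const)
qed


section \<open>Time functions of the foliation\<close>

lemma eta_mono: "x \<in> spacetime S \<Longrightarrow> t \<le> t' \<Longrightarrow> eta S t x \<le> eta S t' x"
  by (rule DERIV_nonneg_imp_nondecreasing) (use eta_deriv theta_nonneg in blast)+

lemma theta_imp_supp: "x \<in> spacetime S \<Longrightarrow> theta S s x \<noteq> 0 \<Longrightarrow> x \<in> supp_on S (theta S s)"
  using closure_subset[of "{x \<in> spacetime S. theta S s x \<noteq> 0}"] by (auto simp: supp_on_def)

lemma theta_zero_if_locally_constant: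
  assumes "x \<in> spacetime S" "open U" "s \<in> U" "\<And>u. u \<in> U \<Longrightarrow> eta S u x = c"
  shows "theta S s x = 0"
proof -
  have "((\<lambda>_. c) has_real_derivative theta S s x) (at s)"
    by (rule has_field_derivative_transform_within_open[OF eta_deriv[OF assms(1)] assms(2,3)])
      (use assms(4) in auto)
  then show ?thesis
    using DERIV_unique DERIV_const by blast
qed

text \<open>Monotonicity and the lower bound 0 force \<open>eta\<close> to vanish at x for all times
  before a, so it is locally constant in time there.\<close>

lemma theta_nonzero_ge:
  assumes x: "x \<in> spacetime S" and a: "eta S a x = 0" and s: "theta S s x \<noteq> 0"
  shows "a \<le> s"
proof (rule ccontr)
  assume "\<not> a \<le> s"
  have "eta S u x = 0" if "u \<in> {..<a}" for u
    using eta_mono[OF x, of u a] eta_bounds[OF x, of u] a that by simp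
  then have "theta S s x = 0"
    using \<open>\<not> a \<le> s\<close> by (intro theta_zero_if_locally_constant[OF x, of "{..<a}" _ 0]) auto
  with s show False by simp
qed

lemma theta_nonzero_le:
  assumes x: "x \<in> spacetime S" and b: "eta S b x = 1" and s: "theta S s x \<noteq> 0"
  shows "s \<le> b"
proof (rule ccontr)
  assume "\<not> s \<le> b"
  have "eta S u x = 1" if "u \<in> {b<..}" for u
    using eta_mono[OF x, of b u] eta_bounds[OF x, of u] b that by simp
  then have "theta S s x = 0"
    using \<open>\<not> s \<le> b\<close> by (intro theta_zero_if_locally_constant[OF x, of "{b<..}" _ 1]) auto
  with s show False by simp
qed

text \<open>The third property of a foliation speaks of points where \<open>theta\<close> is
  non-zero, whereas it is the supports, formed with closures, that cover spacetime. Continuity of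
  \<open>eta\<close> carries the values 0 and 1 over to the closure.\<close>

lemma eta_zero_one_supp:
  assumes "\<And>y. y \<in> spacetime S \<Longrightarrow> theta S s y \<noteq> 0 \<Longrightarrow> eta S t y = c"
    and "x \<in> supp_on S (theta S s)"
  shows "eta S t x = c"
proof -
  have "closedin (top_of_set (spacetime S)) {y \<in> spacetime S. eta S t y = c}"
    by (rule continuous_closedin_preimage_constant[OF eta_continuous])
  then obtain T where T: "closed T" "{y \<in> spacetime S. eta S t y = c} = T \<inter> spacetime S"
    by (auto simp: closedin_closed Int_commute)
  have "{y \<in> spacetime S. theta S s y \<noteq> 0} \<subseteq> T"
    using assms(1) T(2) by blast
  then have "closure {y \<in> spacetime S. theta S s y \<noteq> 0} \<subseteq> T"
    by (rule closure_minimal[OF _ T(1)])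
  then show ?thesis
    using assms(2) T(2) unfolding supp_on_def by blast
qed

lemma eta_MVT:
  assumes "x \<in> spacetime S" "a < b"
  shows "\<exists>s. a < s \<and> s < b \<and> eta S b x - eta S a x = (b - a) * theta S s x"
  using MVT2[OF assms(2), of "\<lambda>s. eta S s x" "\<lambda>s. theta S s x"] eta_deriv[OF assms(1)] by blast

lemma eta_zero_one_exist:
  assumes x: "x \<in> spacetime S"
  shows "\<exists>a b. eta S a x = 0 \<and> eta S b x = 1"
proof -
  obtain s where s: "x \<in> supp_on S (theta S s)" using x spacetime_theta by auto
  then show ?thesis using theta_range[of s] eta_zero_one_supp[OF _ s] by metis
qed

text \<open>In time, \<open>eta\<close> rises from 0 to 1 at x, so its derivative is non-zero
  somewhere. This replaces membership in some support by a strict inequality, which persists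
  nearby.\<close>

lemma theta_pos_exists:
  assumes x: "x \<in> spacetime S"
  shows "\<exists>s. theta S s x > 0"
proof -
  obtain a b where ab: "eta S a x = 0" "eta S b x = 1" using eta_zero_one_exist[OF x] by blast
  have "a < b" using eta_mono[OF x, of b a] ab by (cases "a < b") auto
  then obtain s where "eta S b x - eta S a x = (b - a) * theta S s x"
    using eta_MVT[OF x] by blast
  then have "theta S s x \<noteq> 0" using ab by auto
  then show ?thesis using theta_nonneg[OF x, of s] by (auto simp: less_le)
qed

text \<open>Together with \<open>theta_nonzero_ge\<close> this translates between values of
  \<open>eta\<close> and the active times s of x, those with \<open>theta S s x\<close> non-zero;
  the finite time range is formulated through the latter.\<close>

lemma eta_zero_if:
  assumes x: "x \<in> spacetime S" and "\<And>s. s < a \<Longrightarrow> theta S s x = 0"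
  shows "eta S a x = 0"
proof -
  obtain t where t: "eta S t x = 0" using eta_zero_one_exist[OF x] by blast
  show ?thesis
  proof (cases "t < a")
    case True
    then obtain s where "s < a" "eta S a x - eta S t x = (a - t) * theta S s x"
      using eta_MVT[OF x] by blast
    then show ?thesis using assms(2)[of s] t by simp
  next
    case False
    then show ?thesis using eta_mono[OF x, of a t] eta_bounds[OF x, of a] t by simp
  qed
qed

lemma eta_one_if:
  assumes x: "x \<in> spacetime S" and "\<And>s. s > b \<Longrightarrow> theta S s x = 0"
  shows "eta S b x = 1"
proof -
  obtain t where t: "eta S t x = 1" using eta_zero_one_exist[OF x] by blast
  show ?thesis
  proof (cases "b < t")
    case True
    then obtain s where "b < s" "eta S t x - eta S b x = (t - b) * theta S s x"
      using eta_MVT[OF x] by blast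
    then show ?thesis using assms(2)[of s] t by simp
  next
    case False
    then show ?thesis using eta_mono[OF x, of t b] eta_bounds[OF x, of b] t by simp
  qed
qed

text \<open>The bounds in the third property of a foliation depend on the time only. Since at every
  point some \<open>\<theta>\<^sub>s\<close> is positive, hence positive nearby, they are locally uniform in space.\<close>

lemma eta_local_bounds:
  assumes x: "x \<in> spacetime S"
  shows "\<exists>U a b. open U \<and> x \<in> U \<and> (\<forall>y\<in>U \<inter> spacetime S. eta S a y = 0 \<and> eta S b y = 1)"
proof -
  obtain s where s: "theta S s x > 0" using theta_pos_exists[OF x] by blast
  obtain a b where ab: "\<forall>y\<in>spacetime S. theta S s y \<noteq> 0 \<longrightarrow> eta S a y = 0 \<and> eta S b y = 1"
    using theta_range by blast
  have "openin (top_of_set (spacetime S)) {y \<in> spacetime S. theta S s y \<in> {0<..}}"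
    using continuous_openin_preimage_gen[OF theta_continuous, of "{0<..}" s]
    by (simp add: vimage_def Int_def)
  then obtain U where U: "open U" "{y \<in> spacetime S. theta S s y \<in> {0<..}} = spacetime S \<inter> U"
    unfolding openin_open by blast
  have "x \<in> U" using U(2) s x by blast
  moreover have "eta S a y = 0 \<and> eta S b y = 1" if "y \<in> U \<inter> spacetime S" for y
    using U(2) ab that by force
  ultimately show ?thesis using U(1) by blast
qed

lemma compact_time_bounds:
  assumes "compact K" "K \<subseteq> spacetime S"
  shows "\<exists>a b. a < b \<and> (\<forall>y\<in>K. eta S a y = 0 \<and> eta S b y = 1)"
proof -
  have "\<forall>x\<in>K. \<exists>p. open (fst p) \<and> x \<in> fst p \<and>
      (\<forall>y\<in>fst p \<inter> spacetime S. eta S (fst (snd p)) y = 0 \<and> eta S (snd (snd p)) y = 1)"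
    using eta_local_bounds assms(2) by fastforce
  then obtain p where p: "\<forall>x\<in>K. open (fst (p x)) \<and> x \<in> fst (p x) \<and>
      (\<forall>y\<in>fst (p x) \<inter> spacetime S. eta S (fst (snd (p x))) y = 0 \<and> eta S (snd (snd (p x))) y = 1)"
    by (rule bchoice[THEN exE])
  obtain C where C: "C \<subseteq> K" "finite C" "K \<subseteq> (\<Union>x\<in>C. fst (p x))"
    by (rule compactE_image[OF assms(1), of K "\<lambda>x. fst (p x)"]) (use p in auto)
  \<comment> \<open>Inserting 0 here and 1 below keeps the finite sets non-empty and guarantees a <
    b.\<close>
  define a where "a = Min (insert 0 ((\<lambda>x. fst (snd (p x))) ` C))"
  define b where "b = Max (insert 1 ((\<lambda>x. snd (snd (p x))) ` C))"
  have "a \<le> 0" "b \<ge> 1" using C(2) by (auto simp: a_def b_def)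
  moreover have "eta S a y = 0 \<and> eta S b y = 1" if y: "y \<in> K" for y
  proof -
    have yM: "y \<in> spacetime S" using y assms(2) by blast
    obtain x where x: "x \<in> C" "y \<in> fst (p x)" using C(3) y by blast
    then have xy: "eta S (fst (snd (p x))) y = 0" "eta S (snd (snd (p x))) y = 1"
      using p C(1) yM by auto
    have "a \<le> fst (snd (p x))" "snd (snd (p x)) \<le> b"
      using C(2) x(1) by (auto simp: a_def b_def)
    then show ?thesis
      using xy eta_mono[OF yM] eta_bounds[OF yM] by (metis order_antisym)
  qed
  ultimately show ?thesis by (intro exI[of _ a] exI[of _ b]) auto
qed

section \<open>Pointwise algebra of wave functions\<close>

lemma spin_space_scaleC:
  "x \<in> spacetime S \<Longrightarrow> u \<in> spin_space x \<Longrightarrow> c *\<^sub>C u \<in> spin_space x"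
  unfolding spin_space_def by (metis selfadjoint_scaleC spacetime_selfadjoint rangeE rangeI)

lemma wave_function_zero: "wave_function S (\<lambda>x. 0)"
  by (simp add: wave_function_def)

lemma wave_function_add:
  "wave_function S \<psi> \<Longrightarrow> wave_function S \<phi> \<Longrightarrow> wave_function S (\<lambda>x. \<psi> x + \<phi> x)"
  by (simp add: wave_function_def spin_space_add)

lemma wave_function_scaleC: "wave_function S \<psi> \<Longrightarrow> wave_function S (\<lambda>x. c *\<^sub>C \<psi> x)"
  by (simp add: wave_function_def spin_space_scaleC)

lemma wave_function_minus: "wave_function S \<psi> \<Longrightarrow> wave_function S (\<lambda>x. - \<psi> x)"
  using wave_function_scaleC[of \<psi> "-1"] by simp

lemma wave_function_diff:
  "wave_function S \<psi> \<Longrightarrow> wave_function S \<phi> \<Longrightarrow> wave_function S (\<lambda>x. \<psi> x - \<phi> x)"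
  using wave_function_add[OF _ wave_function_minus, of \<psi> \<phi>] by simp

lemma wave_function_outside: "wave_function S \<psi> \<Longrightarrow> x \<notin> spacetime S \<Longrightarrow> \<psi> x = 0"
  by (simp add: wave_function_def)

lemma wave_function_inside: "wave_function S \<psi> \<Longrightarrow> x \<in> spacetime S \<Longrightarrow> \<psi> x \<in> spin_space x"
  by (simp add: wave_function_def)

lemma op_half_scaleC: "x \<in> spacetime S \<Longrightarrow> op_half x (c *\<^sub>C u) = c *\<^sub>C op_half x u"
  by (rule selfadjoint_scaleC, rule op_half_selfadjoint)
    (rule spacetime_selfadjoint spacetime_finite_rank, assumption)+

lemma op_half_scaleC_wave:
  "wave_function S \<psi> \<Longrightarrow> op_half x (c *\<^sub>C \<psi> x) = c *\<^sub>C op_half x (\<psi> x)"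
  by (cases "x \<in> spacetime S") (simp_all add: op_half_scaleC wave_function_outside blinfun.zero_right)

lemma op_half_wave_eq_0:
  "wave_function S \<psi> \<Longrightarrow> op_half x (\<psi> x) = 0 \<longleftrightarrow> \<psi> x = 0"
  by (cases "x \<in> spacetime S")
    (auto simp: wave_function_outside blinfun.zero_right
      dest!: op_half_eq_0[OF spacetime_selfadjoint spacetime_finite_rank, rotated 2] wave_function_inside)

lemma measurable_wave_iff:
  "measurable_wave S \<psi> \<longleftrightarrow> wave_function S \<psi> \<and> (\<lambda>x. op_half x (\<psi> x)) \<in> borel_measurable (rho S)"
  by (simp add: measurable_wave_def op_half_def)

section \<open>Square integrable wave functions\<close>

text \<open>Nothing is assumed about \<open>eta\<close> outside spacetime. Putting the weight to 0
  there makes it measurable and, for ordered times, non-negative on the whole operator manifold;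
  wave functions vanish there anyway.\<close>

definition strip_weight :: "real \<Rightarrow> real \<Rightarrow> 'h op \<Rightarrow> real" where
  "strip_weight t0 t1 x = (if x \<in> spacetime S then eta S t1 x - eta S t0 x else 0)"

lemma strip_weight_measurable [measurable]: "strip_weight t0 t1 \<in> borel_measurable (rho S)"
  unfolding strip_weight_def
  by (rule borel_measurable_on_spacetime) (intro continuous_intros eta_continuous)

lemma strip_weight_nonneg: "t0 \<le> t1 \<Longrightarrow> strip_weight t0 t1 x \<ge> 0"
  by (simp add: strip_weight_def eta_mono)

lemma strip_weight_mono:
  "s0 \<le> t0 \<Longrightarrow> t1 \<le> s1 \<Longrightarrow> strip_weight t0 t1 x \<le> strip_weight s0 s1 x"
  using eta_mono[of x s0 t0] eta_mono[of x t1 s1] by (auto simp: strip_weight_def)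

definition L2_sq :: "real \<Rightarrow> real \<Rightarrow> 'h wave \<Rightarrow> real" where
  "L2_sq t0 t1 \<psi> = (LINT x|rho S. strip_weight t0 t1 x * (norm (op_half x (\<psi> x)))\<^sup>2)"

definition L2_krein :: "real \<Rightarrow> real \<Rightarrow> 'h wave \<Rightarrow> 'h wave \<Rightarrow> complex" where
  "L2_krein t0 t1 \<psi> \<phi> = (LINT x|rho S. of_real (strip_weight t0 t1 x) * spin_inner x (\<psi> x) (\<phi> x))"

lemma weighted_eucl_inner:
  assumes "wave_function S \<psi>"
  shows "of_real (eta S t1 x - eta S t0 x) * eucl_inner x (\<psi> x) (\<phi> x)
    = of_real (strip_weight t0 t1 x) * cinner (op_half x (\<psi> x)) (op_half x (\<phi> x))"
proof (cases "x \<in> spacetime S")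
  case True
  then show ?thesis
    by (simp add: strip_weight_def eucl_inner_op_half[OF spacetime_selfadjoint spacetime_finite_rank])
next
  case False
  then show ?thesis
    by (simp add: strip_weight_def wave_function_outside[OF assms] eucl_inner_def)
qed

lemma L2_inner_eq:
  "wave_function S \<psi> \<Longrightarrow> L2_inner S t0 t1 \<psi> \<phi>
    = (LINT x|rho S. of_real (strip_weight t0 t1 x) * cinner (op_half x (\<psi> x)) (op_half x (\<phi> x)))"
  unfolding L2_inner_def by (simp only: weighted_eucl_inner)

lemma L2_inner_self: "wave_function S \<psi> \<Longrightarrow> L2_inner S t0 t1 \<psi> \<psi> = of_real (L2_sq t0 t1 \<psi>)"
  by (simp add: L2_inner_eq L2_sq_def cinner_self flip: integral_complex_of_real of_real_mult of_real_power)

lemma L2_norm_eq: "wave_function S \<psi> \<Longrightarrow> L2_norm S t0 t1 \<psi> = sqrt (L2_sq t0 t1 \<psi>)"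
  by (simp add: L2_norm_def L2_inner_self)

lemma L2_strip_iff:
  "\<psi> \<in> L2_strip S t0 t1 \<longleftrightarrow> wave_function S \<psi> \<and> (\<lambda>x. op_half x (\<psi> x)) \<in> borel_measurable (rho S) \<and>
    integrable (rho S) (\<lambda>x. strip_weight t0 t1 x * (norm (op_half x (\<psi> x)))\<^sup>2)"
proof -
  have "integrable (rho S) (\<lambda>x. of_real (eta S t1 x - eta S t0 x) * eucl_inner x (\<psi> x) (\<psi> x))
      \<longleftrightarrow> integrable (rho S) (\<lambda>x. strip_weight t0 t1 x * (norm (op_half x (\<psi> x)))\<^sup>2)"
    if "wave_function S \<psi>"
    unfolding weighted_eucl_inner[OF that] cinner_self
    by (simp add: complex_of_real_integrable_eq flip: of_real_mult of_real_power)
  then show ?thesis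
    unfolding L2_strip_def measurable_wave_iff by blast
qed

lemma L2_strip_wave: "\<psi> \<in> L2_strip S t0 t1 \<Longrightarrow> wave_function S \<psi>"
  and L2_strip_measurable:
    "\<psi> \<in> L2_strip S t0 t1 \<Longrightarrow> (\<lambda>x. op_half x (\<psi> x)) \<in> borel_measurable (rho S)"
  and L2_strip_integrable: "\<psi> \<in> L2_strip S t0 t1 \<Longrightarrow>
    integrable (rho S) (\<lambda>x. strip_weight t0 t1 x * (norm (op_half x (\<psi> x)))\<^sup>2)"
  by (simp_all add: L2_strip_iff)

lemma L2_sq_nonneg: "t0 \<le> t1 \<Longrightarrow> L2_sq t0 t1 \<psi> \<ge> 0"
  by (simp add: L2_sq_def strip_weight_nonneg)

lemma L2_strip_zero: "(\<lambda>x. 0) \<in> L2_strip S t0 t1"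
  by (simp add: L2_strip_iff wave_function_zero blinfun.zero_right)

lemma L2_strip_scaleC:
  assumes "\<psi> \<in> L2_strip S t0 t1"
  shows "(\<lambda>x. c *\<^sub>C \<psi> x) \<in> L2_strip S t0 t1"
    and "L2_sq t0 t1 (\<lambda>x. c *\<^sub>C \<psi> x) = (cmod c)\<^sup>2 * L2_sq t0 t1 \<psi>"
proof -
  have eq: "strip_weight t0 t1 x * (norm (op_half x (c *\<^sub>C \<psi> x)))\<^sup>2
      = (cmod c)\<^sup>2 * (strip_weight t0 t1 x * (norm (op_half x (\<psi> x)))\<^sup>2)" for x
    by (simp add: op_half_scaleC_wave[OF L2_strip_wave[OF assms]] norm_scaleC power_mult_distrib)
  have "(\<lambda>x. c *\<^sub>C op_half x (\<psi> x)) \<in> borel_measurable (rho S)"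
    using borel_measurable_continuous_onI[OF linear_continuous_on[OF bounded_linear_scaleC[of c]]]
      L2_strip_measurable[OF assms] by (rule measurable_compose[rotated])
  then show "(\<lambda>x. c *\<^sub>C \<psi> x) \<in> L2_strip S t0 t1"
    using assms unfolding L2_strip_iff eq
    by (simp add: wave_function_scaleC op_half_scaleC_wave)
  show "L2_sq t0 t1 (\<lambda>x. c *\<^sub>C \<psi> x) = (cmod c)\<^sup>2 * L2_sq t0 t1 \<psi>"
    unfolding L2_sq_def eq by simp
qed

lemma L2_strip_minus: "\<psi> \<in> L2_strip S t0 t1 \<Longrightarrow> (\<lambda>x. - \<psi> x) \<in> L2_strip S t0 t1"
  using L2_strip_scaleC(1)[of \<psi> t0 t1 "-1"] by simp

text \<open>The quadratic inequality with factors 2 stands in for the triangle inequality; it is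
  strong enough for limits and avoids square roots.\<close>

lemma L2_strip_add:
  assumes "t0 \<le> t1" and psi: "\<psi> \<in> L2_strip S t0 t1" and phi: "\<phi> \<in> L2_strip S t0 t1"
  shows "(\<lambda>x. \<psi> x + \<phi> x) \<in> L2_strip S t0 t1"
    and "L2_sq t0 t1 (\<lambda>x. \<psi> x + \<phi> x) \<le> 2 * L2_sq t0 t1 \<psi> + 2 * L2_sq t0 t1 \<phi>"
proof -
  note [measurable] = L2_strip_measurable[OF psi] L2_strip_measurable[OF phi]
  let ?r = "\<lambda>x. 2 * (strip_weight t0 t1 x * (norm (op_half x (\<psi> x)))\<^sup>2)
    + 2 * (strip_weight t0 t1 x * (norm (op_half x (\<phi> x)))\<^sup>2)"
  have le: "strip_weight t0 t1 x * (norm (op_half x (\<psi> x) + op_half x (\<phi> x)))\<^sup>2 \<le> ?r x" for x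
    using mult_left_mono[OF norm_add_sq_le strip_weight_nonneg[OF assms(1)], of x]
    by (simp add: algebra_simps)
  have r: "integrable (rho S) ?r"
    using L2_strip_integrable[OF psi] L2_strip_integrable[OF phi] by simp
  have int: "integrable (rho S) (\<lambda>x. strip_weight t0 t1 x * (norm (op_half x (\<psi> x) + op_half x (\<phi> x)))\<^sup>2)"
  proof (rule Bochner_Integration.integrable_bound[OF r])
    show "AE x in rho S. norm (strip_weight t0 t1 x * (norm (op_half x (\<psi> x) + op_half x (\<phi> x)))\<^sup>2) \<le> norm (?r x)"
    proof (rule AE_I2)
      fix x
      have "norm (strip_weight t0 t1 x * (norm (op_half x (\<psi> x) + op_half x (\<phi> x)))\<^sup>2)
          = strip_weight t0 t1 x * (norm (op_half x (\<psi> x) + op_half x (\<phi> x)))\<^sup>2"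
        using strip_weight_nonneg[OF assms(1)] by (simp add: abs_mult)
      also have "\<dots> \<le> norm (?r x)" unfolding real_norm_def by (rule order_trans[OF le abs_ge_self])
      finally show "norm (strip_weight t0 t1 x * (norm (op_half x (\<psi> x) + op_half x (\<phi> x)))\<^sup>2) \<le> norm (?r x)" .
    qed
  qed measurable
  then show "(\<lambda>x. \<psi> x + \<phi> x) \<in> L2_strip S t0 t1"
    using psi phi by (simp add: L2_strip_iff wave_function_add blinfun.add_right)
  have "L2_sq t0 t1 (\<lambda>x. \<psi> x + \<phi> x) \<le> (LINT x|rho S. ?r x)"
    unfolding L2_sq_def blinfun.add_right by (intro integral_mono int r le)
  also have "\<dots> = 2 * L2_sq t0 t1 \<psi> + 2 * L2_sq t0 t1 \<phi>"
    using L2_strip_integrable[OF psi] L2_strip_integrable[OF phi] by (simp add: L2_sq_def)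
  finally show "L2_sq t0 t1 (\<lambda>x. \<psi> x + \<phi> x) \<le> 2 * L2_sq t0 t1 \<psi> + 2 * L2_sq t0 t1 \<phi>" .
qed

lemma L2_strip_diff:
  assumes "t0 \<le> t1" "\<psi> \<in> L2_strip S t0 t1" "\<phi> \<in> L2_strip S t0 t1"
  shows "(\<lambda>x. \<psi> x - \<phi> x) \<in> L2_strip S t0 t1"
  using L2_strip_add(1)[OF assms(1,2) L2_strip_minus[OF assms(3)]] by simp

lemma L2_strip_mono:
  assumes "s0 \<le> t0" "t0 \<le> t1" "t1 \<le> s1" and psi: "\<psi> \<in> L2_strip S s0 s1"
  shows "\<psi> \<in> L2_strip S t0 t1" and "L2_sq t0 t1 \<psi> \<le> L2_sq s0 s1 \<psi>"
proof -
  note [measurable] = L2_strip_measurable[OF psi]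
  have le: "strip_weight t0 t1 x * (norm (op_half x (\<psi> x)))\<^sup>2
      \<le> strip_weight s0 s1 x * (norm (op_half x (\<psi> x)))\<^sup>2" for x
    using strip_weight_mono[OF assms(1,3)] by (intro mult_right_mono) auto
  have int: "integrable (rho S) (\<lambda>x. strip_weight t0 t1 x * (norm (op_half x (\<psi> x)))\<^sup>2)"
  proof (rule Bochner_Integration.integrable_bound[OF L2_strip_integrable[OF psi]])
    show "AE x in rho S. norm (strip_weight t0 t1 x * (norm (op_half x (\<psi> x)))\<^sup>2)
        \<le> norm (strip_weight s0 s1 x * (norm (op_half x (\<psi> x)))\<^sup>2)"
      using le strip_weight_nonneg[OF assms(2)] strip_weight_nonneg[of s0 s1] assms
      by (intro AE_I2) (simp add: abs_mult)
  qed measurable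
  then show "\<psi> \<in> L2_strip S t0 t1"
    using psi by (simp add: L2_strip_iff)
  show "L2_sq t0 t1 \<psi> \<le> L2_sq s0 s1 \<psi>"
    unfolding L2_sq_def by (intro integral_mono int L2_strip_integrable[OF psi] le)
qed

lemma L2_inner_Cauchy_Schwarz:
  assumes "t0 \<le> t1" and psi: "\<psi> \<in> L2_strip S t0 t1" and phi: "\<phi> \<in> L2_strip S t0 t1"
  shows "integrable (rho S) (\<lambda>x. of_real (strip_weight t0 t1 x) * cinner (op_half x (\<psi> x)) (op_half x (\<phi> x)))"
    and "cmod (L2_inner S t0 t1 \<psi> \<phi>) \<le> sqrt (L2_sq t0 t1 \<psi>) * sqrt (L2_sq t0 t1 \<phi>)"
  using weighted_Cauchy_Schwarz[OF L2_strip_measurable[OF psi] L2_strip_measurable[OF phi]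
      strip_weight_measurable strip_weight_nonneg[OF assms(1)] L2_strip_integrable[OF psi]
      L2_strip_integrable[OF phi]]
  by (simp_all add: L2_inner_eq[OF L2_strip_wave[OF psi]] L2_sq_def)

lemma spin_inner_spacetime:
  "x \<in> spacetime S \<Longrightarrow> spin_inner x u v = - cinner (op_half x u) (op_sgn x (op_half x v))"
  by (rule spin_inner_op_half[OF spacetime_selfadjoint spacetime_finite_rank])

lemma spin_inner_commute: "x \<in> spacetime S \<Longrightarrow> spin_inner x u v = cnj (spin_inner x v u)"
  unfolding spin_inner_def
  by (metis cinner_commute complex_cnj_minus selfadjointD spacetime_selfadjoint)

lemma weighted_spin_inner:
  "of_real (strip_weight t0 t1 x) * spin_inner x u v
    = - (of_real (strip_weight t0 t1 x) * cinner (op_half x u) (op_sgn x (op_half x v)))"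
  by (cases "x \<in> spacetime S") (simp_all add: spin_inner_spacetime strip_weight_def)

text \<open>The spin inner product is, up to sign, the Euclidean one with \<open>op_sgn\<close>
  inserted, and \<open>op_sgn\<close> does not increase norms.\<close>

lemma L2_krein_Cauchy_Schwarz:
  assumes "t0 \<le> t1" and psi: "\<psi> \<in> L2_strip S t0 t1" and phi: "\<phi> \<in> L2_strip S t0 t1"
  shows "integrable (rho S) (\<lambda>x. of_real (strip_weight t0 t1 x) * spin_inner x (\<psi> x) (\<phi> x))"
    and "cmod (L2_krein t0 t1 \<psi> \<phi>) \<le> sqrt (L2_sq t0 t1 \<psi>) * sqrt (L2_sq t0 t1 \<phi>)"
proof -
  note m = borel_measurable_op_sgn[OF L2_strip_measurable[OF phi]]
  note [measurable] = m
  have le: "strip_weight t0 t1 x * (norm (op_sgn x (op_half x (\<phi> x))))\<^sup>2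
      \<le> strip_weight t0 t1 x * (norm (op_half x (\<phi> x)))\<^sup>2" for x
  proof (cases "x \<in> spacetime S")
    case True
    then show ?thesis
      using norm_op_sgn_le[OF spacetime_selfadjoint spacetime_finite_rank]
      by (intro mult_left_mono power_mono strip_weight_nonneg[OF assms(1)]) auto
  qed (simp add: strip_weight_def)
  have int: "integrable (rho S) (\<lambda>x. strip_weight t0 t1 x * (norm (op_sgn x (op_half x (\<phi> x))))\<^sup>2)"
  proof (rule Bochner_Integration.integrable_bound[OF L2_strip_integrable[OF phi]])
    show "AE x in rho S. norm (strip_weight t0 t1 x * (norm (op_sgn x (op_half x (\<phi> x))))\<^sup>2)
        \<le> norm (strip_weight t0 t1 x * (norm (op_half x (\<phi> x)))\<^sup>2)"
      using le strip_weight_nonneg[OF assms(1)] by (intro AE_I2) (simp add: abs_mult)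
  qed measurable
  note CS = weighted_Cauchy_Schwarz[OF L2_strip_measurable[OF psi] m strip_weight_measurable
      strip_weight_nonneg[OF assms(1)] L2_strip_integrable[OF psi] int]
  show "integrable (rho S) (\<lambda>x. of_real (strip_weight t0 t1 x) * spin_inner x (\<psi> x) (\<phi> x))"
    unfolding weighted_spin_inner using CS(1) by (rule Bochner_Integration.integrable_minus)
  have "(LINT x|rho S. strip_weight t0 t1 x * (norm (op_sgn x (op_half x (\<phi> x))))\<^sup>2) \<le> L2_sq t0 t1 \<phi>"
    unfolding L2_sq_def by (intro integral_mono int L2_strip_integrable[OF phi] le)
  then have "sqrt (L2_sq t0 t1 \<psi>) * sqrt (LINT x|rho S. strip_weight t0 t1 x * (norm (op_sgn x (op_half x (\<phi> x))))\<^sup>2)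
      \<le> sqrt (L2_sq t0 t1 \<psi>) * sqrt (L2_sq t0 t1 \<phi>)"
    using L2_sq_nonneg[OF assms(1)] by (intro mult_left_mono real_sqrt_le_mono) auto
  then show "cmod (L2_krein t0 t1 \<psi> \<phi>) \<le> sqrt (L2_sq t0 t1 \<psi>) * sqrt (L2_sq t0 t1 \<phi>)"
    using CS(2) unfolding L2_krein_def weighted_spin_inner integral_minus norm_minus_cancel L2_sq_def
    by (rule order_trans[rotated])
qed

lemma L2_krein_commute: "L2_krein t0 t1 \<psi> \<phi> = cnj (L2_krein t0 t1 \<phi> \<psi>)"
proof -
  have "of_real (strip_weight t0 t1 x) * spin_inner x (\<psi> x) (\<phi> x)
      = cnj (of_real (strip_weight t0 t1 x) * spin_inner x (\<phi> x) (\<psi> x))" for x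
    using spin_inner_commute[of x "\<psi> x" "\<phi> x"] by (cases "x \<in> spacetime S") (auto simp: strip_weight_def)
  then have "L2_krein t0 t1 \<psi> \<phi> = (LINT x|rho S. cnj (of_real (strip_weight t0 t1 x) * spin_inner x (\<phi> x) (\<psi> x)))"
    unfolding L2_krein_def by (simp only:)
  also have "\<dots> = cnj (L2_krein t0 t1 \<phi> \<psi>)"
    unfolding L2_krein_def
    by (rule integral_bounded_linear'[OF bounded_linear_cnj bounded_linear_cnj]) simp
  finally show ?thesis .
qed

lemma sign_op_eq: "x \<in> spacetime S \<Longrightarrow> sign_op S \<psi> x = - op_sgn x (\<psi> x)"
  by (simp add: sign_op_def eucl_sign_eq[OF spacetime_selfadjoint spacetime_finite_rank])

lemma sign_op_outside: "x \<notin> spacetime S \<Longrightarrow> sign_op S \<psi> x = 0"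
  by (simp add: sign_op_def)

lemma sign_op_wave: "wave_function S (sign_op S \<psi>)"
proof -
  have "- op_sgn x (\<psi> x) \<in> spin_space x" if "x \<in> spacetime S" for x
    using op_sgn_spin_space[OF spacetime_selfadjoint spacetime_finite_rank, OF that that, of "- \<psi> x"]
    by (simp add: blinfun.minus_right)
  then show ?thesis
    by (simp add: wave_function_def sign_op_eq sign_op_outside)
qed

lemma sign_op_add: "sign_op S (\<lambda>x. \<psi> x + \<phi> x) = (\<lambda>x. sign_op S \<psi> x + sign_op S \<phi> x)"
  by (rule ext, case_tac "x \<in> spacetime S") (simp_all add: sign_op_eq sign_op_outside blinfun.add_right)

lemma sign_op_scaleC: "sign_op S (\<lambda>x. c *\<^sub>C \<psi> x) = (\<lambda>x. c *\<^sub>C sign_op S \<psi> x)"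
proof
  fix x
  show "sign_op S (\<lambda>x. c *\<^sub>C \<psi> x) x = c *\<^sub>C sign_op S \<psi> x"
    by (cases "x \<in> spacetime S")
      (simp_all add: sign_op_eq sign_op_outside complex_vector.scale_minus_right
        selfadjoint_scaleC[OF op_sgn_selfadjoint[OF spacetime_selfadjoint spacetime_finite_rank]])
qed

lemma sign_op_zero: "sign_op S (\<lambda>x. 0) = (\<lambda>x. 0)"
  using sign_op_scaleC[of 0 "\<lambda>x. 0"] by simp

lemma norm_sign_op:
  assumes "wave_function S \<psi>" "x \<in> spacetime S"
  shows "norm (op_half x (sign_op S \<psi> x)) = norm (op_half x (\<psi> x))"
  using assms(2) op_half_spin_space[OF spacetime_selfadjoint spacetime_finite_rank, OF assms(2,2)]
  by (simp add: sign_op_eq blinfun.minus_right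
    op_half_op_sgn[OF spacetime_selfadjoint spacetime_finite_rank, OF assms(2,2)]
    norm_op_sgn[OF spacetime_selfadjoint spacetime_finite_rank, OF assms(2,2)])

lemma L2_sq_sign_op: "wave_function S \<psi> \<Longrightarrow> L2_sq t0 t1 (sign_op S \<psi>) = L2_sq t0 t1 \<psi>"
  unfolding L2_sq_def
  by (rule Bochner_Integration.integral_cong[OF refl], case_tac "x \<in> spacetime S")
    (simp_all add: norm_sign_op strip_weight_def)

text \<open>This turns the Euclidean pairing with E w in the definition of a canonical solution into
  the Krein pairing with w, with respect to which \<open>Qdyn\<close> is symmetric.\<close>

lemma L2_inner_sign_op: "L2_inner S t0 t1 (sign_op S \<psi>) \<phi> = L2_krein t0 t1 \<psi> \<phi>"
  unfolding L2_inner_eq[OF sign_op_wave] L2_krein_def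
proof (rule Bochner_Integration.integral_cong[OF refl])
  fix x
  show "of_real (strip_weight t0 t1 x) * cinner (op_half x (sign_op S \<psi> x)) (op_half x (\<phi> x))
      = of_real (strip_weight t0 t1 x) * spin_inner x (\<psi> x) (\<phi> x)"
  proof (cases "x \<in> spacetime S")
    case True
    note sf = spacetime_selfadjoint[OF True] spacetime_finite_rank[OF True]
    show ?thesis
      using True eucl_inner_eucl_sign[OF sf, of "\<psi> x" "\<phi> x"]
      by (simp add: eucl_inner_op_half[OF sf] sign_op_def)
  qed (simp add: strip_weight_def)
qed


section \<open>Locally square integrable wave functions\<close>

lemma L2_loc_strip: "\<psi> \<in> L2_loc S \<Longrightarrow> t0 < t1 \<Longrightarrow> \<psi> \<in> L2_strip S t0 t1"
  by (simp add: L2_loc_def)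

lemma L2_loc_wave: "\<psi> \<in> L2_loc S \<Longrightarrow> wave_function S \<psi>"
  using L2_loc_strip[of \<psi> 0 1] L2_strip_wave by simp

lemma L2_loc_zero: "(\<lambda>x. 0) \<in> L2_loc S"
  by (simp add: L2_loc_def L2_strip_zero)

lemma L2_loc_add: "\<psi> \<in> L2_loc S \<Longrightarrow> \<phi> \<in> L2_loc S \<Longrightarrow> (\<lambda>x. \<psi> x + \<phi> x) \<in> L2_loc S"
  by (simp add: L2_loc_def L2_strip_add less_imp_le)

lemma L2_loc_scaleC: "\<psi> \<in> L2_loc S \<Longrightarrow> (\<lambda>x. c *\<^sub>C \<psi> x) \<in> L2_loc S"
  by (simp add: L2_loc_def L2_strip_scaleC)

lemma L2_loc_minus: "\<psi> \<in> L2_loc S \<Longrightarrow> (\<lambda>x. - \<psi> x) \<in> L2_loc S"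
  using L2_loc_scaleC[of \<psi> "-1"] by simp

lemma L2_loc_diff: "\<psi> \<in> L2_loc S \<Longrightarrow> \<phi> \<in> L2_loc S \<Longrightarrow> (\<lambda>x. \<psi> x - \<phi> x) \<in> L2_loc S"
  using L2_loc_add[OF _ L2_loc_minus, of \<psi> \<phi>] by simp

text \<open>Every point of spacetime has weight 1 in the strip from -(n+1) to n+1 for large n, so
  countably many strips decide; \<open>op_half\<close> is injective on the spin spaces.\<close>

lemma AE_zero_if_L2_sq_zero:
  assumes psi: "\<psi> \<in> L2_loc S" and zero: "\<And>t0 t1. t0 < t1 \<Longrightarrow> L2_sq t0 t1 \<psi> = 0"
  shows "AE x in rho S. \<psi> x = 0"
proof -
  have "AE x in rho S. strip_weight (- real (Suc n)) (real (Suc n)) x * (norm (op_half x (\<psi> x)))\<^sup>2 = 0" for n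
  proof -
    \<comment> \<open>With \<open>Suc n\<close> in place of n the end points are distinct also for n
      = 0.\<close>
    have lt: "- real (Suc n) < real (Suc n)" by simp
    show ?thesis
      using zero[OF lt] integral_nonneg_eq_0_iff_AE[OF L2_strip_integrable[OF L2_loc_strip[OF psi lt]]]
        strip_weight_nonneg[OF less_imp_le[OF lt]]
      by (simp add: L2_sq_def)
  qed
  then have "AE x in rho S. \<forall>n. strip_weight (- real (Suc n)) (real (Suc n)) x * (norm (op_half x (\<psi> x)))\<^sup>2 = 0"
    by (subst AE_all_countable) blast
  then show ?thesis
  proof eventually_elim
    fix x assume *: "\<forall>n. strip_weight (- real (Suc n)) (real (Suc n)) x * (norm (op_half x (\<psi> x)))\<^sup>2 = 0"
    show "\<psi> x = 0"
    proof (cases "x \<in> spacetime S")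
      case True
      obtain a b where ab: "eta S a x = 0" "eta S b x = 1" using eta_zero_one_exist[OF True] by blast
      obtain n where n: "max \<bar>a\<bar> \<bar>b\<bar> < real n" using reals_Archimedean2 by blast
      then have "- real (Suc n) \<le> a" "b \<le> real (Suc n)" by auto
      then have "eta S (- real (Suc n)) x \<le> eta S a x" "eta S b x \<le> eta S (real (Suc n)) x"
        by (auto intro: eta_mono[OF True] simp del: of_nat_Suc)
      then have "strip_weight (- real (Suc n)) (real (Suc n)) x = 1"
        using ab eta_bounds[OF True] True by (simp add: strip_weight_def) (smt (verit))
      then have "op_half x (\<psi> x) = 0" using *[rule_format, of n] by simp
      then show ?thesis by (simp add: op_half_wave_eq_0[OF L2_loc_wave[OF psi]])
    qed (simp add: wave_function_outside[OF L2_loc_wave[OF psi]])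
  qed
qed

section \<open>Continuous wave functions and bounded time support\<close>

lemma Cvary_wave: "\<psi> \<in> Cvary S \<Longrightarrow> wave_function S \<psi>"
  and Cvary_half_continuous: "\<psi> \<in> Cvary S \<Longrightarrow> continuous_on (spacetime S) (\<lambda>x. op_half x (\<psi> x))"
  using Cvary_continuous by (auto simp: continuous_waves_def op_half_def)

lemma Cvary_zero: "(\<lambda>x. 0) \<in> Cvary S"
  and Cvary_add: "\<psi> \<in> Cvary S \<Longrightarrow> \<phi> \<in> Cvary S \<Longrightarrow> (\<lambda>x. \<psi> x + \<phi> x) \<in> Cvary S"
  and Cvary_scaleC: "\<psi> \<in> Cvary S \<Longrightarrow> (\<lambda>x. c *\<^sub>C \<psi> x) \<in> Cvary S"
  using Cvary_subspace by (simp_all add: wave_subspace_def)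

text \<open>Spacetime is the support of the measure, so that for continuous functions vanishing almost
  everywhere and vanishing everywhere are the same.\<close>

lemma Cvary_scaled_AE_zero:
  assumes psi: "\<psi> \<in> Cvary S" and c: "continuous_on (spacetime S) c"
    and ae: "AE x in rho S. c x *\<^sub>R \<psi> x = 0" and x: "x \<in> spacetime S"
  shows "c x *\<^sub>R \<psi> x = 0"
proof (rule ccontr)
  assume nz: "c x *\<^sub>R \<psi> x \<noteq> 0"
  have "continuous_on (spacetime S) (\<lambda>x. c x *\<^sub>R op_half x (\<psi> x))"
    by (intro continuous_intros c Cvary_half_continuous[OF psi])
  then have "openin (top_of_set (spacetime S)) (spacetime S \<inter> (\<lambda>x. c x *\<^sub>R op_half x (\<psi> x)) -` (- {0}))"
    by (rule continuous_openin_preimage_gen) auto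
  then obtain U where U: "open U" "spacetime S \<inter> (\<lambda>x. c x *\<^sub>R op_half x (\<psi> x)) -` (- {0}) = spacetime S \<inter> U"
    unfolding openin_open by blast
  have "x \<in> U" using U(2) x nz op_half_wave_eq_0[OF Cvary_wave[OF psi], of x] by auto
  have "AE y in rho S. y \<notin> U \<inter> ops S"
    using ae AE_spacetime
  proof eventually_elim
    fix y assume y: "c y *\<^sub>R \<psi> y = 0" "y \<in> spacetime S"
    then have "y \<notin> spacetime S \<inter> (\<lambda>x. c x *\<^sub>R op_half x (\<psi> x)) -` (- {0})"
      by (auto simp: blinfun.zero_right)
    with y(2) U(2) show "y \<notin> U \<inter> ops S" by blast
  qed
  then have "emeasure (rho S) (U \<inter> ops S) = 0"
    using AE_iff_null_sets[OF open_Int_ops[OF U(1)]] by (simp add: null_sets_def)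
  then show False using x \<open>x \<in> U\<close> U(1) by (auto simp: spacetime_def)
qed

lemma Cvary_AE_zero:
  assumes psi: "\<psi> \<in> Cvary S" and ae: "AE x in rho S. \<psi> x = 0"
  shows "\<psi> = (\<lambda>x. 0)"
proof
  fix x
  show "\<psi> x = 0"
    using Cvary_scaled_AE_zero[OF psi continuous_on_const[of _ 1]] ae
      wave_function_outside[OF Cvary_wave[OF psi], of x] by (cases "x \<in> spacetime S") auto
qed

text \<open>The time support is encoded by the values of \<open>eta\<close> at the end points, so
  that any strip containing [a, b] has weight exactly 1 where the function is non-zero. The
  condition is pointwise rather than almost everywhere.\<close>

definition time_bounded :: "real \<Rightarrow> real \<Rightarrow> 'h wave \<Rightarrow> bool" where
  "time_bounded a b \<psi> \<longleftrightarrow> a < b \<and> (\<forall>x. \<psi> x \<noteq> 0 \<longrightarrow> x \<in> spacetime S \<and> eta S a x = 0 \<and> eta S b x = 1)"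

lemma time_bounded_mono:
  assumes "time_bounded a b \<psi>" "a' \<le> a" "b \<le> b'"
  shows "time_bounded a' b' \<psi>"
proof -
  have "x \<in> spacetime S \<and> eta S a' x = 0 \<and> eta S b' x = 1" if "\<psi> x \<noteq> 0" for x
  proof -
    have x: "x \<in> spacetime S" "eta S a x = 0" "eta S b x = 1"
      using assms(1) that by (auto simp: time_bounded_def)
    then show ?thesis
      using eta_mono[OF x(1) assms(2)] eta_mono[OF x(1) assms(3)] eta_bounds[OF x(1), of a']
        eta_bounds[OF x(1), of b'] by simp
  qed
  then show ?thesis using assms by (auto simp: time_bounded_def)
qed

lemma time_bounded_weight:
  assumes "time_bounded a b \<psi>" "\<psi> x \<noteq> 0"
  shows "strip_weight a b x = 1"
  using assms by (auto simp: time_bounded_def strip_weight_def)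

lemma time_bounded_L2_tc:
  assumes "time_bounded a b \<psi>" "\<psi> \<in> L2_loc S"
  shows "\<psi> \<in> L2_tc S"
proof -
  have "eta S a x *\<^sub>R \<psi> x = 0" "(1 - eta S b x) *\<^sub>R \<psi> x = 0" for x
    using assms(1) by (cases "\<psi> x = 0"; auto simp: time_bounded_def)+
  then show ?thesis
    using assms(2) unfolding L2_tc_def L2_pc_def L2_fc_def by auto
qed

lemma spin_inner_scaleC: "x \<in> spacetime S \<Longrightarrow> spin_inner x u (c *\<^sub>C v) = c * spin_inner x u v"
  by (simp add: spin_inner_def selfadjoint_scaleC[OF spacetime_selfadjoint] cinner_scaleC_right)

text \<open>Frees pairings from the strip: any two strips containing the time support give the same
  value.\<close>

lemma time_bounded_krein:
  assumes tb: "time_bounded a b \<psi>"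
  shows "krein_inner S \<psi> \<phi> = L2_krein a b \<psi> \<phi>" and "krein_inner S \<phi> \<psi> = L2_krein a b \<phi> \<psi>"
proof -
  have *: "of_real (strip_weight a b x) * spin_inner x (\<psi> x) (\<phi> x) = spin_inner x (\<psi> x) (\<phi> x)"
    "of_real (strip_weight a b x) * spin_inner x (\<phi> x) (\<psi> x) = spin_inner x (\<phi> x) (\<psi> x)" for x
    using time_bounded_weight[OF tb, of x] by (cases "\<psi> x = 0"; simp)+
  show "krein_inner S \<psi> \<phi> = L2_krein a b \<psi> \<phi>" "krein_inner S \<phi> \<psi> = L2_krein a b \<phi> \<psi>"
    unfolding krein_inner_def L2_krein_def * by (rule refl)+
qed

lemma krein_integrable:
  assumes tb: "time_bounded a b \<psi>" and "\<psi> \<in> L2_loc S" "\<phi> \<in> L2_loc S"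
  shows "integrable (rho S) (\<lambda>x. spin_inner x (\<psi> x) (\<phi> x))"
proof -
  have "a < b" using tb by (simp add: time_bounded_def)
  then have "integrable (rho S) (\<lambda>x. of_real (strip_weight a b x) * spin_inner x (\<psi> x) (\<phi> x))"
    using assms(2,3) by (intro L2_krein_Cauchy_Schwarz L2_loc_strip) auto
  also have "(\<lambda>x. of_real (strip_weight a b x) * spin_inner x (\<psi> x) (\<phi> x))
      = (\<lambda>x. spin_inner x (\<psi> x) (\<phi> x))"
    using time_bounded_weight[OF tb] by (rule_tac ext, case_tac "\<psi> x = 0") simp_all
  finally show ?thesis .
qed

lemma Cvary0_Cvary: "\<phi> \<in> Cvary0 S \<Longrightarrow> \<phi> \<in> Cvary S"
  by (simp add: Cvary0_def)

lemma Cvary0_time_bounded: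
  assumes "\<phi> \<in> Cvary0 S"
  obtains a b where "time_bounded a b \<phi>"
proof -
  obtain K where K: "compact K" "K \<subseteq> spacetime S" "\<And>x. x \<notin> K \<Longrightarrow> \<phi> x = 0"
    using assms by (auto simp: Cvary0_def)
  obtain a b where "a < b" "\<forall>y\<in>K. eta S a y = 0 \<and> eta S b y = 1"
    using compact_time_bounds[OF K(1,2)] by blast
  then have "time_bounded a b \<phi>" using K(2,3) by (auto simp: time_bounded_def)
  then show ?thesis by (rule that)
qed

text \<open>Continuity bounds the function on a compact set, which has finite measure, and the
  weights are at most 1.\<close>

lemma Cvary0_L2_loc:
  assumes "\<phi> \<in> Cvary0 S"
  shows "\<phi> \<in> L2_loc S"
proof -
  have phi: "\<phi> \<in> Cvary S" by (rule Cvary0_Cvary[OF assms])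
  obtain K where K: "compact K" "K \<subseteq> spacetime S" "\<And>x. x \<notin> K \<Longrightarrow> \<phi> x = 0"
    using assms by (auto simp: Cvary0_def)
  have eq: "(\<lambda>x. if x \<in> spacetime S then op_half x (\<phi> x) else 0) = (\<lambda>x. op_half x (\<phi> x))"
    by (rule ext) (simp add: wave_function_outside[OF Cvary_wave[OF phi]] blinfun.zero_right)
  have m [measurable]: "(\<lambda>x. op_half x (\<phi> x)) \<in> borel_measurable (rho S)"
    using borel_measurable_on_spacetime[OF Cvary_half_continuous[OF phi]] unfolding eq .
  have "bounded ((\<lambda>x. op_half x (\<phi> x)) ` K)"
    using K(1,2) Cvary_half_continuous[OF phi]
    by (intro compact_imp_bounded compact_continuous_image) (blast intro: continuous_on_subset)+
  then obtain c where c: "\<And>x. x \<in> K \<Longrightarrow> norm (op_half x (\<phi> x)) \<le> c"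
    unfolding bounded_iff by blast
  have ind: "integrable (rho S) (\<lambda>x. c\<^sup>2 * indicator K x)"
    using compact_finite_measure[OF K(1,2)] by simp
  have "\<phi> \<in> L2_strip S t0 t1" if "t0 < t1" for t0 t1
  proof -
    have "integrable (rho S) (\<lambda>x. strip_weight t0 t1 x * (norm (op_half x (\<phi> x)))\<^sup>2)"
    proof (rule Bochner_Integration.integrable_bound[OF ind])
      have "norm (strip_weight t0 t1 x * (norm (op_half x (\<phi> x)))\<^sup>2) \<le> norm (c\<^sup>2 * indicator K x :: real)" for x
      proof (cases "x \<in> K")
        case True
        have "0 \<le> strip_weight t0 t1 x" "strip_weight t0 t1 x \<le> 1"
          using strip_weight_nonneg[of t0 t1] that eta_bounds[of x t0] eta_bounds[of x t1] K(2) True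
          by (auto simp: strip_weight_def)
        then have "strip_weight t0 t1 x * (norm (op_half x (\<phi> x)))\<^sup>2 \<le> 1 * c\<^sup>2"
          using c[OF True] by (intro mult_mono power_mono) auto
        then show ?thesis using True \<open>0 \<le> strip_weight t0 t1 x\<close> by (simp add: abs_mult)
      qed (simp add: K(3) blinfun.zero_right)
      then show "AE x in rho S. norm (strip_weight t0 t1 x * (norm (op_half x (\<phi> x)))\<^sup>2) \<le> norm (c\<^sup>2 * indicator K x :: real)"
        by (intro AE_I2)
    qed measurable
    then show ?thesis using m Cvary_wave[OF phi] by (simp add: L2_strip_iff)
  qed
  then show ?thesis by (simp add: L2_loc_def)
qed

section \<open>The dynamical operator\<close>

lemma kern_add: "x \<in> spacetime S \<Longrightarrow> y \<in> spacetime S \<Longrightarrow> u \<in> spin_space y \<Longrightarrow> v \<in> spin_space y \<Longrightarrow>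
    kern S x y (u + v) = kern S x y u + kern S x y v"
  and kern_scaleC: "x \<in> spacetime S \<Longrightarrow> y \<in> spacetime S \<Longrightarrow> u \<in> spin_space y \<Longrightarrow>
    kern S x y (c *\<^sub>C u) = c *\<^sub>C kern S x y u"
  and kern_adjoint: "x \<in> spacetime S \<Longrightarrow> y \<in> spacetime S \<Longrightarrow> u \<in> spin_space x \<Longrightarrow> v \<in> spin_space y \<Longrightarrow>
    spin_inner x u (kern S x y v) = spin_inner y (kern S y x u) v"
  using kern_symmetric unfolding symmetric_kernel_def by blast+

lemma kern_zero: "x \<in> spacetime S \<Longrightarrow> y \<in> spacetime S \<Longrightarrow> kern S x y 0 = 0"
  using kern_scaleC[of x y 0 0] by simp

lemma kern_AE_integrable:
  "\<psi> \<in> L2_loc S \<Longrightarrow> AE x in rho S. integrable (rho S) (\<lambda>y. kern S x y (\<psi> y))"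
  and Qdyn_L2_loc: "\<psi> \<in> L2_loc S \<Longrightarrow> Qdyn S \<psi> \<in> L2_loc S"
  using finite_range unfolding finite_time_range_def by blast+

lemma finite_range_theta:
  obtains r where "r > 0" "\<And>s t x y u. \<lbrakk>x \<in> spacetime S; y \<in> spacetime S; theta S s x \<noteq> 0;
    theta S t y \<noteq> 0; \<bar>t - s\<bar> > r; u \<in> spin_space y\<rbrakk> \<Longrightarrow> kern S x y u = 0"
proof -
  obtain r where r: "r > 0" "\<forall>t0 t1. \<bar>t1 - t0\<bar> > r \<longrightarrow>
        (\<forall>x\<in>supp_on S (theta S t0). \<forall>y\<in>supp_on S (theta S t1). \<forall>u\<in>spin_space y. kern S x y u = 0)"
    using finite_range unfolding finite_time_range_def by blast
  show ?thesis
    by (rule that[OF r(1)]) (use r(2) theta_imp_supp in blast)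
qed

text \<open>Only almost everywhere, since the kernel integrals may diverge for exceptional x. Where
  all three converge, the integrands agree for y in spacetime, on whose spin spaces
  \<open>kern\<close> is additive.\<close>

lemma Qdyn_add_AE:
  assumes "u \<in> L2_loc S" "v \<in> L2_loc S"
  shows "AE x in rho S. Qdyn S (\<lambda>y. u y + v y) x = Qdyn S u x + Qdyn S v x"
  using kern_AE_integrable[OF assms(1)] kern_AE_integrable[OF assms(2)]
    kern_AE_integrable[OF L2_loc_add[OF assms]] AE_spacetime
proof eventually_elim
  fix x assume int: "integrable (rho S) (\<lambda>y. kern S x y (u y))" "integrable (rho S) (\<lambda>y. kern S x y (v y))"
    "integrable (rho S) (\<lambda>y. kern S x y (u y + v y))" and x: "x \<in> spacetime S"
  have "AE y in rho S. kern S x y (u y + v y) = kern S x y (u y) + kern S x y (v y)"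
    using AE_spacetime
    by eventually_elim (use x kern_add L2_loc_wave[OF assms(1)] L2_loc_wave[OF assms(2)]
      wave_function_inside in blast)
  then have "(LINT y|rho S. kern S x y (u y + v y)) = (LINT y|rho S. kern S x y (u y) + kern S x y (v y))"
    using int by (intro integral_cong_AE) auto
  also have "\<dots> = (LINT y|rho S. kern S x y (u y)) + (LINT y|rho S. kern S x y (v y))"
    by (rule Bochner_Integration.integral_add[OF int(1,2)])
  finally show "Qdyn S (\<lambda>y. u y + v y) x = Qdyn S u x + Qdyn S v x"
    using x by (simp add: Qdyn_def scaleR_add_right)
qed

lemma Qdyn_scaleC_AE:
  assumes "u \<in> L2_loc S"
  shows "AE x in rho S. Qdyn S (\<lambda>y. c *\<^sub>C u y) x = c *\<^sub>C Qdyn S u x"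
  using kern_AE_integrable[OF assms] kern_AE_integrable[OF L2_loc_scaleC[OF assms, of c]] AE_spacetime
proof eventually_elim
  fix x assume int: "integrable (rho S) (\<lambda>y. kern S x y (u y))"
    "integrable (rho S) (\<lambda>y. kern S x y (c *\<^sub>C u y))" and x: "x \<in> spacetime S"
  have "AE y in rho S. kern S x y (c *\<^sub>C u y) = c *\<^sub>C kern S x y (u y)"
    using AE_spacetime
    by eventually_elim (use x kern_scaleC L2_loc_wave[OF assms] wave_function_inside in blast)
  then have "(LINT y|rho S. kern S x y (c *\<^sub>C u y)) = (LINT y|rho S. c *\<^sub>C kern S x y (u y))"
    using int integrable_bounded_linear[OF bounded_linear_scaleC int(1), of c]
    by (intro integral_cong_AE) auto
  also have "\<dots> = c *\<^sub>C (LINT y|rho S. kern S x y (u y))"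
    by (rule integral_bounded_linear[OF bounded_linear_scaleC int(1)])
  finally show "Qdyn S (\<lambda>y. c *\<^sub>C u y) x = c *\<^sub>C Qdyn S u x"
    using x by (simp add: Qdyn_def scaleC_add_right scaleR_scaleC scaleC_scaleC mult.commute)
qed

lemma Qdyn_AE_zero:
  assumes "AE x in rho S. u x = 0"
  shows "AE x in rho S. Qdyn S u x = 0"
  using assms AE_spacetime
proof eventually_elim
  fix x assume x: "u x = 0" "x \<in> spacetime S"
  have "AE y in rho S. kern S x y (u y) = 0"
    using assms AE_spacetime by eventually_elim (simp add: kern_zero x(2))
  then show "Qdyn S u x = 0" using x by (simp add: Qdyn_def integral_eq_zero_AE)
qed

text \<open>If Q phi is non-zero at x, then phi is non-zero at x itself or at some y with
  non-vanishing kernel. The active times of y lie in [a, b], those of x differ from them by at most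
  r, and \<open>eta_zero_if\<close> and \<open>eta_one_if\<close> turn this into values of
  \<open>eta\<close>.\<close>

lemma Qdyn_time_bounded:
  assumes tb: "time_bounded a b \<phi>" and wave: "wave_function S \<phi>"
  shows "\<exists>a' b'. time_bounded a' b' (Qdyn S \<phi>)"
proof -
  obtain r where r: "r > 0" "\<And>s t x y u. \<lbrakk>x \<in> spacetime S; y \<in> spacetime S; theta S s x \<noteq> 0;
      theta S t y \<noteq> 0; \<bar>t - s\<bar> > r; u \<in> spin_space y\<rbrakk> \<Longrightarrow> kern S x y u = 0"
    using finite_range_theta by blast
  have "x \<in> spacetime S \<and> eta S (a - r) x = 0 \<and> eta S (b + r) x = 1" if nz: "Qdyn S \<phi> x \<noteq> 0" for x
  proof -
    have x: "x \<in> spacetime S" using nz by (auto simp: Qdyn_def split: if_splits)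
    have "\<exists>y\<in>spacetime S. \<phi> y \<noteq> 0 \<and> (y = x \<or> kern S x y (\<phi> y) \<noteq> 0)"
    proof (rule ccontr)
      assume not: "\<not> ?thesis"
      have "AE y in rho S. kern S x y (\<phi> y) = 0"
        using AE_spacetime by eventually_elim (use kern_zero[OF x] not in force)
      moreover have "\<phi> x = 0" using not x by blast
      ultimately show False using nz x by (simp add: Qdyn_def integral_eq_zero_AE)
    qed
    then obtain y where y: "y \<in> spacetime S" "\<phi> y \<noteq> 0" "y = x \<or> kern S x y (\<phi> y) \<noteq> 0" by blast
    have ey: "eta S a y = 0" "eta S b y = 1" using tb y(2) by (auto simp: time_bounded_def)
    obtain t where t: "theta S t y \<noteq> 0" using theta_pos_exists[OF y(1)] by force
    have ab: "a \<le> t" "t \<le> b" using theta_nonzero_ge[OF y(1) ey(1) t] theta_nonzero_le[OF y(1) ey(2) t] .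
    have range: "a - r \<le> s \<and> s \<le> b + r" if s: "theta S s x \<noteq> 0" for s
      using y(3)
    proof
      assume "y = x"
      then have "a \<le> s" "s \<le> b" using theta_nonzero_ge[OF y(1) ey(1)] theta_nonzero_le[OF y(1) ey(2)] s by auto
      then show ?thesis using r(1) by simp
    next
      assume "kern S x y (\<phi> y) \<noteq> 0"
      then have "\<bar>t - s\<bar> \<le> r"
        using r(2)[OF x y(1) s t] wave_function_inside[OF wave y(1)] by (meson not_le)
      then show ?thesis using ab by (auto simp: abs_le_iff)
    qed
    have "eta S (a - r) x = 0" using range by (intro eta_zero_if[OF x]) force
    moreover have "eta S (b + r) x = 1" using range by (intro eta_one_if[OF x]) force
    ultimately show ?thesis using x by blast
  qed
  moreover have "a - r < b + r" using tb r(1) by (simp add: time_bounded_def)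
  ultimately show ?thesis unfolding time_bounded_def by blast
qed

lemma L2_pc_loc: "\<psi> \<in> L2_pc S \<Longrightarrow> \<psi> \<in> L2_loc S"
  by (simp add: L2_pc_def)

lemma L2_pc_add:
  assumes "\<psi> \<in> L2_pc S" "\<phi> \<in> L2_pc S"
  shows "(\<lambda>x. \<psi> x + \<phi> x) \<in> L2_pc S"
proof -
  obtain s t where st: "AE x in rho S. eta S s x *\<^sub>R \<psi> x = 0" "AE x in rho S. eta S t x *\<^sub>R \<phi> x = 0"
    using assms by (auto simp: L2_pc_def)
  have "AE x in rho S. eta S (min s t) x *\<^sub>R (\<psi> x + \<phi> x) = 0"
    using st AE_spacetime
  proof eventually_elim
    fix x assume *: "eta S s x *\<^sub>R \<psi> x = 0" "eta S t x *\<^sub>R \<phi> x = 0" and x: "x \<in> spacetime S"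
    have "eta S (min s t) x \<le> eta S s x" "eta S (min s t) x \<le> eta S t x" "0 \<le> eta S (min s t) x"
      using eta_mono[OF x] eta_bounds[OF x] by auto
    then show "eta S (min s t) x *\<^sub>R (\<psi> x + \<phi> x) = 0" using * by auto
  qed
  then show ?thesis using assms by (auto simp: L2_pc_def L2_loc_add)
qed

lemma L2_pc_scaleC:
  assumes "\<psi> \<in> L2_pc S"
  shows "(\<lambda>x. c *\<^sub>C \<psi> x) \<in> L2_pc S"
proof -
  obtain s where "AE x in rho S. eta S s x *\<^sub>R \<psi> x = 0" using assms by (auto simp: L2_pc_def)
  then have "AE x in rho S. eta S s x *\<^sub>R (c *\<^sub>C \<psi> x) = 0" by eventually_elim auto
  then show ?thesis using assms by (auto simp: L2_pc_def L2_loc_scaleC)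
qed

lemma L2_pc_AE_zero: "\<psi> \<in> L2_loc S \<Longrightarrow> AE x in rho S. \<psi> x = 0 \<Longrightarrow> \<psi> \<in> L2_pc S"
  unfolding L2_pc_def by (auto elim!: eventually_mono)

text \<open>The argument of \<open>Qdyn_time_bounded\<close> with one end point only and modulo null
  sets; the initial time moves into the past by the range r.\<close>

lemma L2_pc_Qdyn:
  assumes "u \<in> L2_pc S"
  shows "Qdyn S u \<in> L2_pc S"
proof -
  obtain t where t: "AE x in rho S. eta S t x *\<^sub>R u x = 0" using assms by (auto simp: L2_pc_def)
  obtain r where r: "r > 0" "\<And>s t x y u. \<lbrakk>x \<in> spacetime S; y \<in> spacetime S; theta S s x \<noteq> 0;
      theta S t y \<noteq> 0; \<bar>t - s\<bar> > r; u \<in> spin_space y\<rbrakk> \<Longrightarrow> kern S x y u = 0"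
    using finite_range_theta by blast
  have wave: "wave_function S u" using assms by (simp add: L2_pc_loc L2_loc_wave)
  have "AE x in rho S. eta S (t - r) x *\<^sub>R Qdyn S u x = 0"
    using t AE_spacetime
  proof eventually_elim
    fix x assume ux: "eta S t x *\<^sub>R u x = 0" and x: "x \<in> spacetime S"
    show "eta S (t - r) x *\<^sub>R Qdyn S u x = 0"
    proof (cases "eta S (t - r) x = 0")
      case False
      \<comment> \<open>Some active time of x precedes t - r, while almost all points y with u y
        non-zero have only active times from t on; the distance exceeds r.\<close>
      then obtain s where s: "s < t - r" "theta S s x \<noteq> 0" using eta_zero_if[OF x] by blast
      have "eta S (t - r) x \<le> eta S t x" using r(1) by (intro eta_mono[OF x]) simp
      then have "eta S t x \<noteq> 0" using False eta_bounds[OF x, of "t - r"] by auto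
      then have u0: "u x = 0" using ux by simp
      have "AE y in rho S. kern S x y (u y) = 0"
        using t AE_spacetime
      proof eventually_elim
        fix y assume uy: "eta S t y *\<^sub>R u y = 0" and y: "y \<in> spacetime S"
        show "kern S x y (u y) = 0"
        proof (cases "u y = 0")
          case False
          then have ey: "eta S t y = 0" using uy by simp
          obtain t' where t': "theta S t' y \<noteq> 0" using theta_pos_exists[OF y] by force
          have "t \<le> t'" by (rule theta_nonzero_ge[OF y ey t'])
          then show ?thesis
            using s by (intro r(2)[OF x y s(2) t'] wave_function_inside[OF wave y]) simp
        qed (simp add: kern_zero x y)
      qed
      then show ?thesis using u0 x by (simp add: Qdyn_def integral_eq_zero_AE)
    qed simp
  qed
  then show ?thesis using Qdyn_L2_loc[OF L2_pc_loc[OF assms]] by (auto simp: L2_pc_def)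
qed

text \<open>Fubini's theorem and the symmetry of the kernel; the diagonal terms agree because
  \<open>diagc\<close> is real. Compact support of phi puts it into \<open>L2_tc\<close>, where the
  double integral is known to exist.\<close>

lemma krein_Qdyn_symmetric:
  assumes phi: "\<phi> \<in> Cvary0 S" and u: "u \<in> L2_loc S"
  shows "krein_inner S (Qdyn S \<phi>) u = krein_inner S \<phi> (Qdyn S u)"
proof -
  interpret sigma_finite_measure "rho S" by (rule sigma_finite_rho)
  interpret pair_sigma_finite "rho S" "rho S" ..
  obtain a b where tb: "time_bounded a b \<phi>" using Cvary0_time_bounded[OF phi] .
  have phiL: "\<phi> \<in> L2_loc S" by (rule Cvary0_L2_loc[OF phi])
  have pw: "wave_function S \<phi>" and uw: "wave_function S u" using phiL u L2_loc_wave by auto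
  obtain a' b' where tb': "time_bounded a' b' (Qdyn S \<phi>)" using Qdyn_time_bounded[OF tb pw] by blast
  define F where "F x y = spin_inner x (\<phi> x) (kern S x y (u y))" for x y
  define D where "D x = spin_inner x (\<phi> x) (u x)" for x
  have F: "integrable (rho S \<Otimes>\<^sub>M rho S) (case_prod F)"
    using double_integral[OF time_bounded_L2_tc[OF tb phiL] u] unfolding F_def[abs_def] by simp
  have D: "integrable (rho S) D"
    unfolding D_def by (rule krein_integrable[OF tb phiL u])
  have F1: "integrable (rho S) (\<lambda>x. LINT y|rho S. F x y)"
    by (rule integrable_fst[OF F])
  have F2: "integrable (rho S) (\<lambda>x. LINT y|rho S. F y x)"
    by (rule integrable_snd[OF F])
  have AE1: "AE x in rho S. spin_inner x (\<phi> x) (Qdyn S u x) = (LINT y|rho S. F x y) + of_real (diagc S) * D x"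
    using kern_AE_integrable[OF u] AE_spacetime
  proof eventually_elim
    fix x assume int: "integrable (rho S) (\<lambda>y. kern S x y (u y))" and x: "x \<in> spacetime S"
    show "spin_inner x (\<phi> x) (Qdyn S u x) = (LINT y|rho S. F x y) + of_real (diagc S) * D x"
      using integral_bounded_linear[OF bounded_linear_spin_inner_right[of x "\<phi> x"] int] x
      by (simp add: Qdyn_def F_def D_def spin_inner_add spin_inner_scaleR)
  qed
  have AE2: "AE x in rho S. spin_inner x (Qdyn S \<phi> x) (u x) = (LINT y|rho S. F y x) + of_real (diagc S) * D x"
    \<comment> \<open>Integrability of y \<mapsto> \<open>F y x\<close> is supplied by Fubini; the
      kernels at (x, y) and (y, x) are exchanged only for almost every y.\<close>
    using kern_AE_integrable[OF phiL] AE_integrable_snd[OF F] AE_spacetime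
  proof eventually_elim
    fix x assume int: "integrable (rho S) (\<lambda>y. kern S x y (\<phi> y))"
      and Fx: "integrable (rho S) (\<lambda>y. F y x)" and x: "x \<in> spacetime S"
    note int' = integrable_bounded_linear[OF bounded_linear_spin_inner_left[of x "u x"] int]
    have "AE y in rho S. spin_inner x (kern S x y (\<phi> y)) (u x) = F y x"
      using AE_spacetime
    proof eventually_elim
      fix y assume y: "y \<in> spacetime S"
      show "spin_inner x (kern S x y (\<phi> y)) (u x) = F y x"
        unfolding F_def
        by (rule kern_adjoint[OF y x wave_function_inside[OF pw y] wave_function_inside[OF uw x], symmetric])
    qed
    then have "(LINT y|rho S. spin_inner x (kern S x y (\<phi> y)) (u x)) = (LINT y|rho S. F y x)"
      using int' Fx by (intro integral_cong_AE) auto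
    then show "spin_inner x (Qdyn S \<phi> x) (u x) = (LINT y|rho S. F y x) + of_real (diagc S) * D x"
      using integral_bounded_linear[OF bounded_linear_spin_inner_left[of x "u x"] int] x
      by (simp add: Qdyn_def D_def spin_inner_add spin_inner_scaleR)
  qed
  have "krein_inner S \<phi> (Qdyn S u) = (LINT x|rho S. (LINT y|rho S. F x y) + of_real (diagc S) * D x)"
    unfolding krein_inner_def using AE1 krein_integrable[OF tb phiL Qdyn_L2_loc[OF u]] F1 D
    by (intro integral_cong_AE) auto
  also have "\<dots> = (LINT x|rho S. LINT y|rho S. F x y) + of_real (diagc S) * (LINT x|rho S. D x)"
    using F1 D by simp
  also have "(LINT x|rho S. LINT y|rho S. F x y) = (LINT x|rho S. LINT y|rho S. F y x)"
    by (rule Fubini_integral[OF F, symmetric])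
  also have "(LINT x|rho S. LINT y|rho S. F y x) + of_real (diagc S) * (LINT x|rho S. D x)
      = (LINT x|rho S. (LINT y|rho S. F y x) + of_real (diagc S) * D x)"
    using F2 D by simp
  also have "\<dots> = krein_inner S (Qdyn S \<phi>) u"
    unfolding krein_inner_def using AE2 krein_integrable[OF tb' Qdyn_L2_loc[OF phiL] u] F2 D
    by (intro integral_cong_AE) auto
  finally show ?thesis ..
qed

lemma krein_add_right:
  assumes phi: "\<phi> \<in> Cvary0 S" and "u \<in> L2_loc S" "v \<in> L2_loc S"
  shows "krein_inner S \<phi> (\<lambda>x. u x + v x) = krein_inner S \<phi> u + krein_inner S \<phi> v"
proof -
  obtain a b where tb: "time_bounded a b \<phi>" using Cvary0_time_bounded[OF phi] .
  note int = krein_integrable[OF tb Cvary0_L2_loc[OF phi]]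
  show ?thesis
    using int[OF assms(2)] int[OF assms(3)] by (simp add: krein_inner_def spin_inner_add)
qed

lemma krein_scaleC_right:
  assumes "wave_function S u"
  shows "krein_inner S \<phi> (\<lambda>x. c *\<^sub>C u x) = c * krein_inner S \<phi> u"
proof -
  have "spin_inner x (\<phi> x) (c *\<^sub>C u x) = c * spin_inner x (\<phi> x) (u x)" for x
    by (cases "x \<in> spacetime S") (simp_all add: spin_inner_scaleC wave_function_outside[OF assms])
  then show ?thesis by (simp add: krein_inner_def)
qed

lemma Cvary0_perp_loc: "w \<in> Cvary0_perp S \<Longrightarrow> w \<in> L2_loc S"
  by (simp add: Cvary0_perp_def)

lemma Cvary0_perp_add:
  "u \<in> Cvary0_perp S \<Longrightarrow> v \<in> Cvary0_perp S \<Longrightarrow> (\<lambda>x. u x + v x) \<in> Cvary0_perp S"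
  by (simp add: Cvary0_perp_def L2_loc_add krein_add_right)

lemma Cvary0_perp_scaleC: "u \<in> Cvary0_perp S \<Longrightarrow> (\<lambda>x. c *\<^sub>C u x) \<in> Cvary0_perp S"
  by (simp add: Cvary0_perp_def L2_loc_scaleC krein_scaleC_right L2_loc_wave)

lemma Cvary0_perp_AE_zero:
  assumes "u \<in> L2_loc S" "AE x in rho S. u x = 0"
  shows "u \<in> Cvary0_perp S"
proof -
  have "krein_inner S \<phi> u = 0" for \<phi>
    unfolding krein_inner_def
    by (rule integral_eq_zero_AE) (use assms(2) in eventually_elim, simp)
  then show ?thesis using assms(1) by (simp add: Cvary0_perp_def)
qed


section \<open>Convergence in time strips\<close>

lemma L2_tendsto_D:
  assumes "t0 \<le> t1" "L2_tendsto S t0 t1 f g N"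
  shows "\<forall>\<^sub>F i in N. f i \<in> L2_strip S t0 t1" "g \<in> L2_strip S t0 t1"
    "((\<lambda>i. L2_sq t0 t1 (\<lambda>x. f i x - g x)) \<longlongrightarrow> 0) N"
proof -
  show ev: "\<forall>\<^sub>F i in N. f i \<in> L2_strip S t0 t1" and g: "g \<in> L2_strip S t0 t1"
    using assms(2) by (auto simp: L2_tendsto_def)
  have "((\<lambda>i. (L2_norm S t0 t1 (\<lambda>x. f i x - g x))\<^sup>2) \<longlongrightarrow> 0\<^sup>2) N"
    using assms(2) by (intro tendsto_power) (simp add: L2_tendsto_def)
  moreover have "\<forall>\<^sub>F i in N. (L2_norm S t0 t1 (\<lambda>x. f i x - g x))\<^sup>2 = L2_sq t0 t1 (\<lambda>x. f i x - g x)"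
    using ev
  proof eventually_elim
    fix i assume "f i \<in> L2_strip S t0 t1"
    then have "wave_function S (\<lambda>x. f i x - g x)"
      using g by (intro wave_function_diff L2_strip_wave)
    then show "(L2_norm S t0 t1 (\<lambda>x. f i x - g x))\<^sup>2 = L2_sq t0 t1 (\<lambda>x. f i x - g x)"
      using L2_sq_nonneg[OF assms(1)] by (simp add: L2_norm_eq)
  qed
  ultimately show "((\<lambda>i. L2_sq t0 t1 (\<lambda>x. f i x - g x)) \<longlongrightarrow> 0) N"
    by (simp add: filterlim_cong[OF refl refl])
qed

lemma L2_tendsto_I:
  assumes ev: "\<forall>\<^sub>F i in N. f i \<in> L2_strip S t0 t1" and g: "g \<in> L2_strip S t0 t1"
    and lim: "((\<lambda>i. L2_sq t0 t1 (\<lambda>x. f i x - g x)) \<longlongrightarrow> 0) N"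
  shows "L2_tendsto S t0 t1 f g N"
proof -
  have "((\<lambda>i. sqrt (L2_sq t0 t1 (\<lambda>x. f i x - g x))) \<longlongrightarrow> 0) N"
    using tendsto_real_sqrt[OF lim] by simp
  moreover have "\<forall>\<^sub>F i in N. L2_norm S t0 t1 (\<lambda>x. f i x - g x) = sqrt (L2_sq t0 t1 (\<lambda>x. f i x - g x))"
    using ev
  proof eventually_elim
    fix i assume "f i \<in> L2_strip S t0 t1"
    then have "wave_function S (\<lambda>x. f i x - g x)"
      using g by (intro wave_function_diff L2_strip_wave)
    then show "L2_norm S t0 t1 (\<lambda>x. f i x - g x) = sqrt (L2_sq t0 t1 (\<lambda>x. f i x - g x))"
      by (rule L2_norm_eq)
  qed
  ultimately have "((\<lambda>i. L2_norm S t0 t1 (\<lambda>x. f i x - g x)) \<longlongrightarrow> 0) N"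
    by (simp add: filterlim_cong[OF refl refl])
  then show ?thesis using ev g by (simp add: L2_tendsto_def)
qed

lemma L2_tendsto_const: "g \<in> L2_strip S t0 t1 \<Longrightarrow> L2_tendsto S t0 t1 (\<lambda>i. g) g N"
  by (rule L2_tendsto_I) (simp_all add: L2_sq_def blinfun.zero_right)

lemma L2_tendsto_add:
  assumes le: "t0 \<le> t1" and f: "L2_tendsto S t0 t1 f g N" and f': "L2_tendsto S t0 t1 f' g' N"
  shows "L2_tendsto S t0 t1 (\<lambda>i x. f i x + f' i x) (\<lambda>x. g x + g' x) N"
proof (rule L2_tendsto_I)
  note F = L2_tendsto_D[OF le f] and F' = L2_tendsto_D[OF le f']
  show "\<forall>\<^sub>F i in N. (\<lambda>x. f i x + f' i x) \<in> L2_strip S t0 t1"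
    using F(1) F'(1) by eventually_elim (rule L2_strip_add(1)[OF le])
  show "(\<lambda>x. g x + g' x) \<in> L2_strip S t0 t1"
    by (rule L2_strip_add(1)[OF le F(2) F'(2)])
  have lim: "((\<lambda>i. 2 * L2_sq t0 t1 (\<lambda>x. f i x - g x) + 2 * L2_sq t0 t1 (\<lambda>x. f' i x - g' x)) \<longlongrightarrow> 2 * 0 + 2 * 0) N"
    using F(3) F'(3) by (intro tendsto_intros)
  have le': "\<forall>\<^sub>F i in N. L2_sq t0 t1 (\<lambda>x. f i x + f' i x - (g x + g' x))
      \<le> 2 * L2_sq t0 t1 (\<lambda>x. f i x - g x) + 2 * L2_sq t0 t1 (\<lambda>x. f' i x - g' x)"
    using F(1) F'(1)
  proof eventually_elim
    fix i assume "f i \<in> L2_strip S t0 t1" "f' i \<in> L2_strip S t0 t1"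
    then show "L2_sq t0 t1 (\<lambda>x. f i x + f' i x - (g x + g' x))
        \<le> 2 * L2_sq t0 t1 (\<lambda>x. f i x - g x) + 2 * L2_sq t0 t1 (\<lambda>x. f' i x - g' x)"
      using L2_strip_add(2)[OF le L2_strip_diff[OF le _ F(2)] L2_strip_diff[OF le _ F'(2)], of "f i" "f' i"]
      by (simp add: algebra_simps)
  qed
  show "((\<lambda>i. L2_sq t0 t1 (\<lambda>x. f i x + f' i x - (g x + g' x))) \<longlongrightarrow> 0) N"
  proof (rule tendsto_sandwich[OF _ le' tendsto_const])
    show "\<forall>\<^sub>F i in N. 0 \<le> L2_sq t0 t1 (\<lambda>x. f i x + f' i x - (g x + g' x))"
      by (simp add: L2_sq_nonneg[OF le])
  qed (use lim in simp)
qed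

lemma L2_tendsto_scaleC:
  assumes le: "t0 \<le> t1" and f: "L2_tendsto S t0 t1 f g N"
  shows "L2_tendsto S t0 t1 (\<lambda>i x. c *\<^sub>C f i x) (\<lambda>x. c *\<^sub>C g x) N"
proof (rule L2_tendsto_I)
  note F = L2_tendsto_D[OF le f]
  show "\<forall>\<^sub>F i in N. (\<lambda>x. c *\<^sub>C f i x) \<in> L2_strip S t0 t1"
    using F(1) by eventually_elim (rule L2_strip_scaleC(1))
  show "(\<lambda>x. c *\<^sub>C g x) \<in> L2_strip S t0 t1"
    by (rule L2_strip_scaleC(1)[OF F(2)])
  have "((\<lambda>i. (cmod c)\<^sup>2 * L2_sq t0 t1 (\<lambda>x. f i x - g x)) \<longlongrightarrow> (cmod c)\<^sup>2 * 0) N"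
    using F(3) by (intro tendsto_intros)
  moreover have "\<forall>\<^sub>F i in N. (cmod c)\<^sup>2 * L2_sq t0 t1 (\<lambda>x. f i x - g x) = L2_sq t0 t1 (\<lambda>x. c *\<^sub>C f i x - c *\<^sub>C g x)"
    using F(1)
  proof eventually_elim
    fix i assume "f i \<in> L2_strip S t0 t1"
    then show "(cmod c)\<^sup>2 * L2_sq t0 t1 (\<lambda>x. f i x - g x) = L2_sq t0 t1 (\<lambda>x. c *\<^sub>C f i x - c *\<^sub>C g x)"
      using L2_strip_scaleC(2)[OF L2_strip_diff[OF le _ F(2)], of "f i" c]
      by (simp add: scaleC_diff_right)
  qed
  ultimately show "((\<lambda>i. L2_sq t0 t1 (\<lambda>x. c *\<^sub>C f i x - c *\<^sub>C g x)) \<longlongrightarrow> 0) N"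
    by (simp add: filterlim_cong[OF refl refl])
qed

lemma L2_sq_cong_AE:
  assumes "(\<lambda>x. op_half x (\<psi> x)) \<in> borel_measurable (rho S)" "(\<lambda>x. op_half x (\<phi> x)) \<in> borel_measurable (rho S)"
    "AE x in rho S. \<psi> x = \<phi> x"
  shows "L2_sq t0 t1 \<psi> = L2_sq t0 t1 \<phi>"
proof -
  note [measurable] = assms(1,2)
  show ?thesis
    unfolding L2_sq_def
    by (rule integral_cong_AE) (measurable, use assms(3) in \<open>eventually_elim, simp\<close>)
qed

text \<open>Called for because \<open>Qdyn\<close> is linear only almost everywhere: inside a limit,
  images of sums of test functions have to be exchanged for sums of images.\<close>

lemma L2_tendsto_cong_AE:
  assumes le: "t0 \<le> t1" and f: "L2_tendsto S t0 t1 f g N" and f': "\<And>i. f' i \<in> L2_strip S t0 t1"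
    and eq: "\<And>i. AE x in rho S. f i x = f' i x"
  shows "L2_tendsto S t0 t1 f' g N"
proof (rule L2_tendsto_I)
  note F = L2_tendsto_D[OF le f]
  show "\<forall>\<^sub>F i in N. f' i \<in> L2_strip S t0 t1" "g \<in> L2_strip S t0 t1" using f' F(2) by simp_all
  have "\<forall>\<^sub>F i in N. L2_sq t0 t1 (\<lambda>x. f i x - g x) = L2_sq t0 t1 (\<lambda>x. f' i x - g x)"
    using F(1)
  proof eventually_elim
    fix i assume fi: "f i \<in> L2_strip S t0 t1"
    have "AE x in rho S. f i x - g x = f' i x - g x" using eq[of i] by eventually_elim simp
    then show "L2_sq t0 t1 (\<lambda>x. f i x - g x) = L2_sq t0 t1 (\<lambda>x. f' i x - g x)"
      by (intro L2_sq_cong_AE L2_strip_measurable[OF L2_strip_diff[OF le _ F(2)]] fi f')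
  qed
  with F(3) show "((\<lambda>i. L2_sq t0 t1 (\<lambda>x. f' i x - g x)) \<longlongrightarrow> 0) N"
    by (simp add: filterlim_cong[OF refl refl])
qed

lemma L2_krein_add_left:
  assumes "t0 \<le> t1" "u \<in> L2_strip S t0 t1" "v \<in> L2_strip S t0 t1" "w \<in> L2_strip S t0 t1"
  shows "L2_krein t0 t1 (\<lambda>x. u x + v x) w = L2_krein t0 t1 u w + L2_krein t0 t1 v w"
  using L2_krein_Cauchy_Schwarz(1)[OF assms(1,2,4)] L2_krein_Cauchy_Schwarz(1)[OF assms(1,3,4)]
  by (simp add: L2_krein_def spin_inner_add distrib_left)

lemma L2_krein_scaleC_left: "L2_krein t0 t1 (\<lambda>x. c *\<^sub>C u x) w = cnj c * L2_krein t0 t1 u w"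
proof -
  have *: "of_real (strip_weight t0 t1 x) * spin_inner x (c *\<^sub>C u x) (w x)
      = cnj c * (of_real (strip_weight t0 t1 x) * spin_inner x (u x) (w x))" for x
    by (simp add: spin_inner_def cinner_scaleC_left)
  show ?thesis unfolding L2_krein_def * by simp
qed

lemma L2_krein_diff_left:
  assumes "t0 \<le> t1" "u \<in> L2_strip S t0 t1" "v \<in> L2_strip S t0 t1" "w \<in> L2_strip S t0 t1"
  shows "L2_krein t0 t1 (\<lambda>x. u x - v x) w = L2_krein t0 t1 u w - L2_krein t0 t1 v w"
  using L2_krein_add_left[OF assms(1,2) L2_strip_minus[OF assms(3)] assms(4)]
    L2_krein_scaleC_left[of t0 t1 "-1" v w] by simp

lemma L2_inner_add_left:
  assumes "t0 \<le> t1" "u \<in> L2_strip S t0 t1" "v \<in> L2_strip S t0 t1" "w \<in> L2_strip S t0 t1"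
  shows "L2_inner S t0 t1 (\<lambda>x. u x + v x) w = L2_inner S t0 t1 u w + L2_inner S t0 t1 v w"
  using L2_inner_Cauchy_Schwarz(1)[OF assms(1,2,4)] L2_inner_Cauchy_Schwarz(1)[OF assms(1,3,4)]
    assms(2,3)[THEN L2_strip_wave]
  by (simp add: L2_inner_eq wave_function_add blinfun.add_right cinner_add_left distrib_left)

lemma L2_inner_scaleC_left:
  assumes "wave_function S u"
  shows "L2_inner S t0 t1 (\<lambda>x. c *\<^sub>C u x) w = cnj c * L2_inner S t0 t1 u w"
proof -
  have *: "of_real (strip_weight t0 t1 x) * cinner (op_half x (c *\<^sub>C u x)) (op_half x (w x))
      = cnj c * (of_real (strip_weight t0 t1 x) * cinner (op_half x (u x)) (op_half x (w x)))" for x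
    by (simp add: op_half_scaleC_wave[OF assms] cinner_scaleC_left)
  show ?thesis unfolding L2_inner_eq[OF assms] L2_inner_eq[OF wave_function_scaleC[OF assms]] * by simp
qed

lemma L2_tendsto_krein_left:
  assumes le: "t0 \<le> t1" and f: "L2_tendsto S t0 t1 f g N" and h: "h \<in> L2_strip S t0 t1"
  shows "((\<lambda>i. L2_krein t0 t1 (f i) h) \<longlongrightarrow> L2_krein t0 t1 g h) N"
proof -
  note F = L2_tendsto_D[OF le f]
  have "((\<lambda>i. sqrt (L2_sq t0 t1 (\<lambda>x. f i x - g x)) * sqrt (L2_sq t0 t1 h)) \<longlongrightarrow> sqrt 0 * sqrt (L2_sq t0 t1 h)) N"
    using F(3) by (intro tendsto_intros)
  then have lim: "((\<lambda>i. sqrt (L2_sq t0 t1 (\<lambda>x. f i x - g x)) * sqrt (L2_sq t0 t1 h)) \<longlongrightarrow> 0) N" by simp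
  have "\<forall>\<^sub>F i in N. norm (L2_krein t0 t1 (f i) h - L2_krein t0 t1 g h)
      \<le> sqrt (L2_sq t0 t1 (\<lambda>x. f i x - g x)) * sqrt (L2_sq t0 t1 h)"
    using F(1)
  proof eventually_elim
    fix i assume fi: "f i \<in> L2_strip S t0 t1"
    show "norm (L2_krein t0 t1 (f i) h - L2_krein t0 t1 g h)
      \<le> sqrt (L2_sq t0 t1 (\<lambda>x. f i x - g x)) * sqrt (L2_sq t0 t1 h)"
      using L2_krein_Cauchy_Schwarz(2)[OF le L2_strip_diff[OF le fi F(2)] h]
      by (simp add: L2_krein_diff_left[OF le fi F(2) h])
  qed
  then have "((\<lambda>i. L2_krein t0 t1 (f i) h - L2_krein t0 t1 g h) \<longlongrightarrow> 0) N"
    by (rule Lim_null_comparison[OF _ lim])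
  then show ?thesis by (simp add: LIM_zero_iff)
qed

lemma L2_tendsto_krein_right:
  assumes "t0 \<le> t1" "L2_tendsto S t0 t1 f g N" "h \<in> L2_strip S t0 t1"
  shows "((\<lambda>i. L2_krein t0 t1 h (f i)) \<longlongrightarrow> L2_krein t0 t1 h g) N"
  using tendsto_cnj[OF L2_tendsto_krein_left[OF assms]] by (simp flip: L2_krein_commute)

lemma L2_tendsto_sq_zero:
  assumes le: "t0 \<le> t1" and f: "L2_tendsto S t0 t1 f g N" and N: "N \<noteq> bot"
    and zero: "\<forall>\<^sub>F i in N. L2_sq t0 t1 (f i) = 0"
  shows "L2_sq t0 t1 g = 0"
proof -
  note F = L2_tendsto_D[OF le f]
  have "((\<lambda>i. 2 * L2_sq t0 t1 (\<lambda>x. f i x - g x)) \<longlongrightarrow> 2 * 0) N"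
    using F(3) by (intro tendsto_intros)
  moreover have "\<forall>\<^sub>F i in N. L2_sq t0 t1 g \<le> 2 * L2_sq t0 t1 (\<lambda>x. f i x - g x)"
    using F(1) zero
  proof eventually_elim
    fix i assume fi: "f i \<in> L2_strip S t0 t1" and z: "L2_sq t0 t1 (f i) = 0"
    \<comment> \<open>Writing g as -(f - g) + f makes the quadratic bound yield twice the squared
      distance, as the second term is zero.\<close>
    have "L2_sq t0 t1 (\<lambda>x. (-1) *\<^sub>C (f i x - g x) + f i x) \<le>
        2 * L2_sq t0 t1 (\<lambda>x. (-1) *\<^sub>C (f i x - g x)) + 2 * L2_sq t0 t1 (f i)"
      by (intro L2_strip_add(2)[OF le] L2_strip_scaleC(1) L2_strip_diff le fi F(2))
    then show "L2_sq t0 t1 g \<le> 2 * L2_sq t0 t1 (\<lambda>x. f i x - g x)"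
      using L2_strip_scaleC(2)[OF L2_strip_diff[OF le fi F(2)], of "-1"] z by simp
  qed
  ultimately have "L2_sq t0 t1 g \<le> 2 * 0"
    by (rule tendsto_lowerbound[OF _ _ N])
  then show ?thesis using L2_sq_nonneg[OF le, of g] by simp
qed

lemma Cvary0_zero: "(\<lambda>x. 0) \<in> Cvary0 S"
  by (auto simp: Cvary0_def Cvary_zero intro!: exI[of _ "{}"])

lemma Cvary0_add:
  assumes "\<psi> \<in> Cvary0 S" "\<phi> \<in> Cvary0 S"
  shows "(\<lambda>x. \<psi> x + \<phi> x) \<in> Cvary0 S"
proof -
  obtain K where K: "compact K" "K \<subseteq> spacetime S" "\<forall>x. x \<notin> K \<longrightarrow> \<psi> x = 0"
    using assms(1) by (auto simp: Cvary0_def)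
  obtain L where L: "compact L" "L \<subseteq> spacetime S" "\<forall>x. x \<notin> L \<longrightarrow> \<phi> x = 0"
    using assms(2) by (auto simp: Cvary0_def)
  show ?thesis
    using assms K L by (auto simp: Cvary0_def Cvary_add intro!: exI[of _ "K \<union> L"] compact_Un)
qed

lemma Cvary0_scaleC: "\<psi> \<in> Cvary0 S \<Longrightarrow> (\<lambda>x. c *\<^sub>C \<psi> x) \<in> Cvary0 S"
  by (force simp: Cvary0_def Cvary_scaleC)

section \<open>Green's operators\<close>

text \<open>The condition on the surface layer norms of the test functions is automatically satisfied,
  because the layer weight vanishes at pairs of points where \<open>\<eta>\<^sub>t\<^sub>' = 1\<close>.\<close>

lemma test_ret_eq: "test_ret S t = {\<psi> \<in> Cvary0 S. \<forall>x. (1 - eta S t x) *\<^sub>R \<psi> x = 0}"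
proof -
  have "surface_layer_norm S t' \<psi> = 0"
    if psi: "\<psi> \<in> Cvary0 S" "\<forall>x. (1 - eta S t x) *\<^sub>R \<psi> x = 0" and t': "t \<le> t'" for \<psi> t'
  proof -
    have wave: "wave_function S \<psi>" using psi(1) by (simp add: Cvary0_Cvary Cvary_wave)
    have one: "eta S t' x = 1" if "\<psi> x \<noteq> 0" for x
    proof -
      have x: "x \<in> spacetime S" using that wave_function_outside[OF wave] by blast
      have "eta S t x = 1" using psi(2) that by (metis diff_eq_diff_eq diff_self eq_iff_diff_eq_0 scaleR_eq_0_iff)
      then show ?thesis using eta_mono[OF x t'] eta_bounds[OF x, of t'] by simp
    qed
    have "(LINT y|rho S. of_real (layer_weight S t' x y) * spin_inner x (\<psi> x) (kern S x y (\<psi> y))) = 0" for x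
    proof (rule integral_eq_zero_AE)
      show "AE y in rho S. of_real (layer_weight S t' x y) * spin_inner x (\<psi> x) (kern S x y (\<psi> y)) = 0"
        using AE_spacetime
      proof eventually_elim
        fix y assume y: "y \<in> spacetime S"
        show "of_real (layer_weight S t' x y) * spin_inner x (\<psi> x) (kern S x y (\<psi> y)) = 0"
        proof (cases "\<psi> x = 0 \<or> \<psi> y = 0")
          case True
          then show ?thesis
            using kern_zero[OF _ y, of x] wave_function_outside[OF wave, of x] by (cases "x \<in> spacetime S") auto
        next
          case False
          then show ?thesis by (simp add: layer_weight_def one)
        qed
      qed
    qed
    then show ?thesis by (simp add: surface_layer_norm_def surface_layer_form_def)
  qed
  then show ?thesis unfolding test_ret_def by blast
qed

text \<open>Evident only after \<open>test_ret_eq\<close>: the vanishing of the surface layer norm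
  is by itself a quadratic condition.\<close>

lemma test_ret_subspace: "wave_subspace (test_ret S t)"
  unfolding wave_subspace_def test_ret_eq
  by (auto simp: Cvary0_zero Cvary0_add Cvary0_scaleC) (metis add.right_neutral)

lemma test_ret_Cvary0: "\<phi> \<in> test_ret S t \<Longrightarrow> \<phi> \<in> Cvary0 S"
  by (simp add: test_ret_eq)

lemma strip_space_D:
  assumes "(V, g) \<in> strip_space S T t0 t1"
  shows "V \<in> L2_strip S t0 t1" "g \<in> L2_strip S t0 t1"
  using assms by (auto simp: strip_space_def L2_tendsto_def)

lemma strip_space_add:
  assumes le: "t0 < t1" and T: "wave_subspace T" "T \<subseteq> L2_loc S"
    and Vg: "(V, g) \<in> strip_space S T t0 t1" and Vg': "(V', g') \<in> strip_space S T t0 t1"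
  shows "(\<lambda>x. V x + V' x, \<lambda>x. g x + g' x) \<in> strip_space S T t0 t1"
proof -
  obtain \<phi> where phi: "\<And>k::nat. \<phi> k \<in> T" "L2_tendsto S t0 t1 \<phi> V sequentially"
    "L2_tendsto S t0 t1 (\<lambda>k. Qdyn S (\<phi> k)) g sequentially"
    using Vg by (auto simp: strip_space_def)
  obtain \<phi>' where phi': "\<And>k::nat. \<phi>' k \<in> T" "L2_tendsto S t0 t1 \<phi>' V' sequentially"
    "L2_tendsto S t0 t1 (\<lambda>k. Qdyn S (\<phi>' k)) g' sequentially"
    using Vg' by (auto simp: strip_space_def)
  have L: "\<phi> k \<in> L2_loc S" "\<phi>' k \<in> L2_loc S" for k using phi(1) phi'(1) T(2) by auto
  have "L2_tendsto S t0 t1 (\<lambda>k. Qdyn S (\<lambda>x. \<phi> k x + \<phi>' k x)) (\<lambda>x. g x + g' x) sequentially"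
  proof (rule L2_tendsto_cong_AE[OF less_imp_le[OF le] L2_tendsto_add[OF less_imp_le[OF le] phi(3) phi'(3)]])
    show "Qdyn S (\<lambda>x. \<phi> k x + \<phi>' k x) \<in> L2_strip S t0 t1" for k
      by (intro L2_loc_strip[OF _ le] Qdyn_L2_loc L2_loc_add L)
    show "AE x in rho S. Qdyn S (\<phi> k) x + Qdyn S (\<phi>' k) x = Qdyn S (\<lambda>x. \<phi> k x + \<phi>' k x) x" for k
      using Qdyn_add_AE[OF L(1)[of k] L(2)[of k]] by eventually_elim simp
  qed
  moreover have "(\<lambda>x. \<phi> k x + \<phi>' k x) \<in> T" for k
    using T(1) phi(1) phi'(1) by (simp add: wave_subspace_def)
  moreover have "\<forall>x. eta S t1 x - eta S t0 x = 0 \<longrightarrow> V x + V' x = 0 \<and> g x + g' x = 0"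
    using Vg Vg' by (simp add: strip_space_def)
  ultimately show ?thesis
    using L2_tendsto_add[OF less_imp_le[OF le] phi(2) phi'(2)] unfolding strip_space_def
    by (intro CollectI case_prodI conjI exI[of _ "\<lambda>k x. \<phi> k x + \<phi>' k x"]) auto
qed

lemma strip_space_scaleC:
  assumes le: "t0 < t1" and T: "wave_subspace T" "T \<subseteq> L2_loc S"
    and Vg: "(V, g) \<in> strip_space S T t0 t1"
  shows "(\<lambda>x. c *\<^sub>C V x, \<lambda>x. c *\<^sub>C g x) \<in> strip_space S T t0 t1"
proof -
  obtain \<phi> where phi: "\<And>k::nat. \<phi> k \<in> T" "L2_tendsto S t0 t1 \<phi> V sequentially"
    "L2_tendsto S t0 t1 (\<lambda>k. Qdyn S (\<phi> k)) g sequentially"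
    using Vg by (auto simp: strip_space_def)
  have L: "\<phi> k \<in> L2_loc S" for k using phi(1) T(2) by auto
  have "L2_tendsto S t0 t1 (\<lambda>k. Qdyn S (\<lambda>x. c *\<^sub>C \<phi> k x)) (\<lambda>x. c *\<^sub>C g x) sequentially"
  proof (rule L2_tendsto_cong_AE[OF less_imp_le[OF le] L2_tendsto_scaleC[OF less_imp_le[OF le] phi(3)]])
    show "Qdyn S (\<lambda>x. c *\<^sub>C \<phi> k x) \<in> L2_strip S t0 t1" for k
      by (intro L2_loc_strip[OF _ le] Qdyn_L2_loc L2_loc_scaleC L)
    show "AE x in rho S. c *\<^sub>C Qdyn S (\<phi> k) x = Qdyn S (\<lambda>x. c *\<^sub>C \<phi> k x) x" for k
      using Qdyn_scaleC_AE[OF L[of k], of c] by eventually_elim simp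
  qed
  moreover have "(\<lambda>x. c *\<^sub>C \<phi> k x) \<in> T" for k
    using T(1) phi(1) by (simp add: wave_subspace_def)
  moreover have "\<forall>x. eta S t1 x - eta S t0 x = 0 \<longrightarrow> c *\<^sub>C V x = 0 \<and> c *\<^sub>C g x = 0"
    using Vg by (simp add: strip_space_def)
  ultimately show ?thesis
    using L2_tendsto_scaleC[OF less_imp_le[OF le] phi(2), of c] unfolding strip_space_def
    by (intro CollectI case_prodI conjI exI[of _ "\<lambda>k x. c *\<^sub>C \<phi> k x"]) auto
qed

lemma test_ret_L2_loc: "test_ret S t \<subseteq> L2_loc S"
  using test_ret_Cvary0 Cvary0_L2_loc by blast

text \<open>Both sides of the canonical equation are additive in their first arguments, and the
  completion is closed under sums, so the vectors V and V' may simply be added.\<close>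

lemma canonical_add:
  assumes le: "t0 < t1" and T: "wave_subspace T" "T \<subseteq> L2_loc S"
    and w: "is_canonical S T t0 t1 w \<psi>" and w': "is_canonical S T t0 t1 w' \<psi>'"
  shows "is_canonical S T t0 t1 (\<lambda>x. w x + w' x) (\<lambda>x. \<psi> x + \<psi>' x)"
proof -
  obtain V g where Vg: "(V, g) \<in> strip_space S T t0 t1" "\<psi> = sign_op S g"
    "\<And>u h. (u, h) \<in> strip_space S T t0 t1 \<Longrightarrow> L2_inner S t0 t1 (sign_op S w) u = L2_inner S t0 t1 g h"
    using w unfolding is_canonical_def by blast
  obtain V' g' where Vg': "(V', g') \<in> strip_space S T t0 t1" "\<psi>' = sign_op S g'"
    "\<And>u h. (u, h) \<in> strip_space S T t0 t1 \<Longrightarrow> L2_inner S t0 t1 (sign_op S w') u = L2_inner S t0 t1 g' h"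
    using w' unfolding is_canonical_def by blast
  have wL: "w \<in> L2_strip S t0 t1" "w' \<in> L2_strip S t0 t1" using w w' by (auto simp: is_canonical_def)
  note le' = less_imp_le[OF le]
  have "L2_inner S t0 t1 (sign_op S (\<lambda>x. w x + w' x)) u = L2_inner S t0 t1 (\<lambda>x. g x + g' x) h"
    if uh: "(u, h) \<in> strip_space S T t0 t1" for u h
    using Vg(3)[OF uh] Vg'(3)[OF uh] strip_space_D[OF uh] strip_space_D[OF Vg(1)] strip_space_D[OF Vg'(1)]
    by (simp add: L2_inner_sign_op L2_krein_add_left[OF le' wL] L2_inner_add_left[OF le'])
  moreover have "(\<lambda>x. \<psi> x + \<psi>' x) = sign_op S (\<lambda>x. g x + g' x)"
    by (simp add: sign_op_add Vg(2) Vg'(2))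
  ultimately show ?thesis
    unfolding is_canonical_def
    using L2_strip_add(1)[OF le' wL] strip_space_add[OF le T Vg(1) Vg'(1)] by blast
qed

lemma canonical_scaleC:
  assumes le: "t0 < t1" and T: "wave_subspace T" "T \<subseteq> L2_loc S"
    and w: "is_canonical S T t0 t1 w \<psi>"
  shows "is_canonical S T t0 t1 (\<lambda>x. c *\<^sub>C w x) (\<lambda>x. c *\<^sub>C \<psi> x)"
proof -
  obtain V g where Vg: "(V, g) \<in> strip_space S T t0 t1" "\<psi> = sign_op S g"
    "\<And>u h. (u, h) \<in> strip_space S T t0 t1 \<Longrightarrow> L2_inner S t0 t1 (sign_op S w) u = L2_inner S t0 t1 g h"
    using w unfolding is_canonical_def by blast
  have wL: "w \<in> L2_strip S t0 t1" using w by (auto simp: is_canonical_def)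
  have "L2_inner S t0 t1 (sign_op S (\<lambda>x. c *\<^sub>C w x)) u = L2_inner S t0 t1 (\<lambda>x. c *\<^sub>C g x) h"
    if uh: "(u, h) \<in> strip_space S T t0 t1" for u h
    using Vg(3)[OF uh] strip_space_D[OF Vg(1), THEN L2_strip_wave]
    by (simp add: L2_inner_sign_op L2_krein_scaleC_left L2_inner_scaleC_left)
  moreover have "(\<lambda>x. c *\<^sub>C \<psi> x) = sign_op S (\<lambda>x. c *\<^sub>C g x)"
    by (simp add: sign_op_scaleC Vg(2))
  ultimately show ?thesis
    unfolding is_canonical_def
    using L2_strip_scaleC(1)[OF wL] strip_space_scaleC[OF le T Vg(1)] by blast
qed

section \<open>Linearity, uniqueness and weak equation of the retarded limits\<close>

lemma green_ret_add:
  assumes "green_ret S w u" "green_ret S w' u'"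
  shows "green_ret S (\<lambda>x. w x + w' x) (\<lambda>x. u x + u' x)"
proof -
  obtain f v where fv:
    "\<forall>\<^sub>F tmin in at_bot. (\<forall>\<^sub>F tmax in at_top. is_canonical S (test_ret S tmax) tmin tmax w (f tmin tmax)) \<and>
      (\<forall>t0 t1. tmin \<le> t0 \<and> t0 < t1 \<longrightarrow> L2_tendsto S t0 t1 (f tmin) (v tmin) at_top)"
    "\<And>t0 t1. t0 < t1 \<Longrightarrow> L2_tendsto S t0 t1 v (\<lambda>x. - u x) at_bot"
    using assms(1) unfolding green_ret_def by blast
  obtain f' v' where fv':
    "\<forall>\<^sub>F tmin in at_bot. (\<forall>\<^sub>F tmax in at_top. is_canonical S (test_ret S tmax) tmin tmax w' (f' tmin tmax)) \<and>
      (\<forall>t0 t1. tmin \<le> t0 \<and> t0 < t1 \<longrightarrow> L2_tendsto S t0 t1 (f' tmin) (v' tmin) at_top)"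
    "\<And>t0 t1. t0 < t1 \<Longrightarrow> L2_tendsto S t0 t1 v' (\<lambda>x. - u' x) at_bot"
    using assms(2) unfolding green_ret_def by blast
  have "\<forall>\<^sub>F tmin in at_bot.
      (\<forall>\<^sub>F tmax in at_top. is_canonical S (test_ret S tmax) tmin tmax (\<lambda>x. w x + w' x) (\<lambda>x. f tmin tmax x + f' tmin tmax x)) \<and>
      (\<forall>t0 t1. tmin \<le> t0 \<and> t0 < t1 \<longrightarrow>
        L2_tendsto S t0 t1 (\<lambda>tmax x. f tmin tmax x + f' tmin tmax x) (\<lambda>x. v tmin x + v' tmin x) at_top)"
    using fv(1) fv'(1)
  proof eventually_elim
    fix tmin
    assume A: "(\<forall>\<^sub>F tmax in at_top. is_canonical S (test_ret S tmax) tmin tmax w (f tmin tmax)) \<and>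
      (\<forall>t0 t1. tmin \<le> t0 \<and> t0 < t1 \<longrightarrow> L2_tendsto S t0 t1 (f tmin) (v tmin) at_top)"
      and B: "(\<forall>\<^sub>F tmax in at_top. is_canonical S (test_ret S tmax) tmin tmax w' (f' tmin tmax)) \<and>
      (\<forall>t0 t1. tmin \<le> t0 \<and> t0 < t1 \<longrightarrow> L2_tendsto S t0 t1 (f' tmin) (v' tmin) at_top)"
    have "\<forall>\<^sub>F tmax in at_top. is_canonical S (test_ret S tmax) tmin tmax (\<lambda>x. w x + w' x) (\<lambda>x. f tmin tmax x + f' tmin tmax x)"
      using A[THEN conjunct1] B[THEN conjunct1] eventually_gt_at_top[of tmin]
      by eventually_elim (rule canonical_add[OF _ test_ret_subspace test_ret_L2_loc])
    moreover have "\<forall>t0 t1. tmin \<le> t0 \<and> t0 < t1 \<longrightarrow>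
        L2_tendsto S t0 t1 (\<lambda>tmax x. f tmin tmax x + f' tmin tmax x) (\<lambda>x. v tmin x + v' tmin x) at_top"
      using A B by (auto intro!: L2_tendsto_add)
    ultimately show "(\<forall>\<^sub>F tmax in at_top. is_canonical S (test_ret S tmax) tmin tmax (\<lambda>x. w x + w' x) (\<lambda>x. f tmin tmax x + f' tmin tmax x)) \<and>
      (\<forall>t0 t1. tmin \<le> t0 \<and> t0 < t1 \<longrightarrow>
        L2_tendsto S t0 t1 (\<lambda>tmax x. f tmin tmax x + f' tmin tmax x) (\<lambda>x. v tmin x + v' tmin x) at_top)" ..
  qed
  moreover have "L2_tendsto S t0 t1 (\<lambda>tmin x. v tmin x + v' tmin x) (\<lambda>x. - (u x + u' x)) at_bot" if "t0 < t1" for t0 t1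
    using L2_tendsto_add[OF less_imp_le[OF that] fv(2)[OF that] fv'(2)[OF that]] by simp
  ultimately show ?thesis
    using assms unfolding green_ret_def
    by (intro conjI L2_pc_add exI[of _ "\<lambda>tmin tmax x. f tmin tmax x + f' tmin tmax x"]
      exI[of _ "\<lambda>tmin x. v tmin x + v' tmin x"]) auto
qed

lemma green_ret_scaleC:
  assumes "green_ret S w u"
  shows "green_ret S (\<lambda>x. c *\<^sub>C w x) (\<lambda>x. c *\<^sub>C u x)"
proof -
  obtain f v where fv:
    "\<forall>\<^sub>F tmin in at_bot. (\<forall>\<^sub>F tmax in at_top. is_canonical S (test_ret S tmax) tmin tmax w (f tmin tmax)) \<and>
      (\<forall>t0 t1. tmin \<le> t0 \<and> t0 < t1 \<longrightarrow> L2_tendsto S t0 t1 (f tmin) (v tmin) at_top)"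
    "\<And>t0 t1. t0 < t1 \<Longrightarrow> L2_tendsto S t0 t1 v (\<lambda>x. - u x) at_bot"
    using assms unfolding green_ret_def by blast
  have "\<forall>\<^sub>F tmin in at_bot.
      (\<forall>\<^sub>F tmax in at_top. is_canonical S (test_ret S tmax) tmin tmax (\<lambda>x. c *\<^sub>C w x) (\<lambda>x. c *\<^sub>C f tmin tmax x)) \<and>
      (\<forall>t0 t1. tmin \<le> t0 \<and> t0 < t1 \<longrightarrow> L2_tendsto S t0 t1 (\<lambda>tmax x. c *\<^sub>C f tmin tmax x) (\<lambda>x. c *\<^sub>C v tmin x) at_top)"
    using fv(1)
  proof eventually_elim
    fix tmin
    assume A: "(\<forall>\<^sub>F tmax in at_top. is_canonical S (test_ret S tmax) tmin tmax w (f tmin tmax)) \<and>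
      (\<forall>t0 t1. tmin \<le> t0 \<and> t0 < t1 \<longrightarrow> L2_tendsto S t0 t1 (f tmin) (v tmin) at_top)"
    have "\<forall>\<^sub>F tmax in at_top. is_canonical S (test_ret S tmax) tmin tmax (\<lambda>x. c *\<^sub>C w x) (\<lambda>x. c *\<^sub>C f tmin tmax x)"
      using A[THEN conjunct1] eventually_gt_at_top[of tmin]
      by eventually_elim (rule canonical_scaleC[OF _ test_ret_subspace test_ret_L2_loc])
    moreover have "\<forall>t0 t1. tmin \<le> t0 \<and> t0 < t1 \<longrightarrow> L2_tendsto S t0 t1 (\<lambda>tmax x. c *\<^sub>C f tmin tmax x) (\<lambda>x. c *\<^sub>C v tmin x) at_top"
      using A by (auto intro!: L2_tendsto_scaleC)
    ultimately show "(\<forall>\<^sub>F tmax in at_top. is_canonical S (test_ret S tmax) tmin tmax (\<lambda>x. c *\<^sub>C w x) (\<lambda>x. c *\<^sub>C f tmin tmax x)) \<and>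
      (\<forall>t0 t1. tmin \<le> t0 \<and> t0 < t1 \<longrightarrow> L2_tendsto S t0 t1 (\<lambda>tmax x. c *\<^sub>C f tmin tmax x) (\<lambda>x. c *\<^sub>C v tmin x) at_top)" ..
  qed
  moreover have "L2_tendsto S t0 t1 (\<lambda>tmin x. c *\<^sub>C v tmin x) (\<lambda>x. - (c *\<^sub>C u x)) at_bot" if "t0 < t1" for t0 t1
    using L2_tendsto_scaleC[OF less_imp_le[OF that] fv(2)[OF that], of c]
    by (simp add: complex_vector.scale_minus_right)
  ultimately show ?thesis
    using assms unfolding green_ret_def
    by (intro conjI L2_pc_scaleC exI[of _ "\<lambda>tmin tmax x. c *\<^sub>C f tmin tmax x"]
      exI[of _ "\<lambda>tmin x. c *\<^sub>C v tmin x"]) auto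
qed

text \<open>Where both functions are non-zero the cut-off is inactive: \<open>eta\<close> at tmin is
  0 because w vanishes before t and tmin precedes t, and \<open>eta\<close> at tmax is 1 by the
  condition on test functions. The conjugation comes from exchanging the arguments.\<close>

lemma L2_krein_test_function:
  assumes phi: "\<phi> \<in> test_ret S tmax" and w: "w \<in> L2_loc S" and wt: "AE x in rho S. eta S t x *\<^sub>R w x = 0"
    and le: "tmin \<le> t" "tmin < tmax"
  shows "L2_krein tmin tmax w \<phi> = cnj (krein_inner S \<phi> w)"
proof -
  have phi0: "\<phi> \<in> Cvary0 S" and one: "\<And>x. (1 - eta S tmax x) *\<^sub>R \<phi> x = 0"
    using phi by (auto simp: test_ret_eq)
  obtain a b where tb: "time_bounded a b \<phi>" using Cvary0_time_bounded[OF phi0] .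
  have phiL: "\<phi> \<in> L2_loc S" by (rule Cvary0_L2_loc[OF phi0])
  have "AE x in rho S. of_real (strip_weight tmin tmax x) * spin_inner x (\<phi> x) (w x) = spin_inner x (\<phi> x) (w x)"
    using wt AE_spacetime
  proof eventually_elim
    fix x assume w0: "eta S t x *\<^sub>R w x = 0" and x: "x \<in> spacetime S"
    show "of_real (strip_weight tmin tmax x) * spin_inner x (\<phi> x) (w x) = spin_inner x (\<phi> x) (w x)"
    proof (cases "w x = 0 \<or> \<phi> x = 0")
      case False
      then have "eta S t x = 0" "eta S tmax x = 1" using w0 one[of x] by auto
      then have "strip_weight tmin tmax x = 1"
        using eta_mono[OF x le(1)] eta_bounds[OF x, of tmin] x by (simp add: strip_weight_def)
      then show ?thesis by simp
    qed auto
  qed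
  then have "L2_krein tmin tmax \<phi> w = krein_inner S \<phi> w"
    unfolding L2_krein_def krein_inner_def
    using L2_krein_Cauchy_Schwarz(1)[OF less_imp_le[OF le(2)] L2_loc_strip[OF phiL le(2)] L2_loc_strip[OF w le(2)]]
      krein_integrable[OF tb phiL w]
    by (intro integral_cong_AE) auto
  then show ?thesis by (subst L2_krein_commute) simp
qed

text \<open>For test functions this is \<open>L2_krein_test_function\<close>; a vector of the
  completion is an L2 limit of such functions.\<close>

lemma L2_krein_strip_space_perp:
  assumes n: "n \<in> Cvary0_perp S" and nt: "AE x in rho S. eta S t x *\<^sub>R n x = 0"
    and le: "tmin \<le> t" "tmin < tmax" and uh: "(u, h) \<in> space_ret S tmin tmax"
  shows "L2_krein tmin tmax n u = 0"
proof -
  obtain \<phi> where phi: "\<And>k::nat. \<phi> k \<in> test_ret S tmax" "L2_tendsto S tmin tmax \<phi> u sequentially"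
    using uh by (auto simp: strip_space_def)
  have nL: "n \<in> L2_loc S" by (rule Cvary0_perp_loc[OF n])
  have "L2_krein tmin tmax n (\<phi> k) = 0" for k
    using L2_krein_test_function[OF phi(1) nL nt le] n test_ret_Cvary0[OF phi(1)[of k]]
    by (simp add: Cvary0_perp_def)
  then have "(\<lambda>k. 0) \<longlonglongrightarrow> L2_krein tmin tmax n u"
    using L2_tendsto_krein_right[OF less_imp_le[OF le(2)] phi(2) L2_loc_strip[OF nL le(2)]] by simp
  then show ?thesis using LIMSEQ_unique tendsto_const by blast
qed

lemma strip_space_zero:
  assumes "t0 < t1"
  shows "(\<lambda>x. 0, \<lambda>x. 0) \<in> space_ret S t0 t1"
proof -
  have "L2_tendsto S t0 t1 (\<lambda>k. Qdyn S (\<lambda>x. 0)) (\<lambda>x. 0) sequentially"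
  proof (rule L2_tendsto_cong_AE[OF less_imp_le[OF assms] L2_tendsto_const[OF L2_strip_zero]])
    show "Qdyn S (\<lambda>x. 0) \<in> L2_strip S t0 t1"
      by (intro L2_loc_strip[OF _ assms] Qdyn_L2_loc L2_loc_zero)
    show "AE x in rho S. 0 = Qdyn S (\<lambda>x. 0) x"
      using Qdyn_AE_zero[of "\<lambda>x. 0"] by (auto elim: eventually_mono)
  qed
  moreover have "(\<lambda>x. 0) \<in> test_ret S t1" using test_ret_subspace by (simp add: wave_subspace_def)
  ultimately show ?thesis
    unfolding strip_space_def
    by (auto intro!: exI[of _ "\<lambda>k x. 0"] L2_tendsto_const[OF L2_strip_zero])
qed

text \<open>The canonical equation is solved by V = 0 and Q V = 0, since its left side vanishes by
  \<open>L2_krein_strip_space_perp\<close>; all families in the limits are then constant.\<close>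

lemma green_ret_perp:
  assumes n: "n \<in> Cvary0_perp S" "n \<in> L2_pc S"
  shows "green_ret S n (\<lambda>x. 0)"
proof -
  obtain t where t: "AE x in rho S. eta S t x *\<^sub>R n x = 0" using n(2) by (auto simp: L2_pc_def)
  have can: "is_canonical S (test_ret S tmax) tmin tmax n (\<lambda>x. 0)" if "tmin \<le> t" "tmin < tmax" for tmin tmax
  proof -
    have "L2_inner S tmin tmax (sign_op S n) u = L2_inner S tmin tmax (\<lambda>x. 0) h"
      if "(u, h) \<in> space_ret S tmin tmax" for u h
      using L2_krein_strip_space_perp[OF n(1) t \<open>tmin \<le> t\<close> \<open>tmin < tmax\<close> that]
      by (simp add: L2_inner_sign_op L2_inner_eq wave_function_zero blinfun.zero_right)
    then show ?thesis
      unfolding is_canonical_def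
      using strip_space_zero[OF that(2)] L2_loc_strip[OF L2_pc_loc[OF n(2)] that(2)]
      by (auto simp: sign_op_zero intro!: exI[of _ "\<lambda>x. 0"])
  qed
  have "\<forall>\<^sub>F tmin in at_bot.
      (\<forall>\<^sub>F tmax in at_top. is_canonical S (test_ret S tmax) tmin tmax n (\<lambda>x. 0)) \<and>
      (\<forall>t0 t1. tmin \<le> t0 \<and> t0 < t1 \<longrightarrow> L2_tendsto S t0 t1 (\<lambda>tmax x. 0) (\<lambda>x. 0) at_top)"
    using eventually_le_at_bot[of t]
  proof eventually_elim
    fix tmin assume "tmin \<le> t"
    then have "\<forall>\<^sub>F tmax in at_top. is_canonical S (test_ret S tmax) tmin tmax n (\<lambda>x. 0)"
      by (intro eventually_mono[OF eventually_gt_at_top[of tmin]] can)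
    then show "(\<forall>\<^sub>F tmax in at_top. is_canonical S (test_ret S tmax) tmin tmax n (\<lambda>x. 0)) \<and>
      (\<forall>t0 t1. tmin \<le> t0 \<and> t0 < t1 \<longrightarrow> L2_tendsto S t0 t1 (\<lambda>tmax x. 0) (\<lambda>x. 0) at_top)"
      by (simp add: L2_tendsto_const L2_strip_zero)
  qed
  moreover have "(\<lambda>x. 0) \<in> L2_pc S" by (rule L2_pc_AE_zero[OF L2_loc_zero]) simp
  ultimately show ?thesis
    unfolding green_ret_def using n(2)
    by (intro conjI exI[of _ "\<lambda>tmin tmax x. 0"] exI[of _ "\<lambda>tmin x. 0"])
      (auto intro: L2_tendsto_const[OF L2_strip_zero])
qed

text \<open>An arbitrary limit need not come from the zero solutions of
  \<open>green_ret_perp\<close>, so each canonical solution is estimated: tested against its own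
  vector V, the equation says that Q V has norm zero in the strip.\<close>

lemma green_ret_perp_AE_zero:
  assumes n: "n \<in> Cvary0_perp S" and g: "green_ret S n u"
  shows "AE x in rho S. u x = 0"
proof (rule AE_zero_if_L2_sq_zero)
  show uL: "u \<in> L2_loc S" using g by (simp add: green_ret_def L2_pc_loc)
  obtain t where t: "AE x in rho S. eta S t x *\<^sub>R n x = 0" using g by (auto simp: green_ret_def L2_pc_def)
  obtain f v where fv:
    "\<forall>\<^sub>F tmin in at_bot. (\<forall>\<^sub>F tmax in at_top. is_canonical S (test_ret S tmax) tmin tmax n (f tmin tmax)) \<and>
      (\<forall>t0 t1. tmin \<le> t0 \<and> t0 < t1 \<longrightarrow> L2_tendsto S t0 t1 (f tmin) (v tmin) at_top)"
    "\<And>t0 t1. t0 < t1 \<Longrightarrow> L2_tendsto S t0 t1 v (\<lambda>x. - u x) at_bot"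
    using g unfolding green_ret_def by blast
  fix t0 t1 :: real assume lt: "t0 < t1"
  have "\<forall>\<^sub>F tmin in at_bot. L2_sq t0 t1 (v tmin) = 0"
    using fv(1) eventually_le_at_bot[of "min t t0"]
  proof eventually_elim
    fix tmin
    assume A: "(\<forall>\<^sub>F tmax in at_top. is_canonical S (test_ret S tmax) tmin tmax n (f tmin tmax)) \<and>
      (\<forall>t0 t1. tmin \<le> t0 \<and> t0 < t1 \<longrightarrow> L2_tendsto S t0 t1 (f tmin) (v tmin) at_top)"
      and le: "tmin \<le> min t t0"
    have "\<forall>\<^sub>F tmax in at_top. L2_sq t0 t1 (f tmin tmax) = 0"
      using A[THEN conjunct1] eventually_ge_at_top[of t1]
    proof eventually_elim
      fix tmax assume can: "is_canonical S (test_ret S tmax) tmin tmax n (f tmin tmax)" and ge: "t1 \<le> tmax"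
      have lt': "tmin < tmax" using lt le ge by simp
      obtain V g where Vg: "(V, g) \<in> space_ret S tmin tmax" "f tmin tmax = sign_op S g"
        "L2_inner S tmin tmax (sign_op S n) V = L2_inner S tmin tmax g g"
        using can unfolding is_canonical_def by blast
      have gL: "g \<in> L2_strip S tmin tmax" by (rule strip_space_D(2)[OF Vg(1)])
      have "L2_inner S tmin tmax g g = 0"
        using L2_krein_strip_space_perp[OF n t _ lt' Vg(1)] Vg(3) le by (simp add: L2_inner_sign_op)
      then have "L2_sq tmin tmax g = 0" using L2_inner_self[OF L2_strip_wave[OF gL]] by simp
      moreover have "L2_sq t0 t1 g \<le> L2_sq tmin tmax g"
        by (rule L2_strip_mono(2)[OF _ _ ge gL]) (use le lt in auto)
      ultimately show "L2_sq t0 t1 (f tmin tmax) = 0"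
        using L2_sq_nonneg[of t0 t1 g] lt by (simp add: Vg(2) L2_sq_sign_op[OF L2_strip_wave[OF gL]])
    qed
    then show "L2_sq t0 t1 (v tmin) = 0"
      using A le lt by (intro L2_tendsto_sq_zero[of t0 t1 "f tmin" "v tmin" at_top]) auto
  qed
  then have "L2_sq t0 t1 (\<lambda>x. - u x) = 0"
    by (rule L2_tendsto_sq_zero[OF less_imp_le[OF lt] fv(2)[OF lt], rotated]) simp
  then show "L2_sq t0 t1 u = 0"
    using L2_strip_scaleC(2)[OF L2_loc_strip[OF uL lt], of "-1"] by simp
qed

text \<open>The difference of two limits is a limit for the zero function, which is orthogonal to
  the test functions.\<close>

lemma green_ret_unique:
  assumes "green_ret S w u" "green_ret S w u'"
  shows "AE x in rho S. u x = u' x"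
proof -
  have "green_ret S (\<lambda>x. w x + (-1) *\<^sub>C w x) (\<lambda>x. u x + (-1) *\<^sub>C u' x)"
    by (intro green_ret_add green_ret_scaleC assms)
  then have "green_ret S (\<lambda>x. 0) (\<lambda>x. u x - u' x)" by simp
  moreover have "(\<lambda>x. 0) \<in> Cvary0_perp S" by (rule Cvary0_perp_AE_zero[OF L2_loc_zero]) simp
  ultimately have "AE x in rho S. u x - u' x = 0" by (rule green_ret_perp_AE_zero[rotated])
  then show ?thesis by eventually_elim simp
qed

lemma sign_op_involution:
  assumes "wave_function S g"
  shows "sign_op S (sign_op S g) = g"
proof
  fix x
  show "sign_op S (sign_op S g) x = g x"
  proof (cases "x \<in> spacetime S")
    case True
    show ?thesis
      using op_sgn_involution[OF spacetime_selfadjoint[OF True] spacetime_finite_rank[OF True]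
          wave_function_inside[OF assms True]] True
      by (simp add: sign_op_eq blinfun.minus_right)
  qed (simp add: sign_op_outside wave_function_outside[OF assms])
qed

text \<open>A constant sequence represents the element of the completion. Both time supports have to
  lie in the strip, as pairs in \<open>strip_space\<close> vanish where the weight does.\<close>

lemma test_function_strip_space:
  assumes phi: "\<phi> \<in> Cvary0 S" and tb: "time_bounded tmin tmax \<phi>" "time_bounded tmin tmax (Qdyn S \<phi>)"
  shows "\<phi> \<in> test_ret S tmax" "(\<phi>, Qdyn S \<phi>) \<in> space_ret S tmin tmax"
proof -
  have lt: "tmin < tmax" using tb by (simp add: time_bounded_def)
  have "(1 - eta S tmax x) *\<^sub>R \<phi> x = 0" for x
    using tb(1) by (cases "\<phi> x = 0") (auto simp: time_bounded_def)
  then show test: "\<phi> \<in> test_ret S tmax" using phi by (simp add: test_ret_eq)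
  have "\<forall>x. eta S tmax x - eta S tmin x = 0 \<longrightarrow> \<phi> x = 0 \<and> Qdyn S \<phi> x = 0"
    using tb unfolding time_bounded_def by (metis diff_zero zero_neq_one)
  then show "(\<phi>, Qdyn S \<phi>) \<in> space_ret S tmin tmax"
    unfolding strip_space_def
    using test L2_tendsto_const[OF L2_loc_strip[OF Cvary0_L2_loc[OF phi] lt]]
      L2_tendsto_const[OF L2_loc_strip[OF Qdyn_L2_loc[OF Cvary0_L2_loc[OF phi]] lt]]
    by (auto intro!: exI[of _ "\<lambda>k. \<phi>"])
qed

lemma green_ret_weak_solution:
  assumes g: "green_ret S w u" and phi: "\<phi> \<in> Cvary0 S"
  shows "krein_inner S (Qdyn S \<phi>) u = - krein_inner S \<phi> w"
proof -
  have wL: "w \<in> L2_loc S" and uL: "u \<in> L2_loc S" using g by (simp_all add: green_ret_def L2_pc_loc)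
  have phiL: "\<phi> \<in> L2_loc S" by (rule Cvary0_L2_loc[OF phi])
  obtain t where t: "AE x in rho S. eta S t x *\<^sub>R w x = 0" using g by (auto simp: green_ret_def L2_pc_def)
  obtain f v where fv:
    "\<forall>\<^sub>F tmin in at_bot. (\<forall>\<^sub>F tmax in at_top. is_canonical S (test_ret S tmax) tmin tmax w (f tmin tmax)) \<and>
      (\<forall>t0 t1. tmin \<le> t0 \<and> t0 < t1 \<longrightarrow> L2_tendsto S t0 t1 (f tmin) (v tmin) at_top)"
    "\<And>t0 t1. t0 < t1 \<Longrightarrow> L2_tendsto S t0 t1 v (\<lambda>x. - u x) at_bot"
    using g unfolding green_ret_def by blast
  obtain a0 b0 where tb0: "time_bounded a0 b0 \<phi>" using Cvary0_time_bounded[OF phi] .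
  obtain a1 b1 where tb1: "time_bounded a1 b1 (Qdyn S \<phi>)"
    using Qdyn_time_bounded[OF tb0 L2_loc_wave[OF phiL]] by blast
  \<comment> \<open>A common strip for phi and Q phi, kept fixed while tmin and tmax vary.\<close>
  define A B where "A = min a0 a1" and "B = max b0 b1"
  have tb: "time_bounded A B \<phi>" "time_bounded A B (Qdyn S \<phi>)"
    using time_bounded_mono[OF tb0, of A B] time_bounded_mono[OF tb1, of A B] by (simp_all add: A_def B_def)
  have AB: "A < B" using tb by (simp add: time_bounded_def)
  have QL: "Qdyn S \<phi> \<in> L2_strip S A B" by (rule L2_loc_strip[OF Qdyn_L2_loc[OF phiL] AB])
  let ?c = "cnj (krein_inner S \<phi> w)"
  have "\<forall>\<^sub>F tmin in at_bot. L2_krein A B (v tmin) (Qdyn S \<phi>) = ?c"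
    using fv(1) eventually_le_at_bot[of "min t A"]
  proof eventually_elim
    fix tmin
    assume C: "(\<forall>\<^sub>F tmax in at_top. is_canonical S (test_ret S tmax) tmin tmax w (f tmin tmax)) \<and>
      (\<forall>t0 t1. tmin \<le> t0 \<and> t0 < t1 \<longrightarrow> L2_tendsto S t0 t1 (f tmin) (v tmin) at_top)"
      and le: "tmin \<le> min t A"
    have ev: "\<forall>\<^sub>F tmax in at_top. L2_krein A B (f tmin tmax) (Qdyn S \<phi>) = ?c"
      using C[THEN conjunct1] eventually_ge_at_top[of B]
    proof eventually_elim
      fix tmax assume can: "is_canonical S (test_ret S tmax) tmin tmax w (f tmin tmax)" and ge: "B \<le> tmax"
      have tb': "time_bounded tmin tmax \<phi>" "time_bounded tmin tmax (Qdyn S \<phi>)"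
        using time_bounded_mono[OF tb(1) _ ge] time_bounded_mono[OF tb(2) _ ge] le by simp_all
      note test = test_function_strip_space[OF phi tb']
      obtain V g where Vg: "(V, g) \<in> space_ret S tmin tmax" "f tmin tmax = sign_op S g"
        "L2_inner S tmin tmax (sign_op S w) \<phi> = L2_inner S tmin tmax g (Qdyn S \<phi>)"
        using can test(2) unfolding is_canonical_def by blast
      have gw: "wave_function S g" by (rule L2_strip_wave[OF strip_space_D(2)[OF Vg(1)]])
      \<comment> \<open>Both strips contain the time support of Q phi, so both sides equal the Krein
        product over all of spacetime.\<close>
      have "L2_krein A B (f tmin tmax) (Qdyn S \<phi>) = L2_krein tmin tmax (f tmin tmax) (Qdyn S \<phi>)"
        using time_bounded_krein(2)[OF tb(2)] time_bounded_krein(2)[OF tb'(2)] by metis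
      \<comment> \<open>The canonical solution is E applied to g, and E is an involution: its Krein
        pairing is the Euclidean pairing of g.\<close>
      also have "\<dots> = L2_inner S tmin tmax g (Qdyn S \<phi>)"
        using L2_inner_sign_op[of tmin tmax "sign_op S g" "Qdyn S \<phi>"] by (simp add: Vg(2) sign_op_involution[OF gw])
      also have "\<dots> = L2_krein tmin tmax w \<phi>"
        using Vg(3) by (simp add: L2_inner_sign_op)
      also have "\<dots> = ?c"
        using le AB ge by (intro L2_krein_test_function[OF test(1) wL t]) auto
      finally show "L2_krein A B (f tmin tmax) (Qdyn S \<phi>) = ?c" .
    qed
    have "L2_tendsto S A B (f tmin) (v tmin) at_top" using C le AB by auto
    then have "((\<lambda>tmax. L2_krein A B (f tmin tmax) (Qdyn S \<phi>)) \<longlongrightarrow> L2_krein A B (v tmin) (Qdyn S \<phi>)) at_top"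
      by (rule L2_tendsto_krein_left[OF less_imp_le[OF AB] _ QL])
    moreover have "((\<lambda>tmax. L2_krein A B (f tmin tmax) (Qdyn S \<phi>)) \<longlongrightarrow> ?c) at_top"
      by (rule tendsto_eventually[OF ev])
    ultimately show "L2_krein A B (v tmin) (Qdyn S \<phi>) = ?c"
      by (rule tendsto_unique[rotated]) simp
  qed
  then have "((\<lambda>tmin. L2_krein A B (v tmin) (Qdyn S \<phi>)) \<longlongrightarrow> ?c) at_bot"
    by (rule tendsto_eventually)
  moreover have "((\<lambda>tmin. L2_krein A B (v tmin) (Qdyn S \<phi>)) \<longlongrightarrow> L2_krein A B (\<lambda>x. - u x) (Qdyn S \<phi>)) at_bot"
    by (rule L2_tendsto_krein_left[OF less_imp_le[OF AB] fv(2)[OF AB] QL])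
  ultimately have "?c = L2_krein A B (\<lambda>x. - u x) (Qdyn S \<phi>)"
    by (rule tendsto_unique[rotated]) simp
  also have "\<dots> = - cnj (L2_krein A B (Qdyn S \<phi>) u)"
    using L2_krein_scaleC_left[of A B "-1" u "Qdyn S \<phi>"] L2_krein_commute[of A B u "Qdyn S \<phi>"] by simp
  also have "\<dots> = cnj (- krein_inner S (Qdyn S \<phi>) u)"
    by (simp add: time_bounded_krein(1)[OF tb(2)])
  finally have "krein_inner S \<phi> w = - krein_inner S (Qdyn S \<phi>) u"
    using complex_cnj_cancel_iff by blast
  then show ?thesis by simp
qed

text \<open>By symmetry <phi|Q u> = <Q phi|u>, and the weak equation identifies this with -
  <phi|w>.\<close>

lemma green_ret_Qdyn:
  assumes "green_ret S w u"
  shows "(\<lambda>x. Qdyn S u x + w x) \<in> Cvary0_perp S" "(\<lambda>x. Qdyn S u x + w x) \<in> L2_pc S"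
proof -
  have pc: "w \<in> L2_pc S" "u \<in> L2_pc S" using assms by (simp_all add: green_ret_def)
  show "(\<lambda>x. Qdyn S u x + w x) \<in> L2_pc S"
    by (rule L2_pc_add[OF L2_pc_Qdyn[OF pc(2)] pc(1)])
  have "krein_inner S \<phi> (\<lambda>x. Qdyn S u x + w x) = 0" if phi: "\<phi> \<in> Cvary0 S" for \<phi>
    using krein_add_right[OF phi Qdyn_L2_loc[OF L2_pc_loc[OF pc(2)]] L2_pc_loc[OF pc(1)]]
      krein_Qdyn_symmetric[OF phi L2_pc_loc[OF pc(2)]] green_ret_weak_solution[OF assms phi]
    by (metis add.left_inverse)
  then show "(\<lambda>x. Qdyn S u x + w x) \<in> Cvary0_perp S"
    by (simp add: Cvary0_perp_def L2_loc_add Qdyn_L2_loc L2_pc_loc pc)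
qed

end

section \<open>Time reversal\<close>

text \<open>Reflecting t alone would make the family decrease. The complement 1 - \<open>eta\<close>
  restores monotonicity and exchanges the values 0 and 1, hence past and future compactness.\<close>

definition time_reverse :: "'h::complex_hilbert wave_dynamics \<Rightarrow> 'h wave_dynamics" where
  "time_reverse S = S\<lparr>eta := (\<lambda>t x. 1 - eta S (- t) x)\<rparr>"

lemma time_reverse_simps [simp]:
  "ops (time_reverse S) = ops S" "rho (time_reverse S) = rho S" "Cvary (time_reverse S) = Cvary S"
  "kern (time_reverse S) = kern S" "diagc (time_reverse S) = diagc S"
  "eta (time_reverse S) t x = 1 - eta S (- t) x"
  by (simp_all add: time_reverse_def)

lemma spacetime_time_reverse [simp]: "spacetime (time_reverse S) = spacetime S"
  by (simp add: spacetime_def)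

lemma wave_function_time_reverse [simp]: "wave_function (time_reverse S) = wave_function S"
  by (simp add: wave_function_def[abs_def])

lemma measurable_wave_time_reverse [simp]: "measurable_wave (time_reverse S) = measurable_wave S"
  by (simp add: measurable_wave_def[abs_def])

lemma continuous_waves_time_reverse [simp]: "continuous_waves (time_reverse S) = continuous_waves S"
  by (simp add: continuous_waves_def)

lemma sign_op_time_reverse [simp]: "sign_op (time_reverse S) = sign_op S"
  by (simp add: sign_op_def[abs_def])

lemma Qdyn_time_reverse [simp]: "Qdyn (time_reverse S) = Qdyn S"
  by (simp only: Qdyn_def[abs_def] spacetime_time_reverse time_reverse_simps)

lemma Cvary0_time_reverse [simp]: "Cvary0 (time_reverse S) = Cvary0 S"
  by (simp add: Cvary0_def)

lemma supp_on_time_reverse [simp]: "supp_on (time_reverse S) = supp_on S"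
  by (simp add: supp_on_def[abs_def])

lemma L2_inner_time_reverse: "L2_inner (time_reverse S) t0 t1 = L2_inner S (- t1) (- t0)"
  by (simp add: L2_inner_def[abs_def])

lemma L2_norm_time_reverse: "L2_norm (time_reverse S) t0 t1 = L2_norm S (- t1) (- t0)"
  by (simp add: L2_norm_def[abs_def] L2_inner_time_reverse)

lemma L2_strip_time_reverse: "L2_strip (time_reverse S) t0 t1 = L2_strip S (- t1) (- t0)"
  by (simp add: L2_strip_def)

lemma L2_tendsto_time_reverse:
  "L2_tendsto (time_reverse S) t0 t1 f g N = L2_tendsto S (- t1) (- t0) f g N"
  by (simp add: L2_tendsto_def L2_strip_time_reverse L2_norm_time_reverse)

lemma all_less_uminus: "(\<forall>t0 t1. t0 < t1 \<longrightarrow> P (- t1) (- t0)) \<longleftrightarrow> (\<forall>t0 t1::real. t0 < t1 \<longrightarrow> P t0 t1)"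
  by (metis minus_minus neg_less_iff_less)

lemma ex_uminus: "(\<exists>t::real. P (- t)) \<longleftrightarrow> (\<exists>t. P t)"
  by (metis minus_minus)

lemma L2_loc_time_reverse [simp]: "L2_loc (time_reverse S) = L2_loc S"
  unfolding L2_loc_def L2_strip_time_reverse
  using all_less_uminus[of "\<lambda>t0 t1. _ \<in> L2_strip S t0 t1"] by blast

lemma L2_pc_time_reverse [simp]: "L2_pc (time_reverse S) = L2_fc S"
  unfolding L2_pc_def L2_fc_def L2_loc_time_reverse time_reverse_simps
  using ex_uminus[of "\<lambda>t. AE x in rho S. (1 - eta S t x) *\<^sub>R _ x = 0"] by blast

lemma L2_fc_time_reverse [simp]: "L2_fc (time_reverse S) = L2_pc S"
proof -
  have *: "1 - (1 - eta S t x) = eta S t x" for t x by simp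
  show ?thesis
    unfolding L2_pc_def L2_fc_def L2_loc_time_reverse time_reverse_simps *
    using ex_uminus[of "\<lambda>t. AE x in rho S. eta S t x *\<^sub>R _ x = 0"] by blast
qed

lemma L2_tc_time_reverse [simp]: "L2_tc (time_reverse S) = L2_tc S"
  by (auto simp: L2_tc_def)

lemma Cvary0_perp_time_reverse [simp]: "Cvary0_perp (time_reverse S) = Cvary0_perp S"
  by (simp add: Cvary0_perp_def krein_inner_def)

text \<open>The layer weight, and with it the form, changes its sign, so that only the vanishing of
  the norm is invariant.\<close>

lemma surface_layer_norm_time_reverse:
  "surface_layer_norm (time_reverse S) t \<psi> = 0 \<longleftrightarrow> surface_layer_norm S (- t) \<psi> = 0"
proof -
  have "layer_weight (time_reverse S) t x y = - layer_weight S (- t) x y" for x y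
    by (simp add: layer_weight_def algebra_simps)
  then have "surface_layer_form (time_reverse S) t \<psi> \<psi> = - surface_layer_form S (- t) \<psi> \<psi>"
    by (simp add: surface_layer_form_def)
  then show ?thesis by (simp add: surface_layer_norm_def)
qed

lemma test_ret_time_reverse: "test_ret (time_reverse S) t = test_adv S (- t)"
proof -
  have "(\<forall>t'\<ge>t. surface_layer_norm S (- t') \<psi> = 0) \<longleftrightarrow> (\<forall>t'\<le>-t. surface_layer_norm S t' \<psi> = 0)" for \<psi>
    by (metis minus_minus neg_le_iff_le)
  then show ?thesis
    by (simp add: test_ret_def test_adv_def surface_layer_norm_time_reverse)
qed

lemma strip_space_time_reverse: "strip_space (time_reverse S) T t0 t1 = strip_space S T (- t1) (- t0)"
  by (simp add: strip_space_def L2_tendsto_time_reverse)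

lemma is_canonical_time_reverse:
  "is_canonical (time_reverse S) T t0 t1 w \<psi> = is_canonical S T (- t1) (- t0) w \<psi>"
  by (simp add: is_canonical_def strip_space_time_reverse L2_strip_time_reverse L2_inner_time_reverse)

lemma eventually_at_top_uminus: "(\<forall>\<^sub>F t in at_top. P (- t)) \<longleftrightarrow> (\<forall>\<^sub>F t::real in at_bot. P t)"
  unfolding at_bot_mirror by (simp add: eventually_filtermap)

lemma eventually_at_bot_uminus: "(\<forall>\<^sub>F t in at_bot. P (- t)) \<longleftrightarrow> (\<forall>\<^sub>F t::real in at_top. P t)"
  unfolding at_top_mirror by (simp add: eventually_filtermap)

lemma L2_tendsto_at_top_uminus:
  "L2_tendsto S t0 t1 (\<lambda>t. f (- t)) g at_top \<longleftrightarrow> L2_tendsto S t0 t1 f g (at_bot :: real filter)"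
  unfolding L2_tendsto_def at_bot_mirror by (simp add: eventually_filtermap filterlim_filtermap)

lemma L2_tendsto_at_bot_uminus:
  "L2_tendsto S t0 t1 (\<lambda>t. f (- t)) g at_bot \<longleftrightarrow> L2_tendsto S t0 t1 f g (at_top :: real filter)"
  unfolding L2_tendsto_def at_top_mirror by (simp add: eventually_filtermap filterlim_filtermap)

text \<open>The strip from tmin to tmax becomes the one from -tmax to -tmin. The outer limit of tmin
  to minus infinity thus becomes the outer limit of tmax to infinity, and the approximating families
  are reflected in both arguments.\<close>

lemma green_ret_time_reverse: "green_ret (time_reverse S) w u \<longleftrightarrow> green_adv S w u"
proof
  assume "green_ret (time_reverse S) w u"
  then obtain f v where wu: "w \<in> L2_fc S" "u \<in> L2_fc S" and f:
    "\<forall>\<^sub>F tmin in at_bot. (\<forall>\<^sub>F tmax in at_top. is_canonical S (test_adv S (- tmax)) (- tmax) (- tmin) w (f tmin tmax)) \<and>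
      (\<forall>t0 t1. tmin \<le> t0 \<and> t0 < t1 \<longrightarrow> L2_tendsto S (- t1) (- t0) (f tmin) (v tmin) at_top)"
    and v: "\<And>t0 t1. t0 < t1 \<Longrightarrow> L2_tendsto S (- t1) (- t0) v (\<lambda>x. - u x) at_bot"
    unfolding green_ret_def by (auto simp: is_canonical_time_reverse test_ret_time_reverse L2_tendsto_time_reverse)
  have "\<forall>\<^sub>F tmax in at_top.
      (\<forall>\<^sub>F tmin in at_bot. is_canonical S (test_adv S tmin) tmin tmax w (f (- tmax) (- tmin))) \<and>
      (\<forall>t0 t1. t0 < t1 \<and> t1 \<le> tmax \<longrightarrow> L2_tendsto S t0 t1 (\<lambda>tmin. f (- tmax) (- tmin)) (v (- tmax)) at_bot)"
    using f unfolding eventually_at_top_uminus[symmetric]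
  proof eventually_elim
    fix tmax
    assume A: "(\<forall>\<^sub>F t in at_top. is_canonical S (test_adv S (- t)) (- t) (- (- tmax)) w (f (- tmax) t)) \<and>
      (\<forall>t0 t1. - tmax \<le> t0 \<and> t0 < t1 \<longrightarrow> L2_tendsto S (- t1) (- t0) (f (- tmax)) (v (- tmax)) at_top)"
    have "L2_tendsto S t0 t1 (\<lambda>tmin. f (- tmax) (- tmin)) (v (- tmax)) at_bot" if "t0 < t1" "t1 \<le> tmax" for t0 t1
      using A[THEN conjunct2, rule_format, of "- t1" "- t0"] that by (simp add: L2_tendsto_at_bot_uminus)
    then show "(\<forall>\<^sub>F t in at_top. is_canonical S (test_adv S (- t)) (- t) tmax w (f (- tmax) (- (- t)))) \<and>
      (\<forall>t0 t1. t0 < t1 \<and> t1 \<le> tmax \<longrightarrow> L2_tendsto S t0 t1 (\<lambda>tmin. f (- tmax) (- tmin)) (v (- tmax)) at_bot)"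
      using A by simp
  qed
  moreover have "L2_tendsto S t0 t1 (\<lambda>tmax. v (- tmax)) (\<lambda>x. - u x) at_top" if "t0 < t1" for t0 t1
    using v[of "- t1" "- t0"] that by (simp add: L2_tendsto_at_top_uminus)
  ultimately show "green_adv S w u"
    unfolding green_adv_def using wu
    by (intro conjI exI[of _ "\<lambda>s t. f (- s) (- t)"] exI[of _ "\<lambda>s. v (- s)"]) auto
next
  assume "green_adv S w u"
  then obtain f v where wu: "w \<in> L2_fc S" "u \<in> L2_fc S" and f:
    "\<forall>\<^sub>F tmax in at_top. (\<forall>\<^sub>F tmin in at_bot. is_canonical S (test_adv S tmin) tmin tmax w (f tmax tmin)) \<and>
      (\<forall>t0 t1. t0 < t1 \<and> t1 \<le> tmax \<longrightarrow> L2_tendsto S t0 t1 (f tmax) (v tmax) at_bot)"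
    and v: "\<And>t0 t1. t0 < t1 \<Longrightarrow> L2_tendsto S t0 t1 v (\<lambda>x. - u x) at_top"
    unfolding green_adv_def by blast
  have "\<forall>\<^sub>F tmin in at_bot.
      (\<forall>\<^sub>F tmax in at_top. is_canonical S (test_adv S (- tmax)) (- tmax) (- tmin) w (f (- tmin) (- tmax))) \<and>
      (\<forall>t0 t1. tmin \<le> t0 \<and> t0 < t1 \<longrightarrow> L2_tendsto S (- t1) (- t0) (\<lambda>tmax. f (- tmin) (- tmax)) (v (- tmin)) at_top)"
    using f unfolding eventually_at_bot_uminus[symmetric]
  proof eventually_elim
    fix tmin
    assume A: "(\<forall>\<^sub>F t in at_bot. is_canonical S (test_adv S t) t (- tmin) w (f (- tmin) t)) \<and>
      (\<forall>t0 t1. t0 < t1 \<and> t1 \<le> - tmin \<longrightarrow> L2_tendsto S t0 t1 (f (- tmin)) (v (- tmin)) at_bot)"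
    have "L2_tendsto S (- t1) (- t0) (\<lambda>tmax. f (- tmin) (- tmax)) (v (- tmin)) at_top" if "tmin \<le> t0" "t0 < t1" for t0 t1
      using A[THEN conjunct2, rule_format, of "- t1" "- t0"] that by (simp add: L2_tendsto_at_top_uminus)
    then show "(\<forall>\<^sub>F t in at_bot. is_canonical S (test_adv S (- (- t))) (- (- t)) (- tmin) w (f (- tmin) (- (- t)))) \<and>
      (\<forall>t0 t1. tmin \<le> t0 \<and> t0 < t1 \<longrightarrow> L2_tendsto S (- t1) (- t0) (\<lambda>tmax. f (- tmin) (- tmax)) (v (- tmin)) at_top)"
      using A by simp
  qed
  moreover have "L2_tendsto S (- t1) (- t0) (\<lambda>tmin. v (- tmin)) (\<lambda>x. - u x) at_bot" if "t0 < t1" for t0 t1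
    using v[of "- t1" "- t0"] that by (simp add: L2_tendsto_at_bot_uminus)
  ultimately show "green_ret (time_reverse S) w u"
    unfolding green_ret_def is_canonical_time_reverse test_ret_time_reverse L2_tendsto_time_reverse
      L2_pc_time_reverse
    using wu by (intro conjI exI[of _ "\<lambda>s t. f (- s) (- t)"] exI[of _ "\<lambda>s. v (- s)"]) auto
qed

context wave_dyn
begin

lemma time_reverse_deriv:
  assumes "x \<in> spacetime S"
  shows "((\<lambda>s. 1 - eta S (- s) x) has_real_derivative theta S (- t) x) (at t)"
proof -
  have "((\<lambda>s. eta S (- s) x) has_real_derivative theta S (- t) x * (- 1)) (at t)"
    by (rule DERIV_chain2[OF eta_deriv[OF assms]]) (auto intro!: derivative_eq_intros)
  from DERIV_diff[OF DERIV_const this, of 1] show ?thesis by simp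
qed

lemma theta_time_reverse: "x \<in> spacetime S \<Longrightarrow> theta (time_reverse S) t x = theta S (- t) x"
  using DERIV_imp_deriv[OF time_reverse_deriv] by (simp add: theta_def)

lemma supp_theta_time_reverse: "supp_on S (theta (time_reverse S) t) = supp_on S (theta S (- t))"
proof -
  have "{x \<in> spacetime S. theta (time_reverse S) t x \<noteq> 0} = {x \<in> spacetime S. theta S (- t) x \<noteq> 0}"
    using theta_time_reverse by auto
  then show ?thesis by (simp add: supp_on_def)
qed

lemma wave_dyn_time_reverse: "wave_dyn (time_reverse S)"
proof
  show "selfadjoint x" "finite_rank x" if "x \<in> ops (time_reverse S)" for x
    using that ops_selfadjoint ops_finite_rank by auto
  show "second_countable (top_of_set (ops (time_reverse S)))" by (simp add: second_countable_ops)
  show "locally_finite_regular_measure (time_reverse S)"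
    using measure_rho unfolding locally_finite_regular_measure_def time_reverse_simps .
  show "Cvary (time_reverse S) \<subseteq> continuous_waves (time_reverse S)" "wave_subspace (Cvary (time_reverse S))"
    using Cvary_continuous Cvary_subspace by simp_all
  show "0 \<le> eta (time_reverse S) t x \<and> eta (time_reverse S) t x \<le> 1" if "x \<in> spacetime (time_reverse S)" for x t
    using that eta_bounds by auto
  show "((\<lambda>s. eta (time_reverse S) s x) has_real_derivative theta (time_reverse S) t x) (at t)"
    if "x \<in> spacetime (time_reverse S)" for x t
    using that time_reverse_deriv theta_time_reverse by simp
  show "continuous_on (spacetime (time_reverse S)) (eta (time_reverse S) t)" for t
  proof -
    have "eta (time_reverse S) t = (\<lambda>x. 1 - eta S (- t) x)" by (rule ext) simp
    then show ?thesis by (simp add: continuous_on_diff[OF continuous_on_const eta_continuous])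
  qed
  show "continuous_on (spacetime (time_reverse S)) (theta (time_reverse S) t)" for t
    unfolding spacetime_time_reverse
    using theta_continuous[of "- t"] by (subst continuous_on_cong[OF refl theta_time_reverse]) auto
  show "theta (time_reverse S) t x \<ge> 0" if "x \<in> spacetime (time_reverse S)" for x t
    using that theta_nonneg theta_time_reverse by simp
  show "\<exists>t0 t1. \<forall>x\<in>spacetime (time_reverse S). theta (time_reverse S) t x \<noteq> 0 \<longrightarrow>
      eta (time_reverse S) t0 x = 0 \<and> eta (time_reverse S) t1 x = 1" for t
  proof -
    obtain t0 t1 where "\<forall>x\<in>spacetime S. theta S (- t) x \<noteq> 0 \<longrightarrow> eta S t0 x = 0 \<and> eta S t1 x = 1"
      using theta_range by blast
    then show ?thesis
      \<comment> \<open>The complement turns the value 1 at t1 into the value 0 at -t1, so the two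
        bounds are exchanged.\<close>
      using theta_time_reverse by (intro exI[of _ "- t1"] exI[of _ "- t0"]) simp
  qed
  show "spacetime (time_reverse S) = (\<Union>t. supp_on (time_reverse S) (theta (time_reverse S) t))"
  proof -
    have "(\<Union>t. supp_on S (theta S (- t))) = (\<Union>t. supp_on S (theta S t))"
    proof (rule Set.set_eqI)
      fix x
      show "x \<in> (\<Union>t. supp_on S (theta S (- t))) \<longleftrightarrow> x \<in> (\<Union>t. supp_on S (theta S t))"
        using ex_uminus[of "\<lambda>t. x \<in> supp_on S (theta S t)"] by simp
    qed
    then show ?thesis using spacetime_theta by (simp add: supp_theta_time_reverse)
  qed
  show "symmetric_kernel (time_reverse S)" using kern_symmetric by (simp add: symmetric_kernel_def)
  show "integrable (rho (time_reverse S) \<Otimes>\<^sub>M rho (time_reverse S))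
      (\<lambda>(x, y). spin_inner x (\<psi> x) (kern (time_reverse S) x y (\<phi> y)))"
    if "\<psi> \<in> L2_tc (time_reverse S)" "\<phi> \<in> L2_loc (time_reverse S)" for \<psi> \<phi>
    using that double_integral by simp
  show "finite_time_range (time_reverse S)"
  proof -
    obtain r where r: "r > 0" "\<And>t0 t1 x y u. \<bar>t1 - t0\<bar> > r \<Longrightarrow> x \<in> supp_on S (theta S t0) \<Longrightarrow>
        y \<in> supp_on S (theta S t1) \<Longrightarrow> u \<in> spin_space y \<Longrightarrow> kern S x y u = 0"
      using finite_range unfolding finite_time_range_def by blast
    have "kern S x y u = 0" if "\<bar>t1 - t0\<bar> > r" "x \<in> supp_on S (theta S (- t0))"
      "y \<in> supp_on S (theta S (- t1))" "u \<in> spin_space y" for t0 t1 x y u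
      using that by (intro r(2)[of "- t1" "- t0"]) auto
    then have "\<exists>r>0. \<forall>t0 t1. \<bar>t1 - t0\<bar> > r \<longrightarrow> (\<forall>x\<in>supp_on S (theta S (- t0)).
        \<forall>y\<in>supp_on S (theta S (- t1)). \<forall>u\<in>spin_space y. kern S x y u = 0)"
      using r(1) by blast
    then show ?thesis
      unfolding finite_time_range_def supp_on_time_reverse supp_theta_time_reverse
        L2_loc_time_reverse Qdyn_time_reverse time_reverse_simps
      using kern_AE_integrable Qdyn_L2_loc by blast
  qed
qed

lemmas L2_fc_add = wave_dyn.L2_pc_add[OF wave_dyn_time_reverse, simplified]
lemmas L2_fc_scaleC = wave_dyn.L2_pc_scaleC[OF wave_dyn_time_reverse, simplified]
lemmas L2_fc_AE_zero = wave_dyn.L2_pc_AE_zero[OF wave_dyn_time_reverse,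
  unfolded time_reverse_simps L2_loc_time_reverse L2_pc_time_reverse]
lemmas green_adv_add = wave_dyn.green_ret_add[OF wave_dyn_time_reverse, unfolded green_ret_time_reverse]
lemmas green_adv_scaleC = wave_dyn.green_ret_scaleC[OF wave_dyn_time_reverse, unfolded green_ret_time_reverse]
lemmas green_adv_perp = wave_dyn.green_ret_perp[OF wave_dyn_time_reverse,
  unfolded green_ret_time_reverse Cvary0_perp_time_reverse L2_pc_time_reverse]
lemmas green_adv_unique = wave_dyn.green_ret_unique[OF wave_dyn_time_reverse,
  unfolded green_ret_time_reverse time_reverse_simps]
lemmas green_adv_Qdyn = wave_dyn.green_ret_Qdyn[OF wave_dyn_time_reverse,
  unfolded green_ret_time_reverse Cvary0_perp_time_reverse L2_pc_time_reverse Qdyn_time_reverse]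

end


section \<open>Smoothness of the foliation\<close>

text \<open>Suited to smoothness on a subset, which provides near each point a function on an open
  set that restricts to the given one.\<close>

lemma continuous_on_if_locally_equal:
  assumes "\<And>x. x \<in> A \<Longrightarrow> \<exists>U f. open U \<and> x \<in> U \<and> isCont f x \<and> (\<forall>y\<in>U \<inter> A. h y = f y)"
  shows "continuous_on A h"
  unfolding continuous_on_eq_continuous_within
proof
  fix x assume x: "x \<in> A"
  then obtain U f where U: "open U" "x \<in> U" "isCont f x" "\<forall>y\<in>U \<inter> A. h y = f y"
    using assms by blast
  have "(f \<longlongrightarrow> f x) (at x within A)"
    using U(3) unfolding isCont_def by (rule tendsto_mono[OF at_le[OF subset_UNIV]])
  moreover have "\<forall>\<^sub>F y in at x within A. f y = h y"
    unfolding eventually_at_topological using U by auto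
  ultimately have "(h \<longlongrightarrow> f x) (at x within A)"
    by (rule Lim_transform_eventually)
  then show "continuous (at x within A) h"
    using U x by (simp add: continuous_within)
qed

context
  fixes M :: "'a::real_normed_vector set" and e :: "real \<Rightarrow> 'a \<Rightarrow> real"
  assumes smooth: "smooth_on_subset (UNIV \<times> M) (\<lambda>(t, x). e t x)"
begin

text \<open>Order one of the smoothness of the local extension is used: the time derivative is its
  directional derivative along (1, 0), whose continuity is part of that order.\<close>

lemma smooth_family_local:
  assumes "x \<in> M"
  shows "\<exists>W g. open W \<and> (t, x) \<in> W \<and> (\<forall>s y. (s, y) \<in> W \<longrightarrow> (y \<in> M \<longrightarrow> e s y = g (s, y)) \<and>
    isCont (\<lambda>y. g (s, y)) y \<and> isCont (\<lambda>y. frechet_derivative g (at (s, y)) (1, 0)) y \<and>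
    ((\<lambda>s. g (s, y)) has_real_derivative frechet_derivative g (at (s, y)) (1, 0)) (at s))"
proof -
  obtain W g where W: "open W" "(t, x) \<in> W" "smooth_on W g" "\<forall>q\<in>W \<inter> UNIV \<times> M. g q = (case q of (t, x) \<Rightarrow> e t x)"
    using smooth assms unfolding smooth_on_subset_def by blast
  have "smooth_order (Suc 0) W g" using W(3) unfolding smooth_on_def by blast
  then have diff: "\<And>p. p \<in> W \<Longrightarrow> g differentiable (at p)"
    and cont: "\<And>v. continuous_on W (\<lambda>p. frechet_derivative g (at p) v)"
    unfolding smooth_order.simps by blast+
  show ?thesis
  proof (intro exI[of _ W] exI[of _ g] conjI allI impI W(1,2))
    fix s y assume sy: "(s, y) \<in> W"
    show "e s y = g (s, y)" if "y \<in> M" using W(4) sy that by force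
    have pair: "isCont (\<lambda>y. (s, y)) y" by (intro continuous_intros)
    show "isCont (\<lambda>y. g (s, y)) y"
      by (rule isCont_o2[OF pair differentiable_imp_continuous_within[OF diff[OF sy]]])
    have "isCont (\<lambda>p. frechet_derivative g (at p) (1, 0)) (s, y)"
      using cont[of "(1, 0)"] W(1) sy continuous_on_eq_continuous_at by blast
    then show "isCont (\<lambda>y. frechet_derivative g (at (s, y)) (1, 0)) y"
      by (rule isCont_o2[OF pair])
    let ?g' = "frechet_derivative g (at (s, y))"
    have g': "(g has_derivative ?g') (at (s, y))"
      using diff[OF sy] frechet_derivative_works by blast
    have "((\<lambda>s. (s, y)) has_derivative (\<lambda>h. (h, 0))) (at s)"
      by (intro has_derivative_Pair has_derivative_ident has_derivative_const)
    note deriv = has_derivative_compose[OF this g']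
    have "(\<lambda>h. ?g' (h, 0)) = (*) (?g' (1, 0))"
    proof
      fix h
      show "?g' (h, 0) = ?g' (1, 0) * h"
        using linear_scale[OF has_derivative_linear[OF g'], of h "(1, 0)"] by (simp add: mult.commute)
    qed
    then show "((\<lambda>s. g (s, y)) has_real_derivative ?g' (1, 0)) (at s)"
      using deriv unfolding has_field_derivative_def by (simp only:)
  qed
qed

text \<open>Lines in the time direction stay inside UNIV x M, so extension and family agree on an
  open set of times at x. The time derivative is therefore independent of the extension.\<close>

lemma smooth_family_deriv_eq:
  assumes W: "open W" "(t, x) \<in> W" and x: "x \<in> M"
    and eq: "\<And>s y. (s, y) \<in> W \<Longrightarrow> y \<in> M \<Longrightarrow> e s y = g (s, y)"
    and d: "((\<lambda>s. g (s, x)) has_real_derivative D) (at t)"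
  shows "((\<lambda>s. e s x) has_real_derivative D) (at t)"
proof (rule has_field_derivative_transform_within_open[OF d])
  show "open ((\<lambda>s. (s, x)) -` W)"
    by (intro open_vimage W(1) continuous_intros)
qed (use W(2) eq x in auto)

lemma smooth_family_deriv:
  assumes "x \<in> M"
  shows "((\<lambda>s. e s x) has_real_derivative deriv (\<lambda>s. e s x) t) (at t)"
proof -
  obtain W g where "open W" "(t, x) \<in> W" "\<And>s y. (s, y) \<in> W \<Longrightarrow> y \<in> M \<Longrightarrow> e s y = g (s, y)"
    "\<And>s y. (s, y) \<in> W \<Longrightarrow>
      ((\<lambda>s. g (s, y)) has_real_derivative frechet_derivative g (at (s, y)) (1, 0)) (at s)"
    using smooth_family_local[OF assms, of t] by blast
  then have "((\<lambda>s. e s x) has_real_derivative frechet_derivative g (at (t, x)) (1, 0)) (at t)"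
    using smooth_family_deriv_eq[OF _ _ assms, of W t g] by blast
  then show ?thesis using DERIV_imp_deriv by metis
qed

lemma smooth_family_continuous: "continuous_on M (e t)"
proof (rule continuous_on_if_locally_equal)
  fix x assume x: "x \<in> M"
  obtain W g where W: "open W" "(t, x) \<in> W" "\<And>s y. (s, y) \<in> W \<Longrightarrow> y \<in> M \<Longrightarrow> e s y = g (s, y)"
    "\<And>s y. (s, y) \<in> W \<Longrightarrow> isCont (\<lambda>y. g (s, y)) y"
    using smooth_family_local[OF x, of t] by blast
  have "open ((\<lambda>y. (t, y)) -` W)" by (intro open_vimage W(1) continuous_intros)
  then show "\<exists>U f. open U \<and> x \<in> U \<and> isCont f x \<and> (\<forall>y\<in>U \<inter> M. e t y = f y)"
    using W by (intro exI[of _ "(\<lambda>y. (t, y)) -` W"] exI[of _ "\<lambda>y. g (t, y)"]) auto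
qed

lemma smooth_family_deriv_continuous: "continuous_on M (\<lambda>x. deriv (\<lambda>s. e s x) t)"
proof (rule continuous_on_if_locally_equal)
  fix x assume x: "x \<in> M"
  obtain W g where W: "open W" "(t, x) \<in> W" "\<And>s y. (s, y) \<in> W \<Longrightarrow> y \<in> M \<Longrightarrow> e s y = g (s, y)"
    "\<And>s y. (s, y) \<in> W \<Longrightarrow> isCont (\<lambda>y. g (s, y)) y"
    "\<And>s y. (s, y) \<in> W \<Longrightarrow> isCont (\<lambda>y. frechet_derivative g (at (s, y)) (1, 0)) y"
    "\<And>s y. (s, y) \<in> W \<Longrightarrow>
      ((\<lambda>s. g (s, y)) has_real_derivative frechet_derivative g (at (s, y)) (1, 0)) (at s)"
    using smooth_family_local[OF x, of t] by blast
  have "open ((\<lambda>y. (t, y)) -` W)" by (intro open_vimage W(1) continuous_intros)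
  moreover have "deriv (\<lambda>s. e s y) t = frechet_derivative g (at (t, y)) (1, 0)"
    if "(t, y) \<in> W" "y \<in> M" for y
    by (rule DERIV_imp_deriv, rule smooth_family_deriv_eq[OF W(1) that W(3)]) (use W(6) that in auto)
  ultimately show "\<exists>U f. open U \<and> x \<in> U \<and> isCont f x \<and> (\<forall>y\<in>U \<inter> M. deriv (\<lambda>s. e s y) t = f y)"
    using W(2,5) by (intro exI[of _ "(\<lambda>y. (t, y)) -` W"] exI[of _ "\<lambda>y. frechet_derivative g (at (t, y)) (1, 0)"]) auto
qed

end

text \<open>The smoothness of \<open>eta\<close> is broken down into statements on continuity and
  time derivatives, a form in which invariance under time reversal is easily checked.\<close>

lemma wave_dyn_if_wave_setting:
  assumes "wave_setting S" "finite_time_range S"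
  shows "wave_dyn S"
proof -
  have om: "operator_manifold S" and fol: "global_foliation S"
    using assms(1) by (simp_all add: wave_setting_def)
  have smooth: "smooth_on_subset (UNIV \<times> spacetime S) (\<lambda>(t, x). eta S t x)"
    using fol unfolding global_foliation_def by blast
  have theta: "theta S t = (\<lambda>x. deriv (\<lambda>s. eta S s x) t)" for t
    by (rule ext) (simp add: theta_def)
  show ?thesis
  proof
    show "selfadjoint x" "finite_rank x" if "x \<in> ops S" for x
      using om that by (simp_all add: operator_manifold_def)
    show "second_countable (top_of_set (ops S))"
      using om by (simp add: operator_manifold_def smooth_submanifold_def)
    show "((\<lambda>s. eta S s x) has_real_derivative theta S t x) (at t)" if "x \<in> spacetime S" for x t
      unfolding theta by (rule smooth_family_deriv[OF smooth that])
    show "continuous_on (spacetime S) (eta S t)" for t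
      by (rule smooth_family_continuous[OF smooth])
    show "continuous_on (spacetime S) (theta S t)" for t
      unfolding theta by (rule smooth_family_deriv_continuous[OF smooth])
    show "0 \<le> eta S t x \<and> eta S t x \<le> 1" if "x \<in> spacetime S" for x t
      using fol that unfolding global_foliation_def by blast
    show "theta S t x \<ge> 0" if "x \<in> spacetime S" for x t
      using fol that unfolding global_foliation_def by blast
    show "\<exists>t0 t1. \<forall>x\<in>spacetime S. theta S t x \<noteq> 0 \<longrightarrow> eta S t0 x = 0 \<and> eta S t1 x = 1" for t
      using fol unfolding global_foliation_def by blast
    show "spacetime S = (\<Union>t. supp_on S (theta S t))"
      using fol unfolding global_foliation_def by blast
  qed (use assms in \<open>simp_all add: wave_setting_def double_integrals_exist_def\<close>)
qed

section \<open>Quotients of spaces of wave functions\<close>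

text \<open>A coset does not involve the ambient group, so those formed in
  \<open>wave_group UNIV\<close> by \<open>induced\<close> are the cosets of the quotients.\<close>

definition wave_coset :: "'h::complex_hilbert wave set \<Rightarrow> 'h wave \<Rightarrow> 'h wave set" where
  "wave_coset Y \<psi> = (\<lambda>n x. n x + \<psi> x) ` Y"

lemma wave_subspace_zero: "wave_subspace X \<Longrightarrow> (\<lambda>x. 0) \<in> X"
  and wave_subspace_add: "wave_subspace X \<Longrightarrow> \<psi> \<in> X \<Longrightarrow> \<phi> \<in> X \<Longrightarrow> (\<lambda>x. \<psi> x + \<phi> x) \<in> X"
  and wave_subspace_scaleC: "wave_subspace X \<Longrightarrow> \<psi> \<in> X \<Longrightarrow> (\<lambda>x. c *\<^sub>C \<psi> x) \<in> X"
  by (simp_all add: wave_subspace_def)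

lemma wave_subspace_minus: "wave_subspace X \<Longrightarrow> \<psi> \<in> X \<Longrightarrow> (\<lambda>x. - \<psi> x) \<in> X"
  using wave_subspace_scaleC[of X \<psi> "-1"] by simp

lemma wave_subspace_diff:
  "wave_subspace X \<Longrightarrow> \<psi> \<in> X \<Longrightarrow> \<phi> \<in> X \<Longrightarrow> (\<lambda>x. \<psi> x - \<phi> x) \<in> X"
  using wave_subspace_add[OF _ _ wave_subspace_minus, of X \<psi> \<phi>] by simp

lemma wave_subspace_singleton_zero: "wave_subspace {\<lambda>x. 0}"
  by (simp add: wave_subspace_def)

lemma wave_subspace_Int: "wave_subspace A \<Longrightarrow> wave_subspace B \<Longrightarrow> wave_subspace (A \<inter> B)"
  by (simp add: wave_subspace_def)

lemma wave_subspace_sum: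
  assumes "wave_subspace A" "wave_subspace B"
  shows "wave_subspace {(\<lambda>x. a x + b x) |a b. a \<in> A \<and> b \<in> B}"
  unfolding wave_subspace_def
proof (intro conjI ballI allI)
  show "(\<lambda>x. 0) \<in> {(\<lambda>x. a x + b x) |a b. a \<in> A \<and> b \<in> B}"
    using wave_subspace_zero[OF assms(1)] wave_subspace_zero[OF assms(2)] by force
next
  fix \<psi> \<phi> assume "\<psi> \<in> {(\<lambda>x. a x + b x) |a b. a \<in> A \<and> b \<in> B}" "\<phi> \<in> {(\<lambda>x. a x + b x) |a b. a \<in> A \<and> b \<in> B}"
  then obtain a b a' b' where *: "a \<in> A" "b \<in> B" "a' \<in> A" "b' \<in> B"
    "\<psi> = (\<lambda>x. a x + b x)" "\<phi> = (\<lambda>x. a' x + b' x)" by blast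
  then have "(\<lambda>x. \<psi> x + \<phi> x) = (\<lambda>x. (a x + a' x) + (b x + b' x))" by (simp add: algebra_simps)
  then show "(\<lambda>x. \<psi> x + \<phi> x) \<in> {(\<lambda>x. a x + b x) |a b. a \<in> A \<and> b \<in> B}"
    using wave_subspace_add[OF assms(1) *(1,3)] wave_subspace_add[OF assms(2) *(2,4)]
    by (intro CollectI exI[of _ "\<lambda>x. a x + a' x"] exI[of _ "\<lambda>x. b x + b' x"]) simp
next
  fix c \<psi> assume "\<psi> \<in> {(\<lambda>x. a x + b x) |a b. a \<in> A \<and> b \<in> B}"
  then obtain a b where *: "a \<in> A" "b \<in> B" "\<psi> = (\<lambda>x. a x + b x)" by blast
  then have "(\<lambda>x. c *\<^sub>C \<psi> x) = (\<lambda>x. c *\<^sub>C a x + c *\<^sub>C b x)" by (simp add: scaleC_add_right)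
  then show "(\<lambda>x. c *\<^sub>C \<psi> x) \<in> {(\<lambda>x. a x + b x) |a b. a \<in> A \<and> b \<in> B}"
    using wave_subspace_scaleC[OF assms(1) *(1), of c] wave_subspace_scaleC[OF assms(2) *(2), of c]
    by (intro CollectI exI[of _ "\<lambda>x. c *\<^sub>C a x"] exI[of _ "\<lambda>x. c *\<^sub>C b x"]) simp
qed

lemma wave_group_simps [simp]:
  "carrier (wave_group X) = X" "monoid.mult (wave_group X) \<psi> \<phi> = (\<lambda>x. \<psi> x + \<phi> x)"
  "one (wave_group X) = (\<lambda>x. 0)"
  by (simp_all add: wave_group_def)

lemma comm_group_wave_group:
  assumes "wave_subspace X"
  shows "comm_group (wave_group X)"
proof (rule comm_groupI)
  show "\<exists>\<phi>\<in>carrier (wave_group X). \<phi> \<otimes>\<^bsub>wave_group X\<^esub> \<psi> = \<one>\<^bsub>wave_group X\<^esub>"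
    if "\<psi> \<in> carrier (wave_group X)" for \<psi>
    using that wave_subspace_minus[OF assms, of \<psi>] by (intro bexI[of _ "\<lambda>x. - \<psi> x"]) auto
qed (use wave_subspace_zero[OF assms] wave_subspace_add[OF assms] in \<open>auto simp: algebra_simps\<close>)

lemma subgroup_wave_group:
  assumes X: "wave_subspace X" and Y: "wave_subspace Y" "Y \<subseteq> X"
  shows "subgroup Y (wave_group X)"
proof -
  interpret comm_group "wave_group X" by (rule comm_group_wave_group[OF X])
  show ?thesis
  proof (rule subgroupI)
    show "Y \<subseteq> carrier (wave_group X)" "Y \<noteq> {}" using Y wave_subspace_zero by auto
    fix \<psi> assume psi: "\<psi> \<in> Y"
    have "inv\<^bsub>wave_group X\<^esub> \<psi> = (\<lambda>x. - \<psi> x)"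
      by (rule inv_equality) (use psi Y wave_subspace_minus[OF Y(1) psi] in auto)
    then show "inv\<^bsub>wave_group X\<^esub> \<psi> \<in> Y" using wave_subspace_minus[OF Y(1) psi] by simp
    fix \<phi> assume "\<phi> \<in> Y"
    then show "\<psi> \<otimes>\<^bsub>wave_group X\<^esub> \<phi> \<in> Y" using wave_subspace_add[OF Y(1) psi] by simp
  qed
qed

lemma r_coset_wave_group: "Y #>\<^bsub>wave_group X\<^esub> \<psi> = wave_coset Y \<psi>"
  by (auto simp: r_coset_def wave_coset_def)

lemma carrier_quot: "carrier (quot X Y) = wave_coset Y ` X"
  by (auto simp: FactGroup_def RCOSETS_def r_coset_wave_group)

lemma one_quot: "one (quot X Y) = Y"
  by (simp add: FactGroup_def)

lemma normal_wave_group: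
  assumes "wave_subspace X" "wave_subspace Y" "Y \<subseteq> X"
  shows "normal Y (wave_group X)"
  by (rule comm_group.subgroup_imp_normal[OF comm_group_wave_group[OF assms(1)] subgroup_wave_group[OF assms]])

lemma group_quot:
  assumes "wave_subspace X" "wave_subspace Y" "Y \<subseteq> X"
  shows "group (quot X Y)"
  by (rule normal.factorgroup_is_group[OF normal_wave_group[OF assms]])

lemma mult_quot:
  assumes "wave_subspace X" "wave_subspace Y" "Y \<subseteq> X" "\<psi> \<in> X" "\<phi> \<in> X"
  shows "wave_coset Y \<psi> <#>\<^bsub>wave_group X\<^esub> wave_coset Y \<phi> = wave_coset Y (\<lambda>x. \<psi> x + \<phi> x)"
  using normal.rcos_sum[OF normal_wave_group[OF assms(1-3)], of \<psi> \<phi>] assms(4,5)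
  by (simp add: r_coset_wave_group)

lemma wave_coset_eq_iff:
  assumes Y: "wave_subspace Y"
  shows "wave_coset Y \<psi> = wave_coset Y \<phi> \<longleftrightarrow> (\<lambda>x. \<psi> x - \<phi> x) \<in> Y"
proof
  assume "wave_coset Y \<psi> = wave_coset Y \<phi>"
  moreover have "\<psi> \<in> wave_coset Y \<psi>"
    unfolding wave_coset_def by (rule image_eqI[OF _ wave_subspace_zero[OF Y]]) simp
  ultimately obtain n where "n \<in> Y" "\<psi> = (\<lambda>x. n x + \<phi> x)" unfolding wave_coset_def by blast
  then show "(\<lambda>x. \<psi> x - \<phi> x) \<in> Y" by simp
next
  assume d: "(\<lambda>x. \<psi> x - \<phi> x) \<in> Y"
  have "wave_coset Y \<psi> \<subseteq> wave_coset Y \<phi>" if d: "(\<lambda>x. \<psi> x - \<phi> x) \<in> Y" for \<psi> \<phi>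
  proof
    fix \<omega> assume "\<omega> \<in> wave_coset Y \<psi>"
    then obtain n where "n \<in> Y" "\<omega> = (\<lambda>x. n x + \<psi> x)" unfolding wave_coset_def by blast
    then have "(\<lambda>x. n x + (\<psi> x - \<phi> x)) \<in> Y" "\<omega> = (\<lambda>x. (n x + (\<psi> x - \<phi> x)) + \<phi> x)"
      using wave_subspace_add[OF Y _ d] by auto
    then show "\<omega> \<in> wave_coset Y \<phi>" unfolding wave_coset_def by (intro image_eqI)
  qed
  from this[OF d] this[of \<phi> \<psi>] show "wave_coset Y \<psi> = wave_coset Y \<phi>"
    using wave_subspace_minus[OF Y d] by auto
qed

lemma wave_coset_zero: "wave_coset Y (\<lambda>x. 0) = Y"
  by (simp add: wave_coset_def)

lemma wave_coset_eq_iff_mem: "wave_subspace Y \<Longrightarrow> wave_coset Y \<psi> = Y \<longleftrightarrow> \<psi> \<in> Y"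
  using wave_coset_eq_iff[of Y \<psi> "\<lambda>x. 0"] by (simp add: wave_coset_zero)

text \<open>The scaled representatives all lie in one coset, and \<open>induced\<close> returns this
  full coset; hence the formula also holds for c = 0, where the scaled set itself is a single
  point.\<close>

lemma coset_scale_eq:
  assumes "wave_subspace Z"
  shows "coset_scale Z c (wave_coset Z \<psi>) = wave_coset Z (\<lambda>x. c *\<^sub>C \<psi> x)"
proof -
  have "wave_coset Z (\<lambda>x. c *\<^sub>C (n x + \<psi> x)) = wave_coset Z (\<lambda>x. c *\<^sub>C \<psi> x)" if "n \<in> Z" for n
    using wave_subspace_scaleC[OF assms that, of c]
    by (simp add: wave_coset_eq_iff[OF assms] scaleC_add_right)
  moreover have "Z \<noteq> {}" using wave_subspace_zero[OF assms] by blast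
  ultimately show ?thesis
    unfolding coset_scale_def induced_def r_coset_wave_group
    by (subst (2) wave_coset_def) (simp add: image_image)
qed

text \<open>The maps of the sequence are additive and homogeneous up to null functions only, because
  the integrals defining \<open>Qdyn\<close> need not converge at every point and \<open>s_ret\<close>, \<open>s_adv\<close> are chosen
  representatives.\<close>

locale quot_map =
  fixes X Y X' Y' :: "'h::complex_hilbert wave set" and f :: "'h wave \<Rightarrow> 'h wave"
  assumes X: "wave_subspace X" and Y: "wave_subspace Y" "Y \<subseteq> X"
    and X': "wave_subspace X'" and Y': "wave_subspace Y'" "Y' \<subseteq> X'"
    and maps: "\<psi> \<in> X \<Longrightarrow> f \<psi> \<in> X'"
    and add: "\<psi> \<in> X \<Longrightarrow> \<phi> \<in> X \<Longrightarrow> (\<lambda>x. f (\<lambda>y. \<psi> y + \<phi> y) x - (f \<psi> x + f \<phi> x)) \<in> Y'"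
    and scale: "\<psi> \<in> X \<Longrightarrow> (\<lambda>x. f (\<lambda>y. c *\<^sub>C \<psi> y) x - c *\<^sub>C f \<psi> x) \<in> Y'"
    and null: "\<psi> \<in> Y \<Longrightarrow> f \<psi> \<in> Y'"
begin

lemma induced_coset:
  assumes "\<psi> \<in> X"
  shows "induced f Y' (wave_coset Y \<psi>) = wave_coset Y' (f \<psi>)"
proof -
  have "wave_coset Y' (f (\<lambda>x. n x + \<psi> x)) = wave_coset Y' (f \<psi>)" if "n \<in> Y" for n
  proof -
    \<comment> \<open>The difference of f (n + psi) and f psi is the additivity defect plus f n, and
      both lie in \<open>Y'\<close>.\<close>
    have "(\<lambda>x. (f (\<lambda>x. n x + \<psi> x) x - (f n x + f \<psi> x)) + f n x) \<in> Y'"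
      using that Y(2) by (intro wave_subspace_add[OF Y'(1)] add null assms) auto
    then show ?thesis by (simp add: wave_coset_eq_iff[OF Y'(1)] algebra_simps)
  qed
  moreover have "Y \<noteq> {}" using wave_subspace_zero[OF Y(1)] by blast
  ultimately show ?thesis
    unfolding induced_def r_coset_wave_group
    by (subst wave_coset_def) (simp add: image_image)
qed

lemma induced_hom: "induced f Y' \<in> hom (quot X Y) (quot X' Y')"
proof (rule homI)
  show "induced f Y' A \<in> carrier (quot X' Y')" if "A \<in> carrier (quot X Y)" for A
    using that by (auto simp: carrier_quot induced_coset maps)
  fix A B assume "A \<in> carrier (quot X Y)" "B \<in> carrier (quot X Y)"
  then obtain \<psi> \<phi> where AB: "\<psi> \<in> X" "A = wave_coset Y \<psi>" "\<phi> \<in> X" "B = wave_coset Y \<phi>"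
    by (auto simp: carrier_quot)
  show "induced f Y' (A \<otimes>\<^bsub>quot X Y\<^esub> B) = induced f Y' A \<otimes>\<^bsub>quot X' Y'\<^esub> induced f Y' B"
    using AB add[OF AB(1,3)]
    by (simp add: mult_quot[OF X Y] mult_quot[OF X' Y'] induced_coset maps wave_subspace_add[OF X]
      wave_coset_eq_iff[OF Y'(1)])
qed

lemma induced_homogeneous: "chomogeneous X Y X' Y' (induced f Y')"
  unfolding chomogeneous_def
proof (intro allI ballI conjI)
  fix c A assume "A \<in> carrier (quot X Y)"
  then obtain \<psi> where A: "\<psi> \<in> X" "A = wave_coset Y \<psi>" by (auto simp: carrier_quot)
  have c: "(\<lambda>x. c *\<^sub>C \<psi> x) \<in> X" by (rule wave_subspace_scaleC[OF X A(1)])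
  show "coset_scale Y c A \<in> carrier (quot X Y)"
    using c by (simp add: A coset_scale_eq[OF Y(1)] carrier_quot)
  show "coset_scale Y' c (induced f Y' A) \<in> carrier (quot X' Y')"
    using A wave_subspace_scaleC[OF X' maps[OF A(1)], of c]
    by (simp add: induced_coset coset_scale_eq[OF Y'(1)] carrier_quot)
  show "induced f Y' (coset_scale Y c A) = coset_scale Y' c (induced f Y' A)"
    using A c scale[OF A(1), of c]
    by (simp add: induced_coset coset_scale_eq[OF Y(1)] coset_scale_eq[OF Y'(1)] wave_coset_eq_iff[OF Y'(1)])
qed

lemma kernel_induced: "kernel (quot X Y) (quot X' Y') (induced f Y') = wave_coset Y ` {\<psi> \<in> X. f \<psi> \<in> Y'}"
proof -
  have "induced f Y' (wave_coset Y \<psi>) = Y' \<longleftrightarrow> f \<psi> \<in> Y'" if "\<psi> \<in> X" for \<psi>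
    using that by (simp add: induced_coset wave_coset_eq_iff_mem[OF Y'(1)])
  then show ?thesis
    unfolding kernel_def carrier_quot one_quot by blast
qed

lemma image_induced: "induced f Y' ` carrier (quot X Y) = wave_coset Y' ` f ` X"
  by (auto simp: carrier_quot induced_coset image_image)

end

text \<open>Reduces exactness at a middle space to two statements on representatives, the form in
  which \<open>exact_at_W_tc_star\<close> and \<open>exact_at_W_E\<close> deliver it.\<close>

lemma kernel_eq_image_induced:
  assumes "quot_map X Y X' Y' f" "quot_map X' Y' X'' Y'' g"
    and zero: "\<And>\<psi>. \<psi> \<in> X \<Longrightarrow> g (f \<psi>) \<in> Y''"
    and exact: "\<And>\<phi>. \<phi> \<in> X' \<Longrightarrow> g \<phi> \<in> Y'' \<Longrightarrow> \<exists>\<psi>\<in>X. (\<lambda>x. \<phi> x - f \<psi> x) \<in> Y'"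
  shows "kernel (quot X' Y') (quot X'' Y'') (induced g Y'') = induced f Y' ` carrier (quot X Y)"
proof -
  interpret f: quot_map X Y X' Y' f by fact
  interpret g: quot_map X' Y' X'' Y'' g by fact
  show ?thesis
    unfolding g.kernel_induced f.image_induced
  proof (intro equalityI subsetI)
    fix A assume "A \<in> wave_coset Y' ` {\<phi> \<in> X'. g \<phi> \<in> Y''}"
    then obtain \<phi> where phi: "\<phi> \<in> X'" "g \<phi> \<in> Y''" "A = wave_coset Y' \<phi>" by blast
    then obtain \<psi> where "\<psi> \<in> X" "(\<lambda>x. \<phi> x - f \<psi> x) \<in> Y'" using exact by blast
    then show "A \<in> wave_coset Y' ` f ` X"
      using phi(3) by (auto simp: wave_coset_eq_iff[OF f.Y'(1)] intro!: image_eqI)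
  next
    fix A assume "A \<in> wave_coset Y' ` f ` X"
    then show "A \<in> wave_coset Y' ` {\<phi> \<in> X'. g \<phi> \<in> Y''}" using zero f.maps by blast
  qed
qed


section \<open>The exact sequence\<close>

context wave_dyn
begin

section \<open>Green's limits modulo orthogonal functions, and spatially compact functions\<close>

lemma L2_tc_iff: "\<psi> \<in> L2_tc S \<longleftrightarrow> \<psi> \<in> L2_pc S \<and> \<psi> \<in> L2_fc S"
  by (simp add: L2_tc_def)

lemma green_ret_D: "green_ret S w u \<Longrightarrow> w \<in> L2_pc S" "green_ret S w u \<Longrightarrow> u \<in> L2_pc S"
  by (simp_all add: green_ret_def)

lemma green_adv_D: "green_adv S w u \<Longrightarrow> w \<in> L2_fc S" "green_adv S w u \<Longrightarrow> u \<in> L2_fc S"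
  by (simp_all add: green_adv_def)

lemma L2_fc_loc: "\<psi> \<in> L2_fc S \<Longrightarrow> \<psi> \<in> L2_loc S"
  by (simp add: L2_fc_def)

text \<open>The difference of the sources has the Green's limit 0, which may be added without
  changing u.\<close>

lemma green_ret_cong_perp:
  assumes "green_ret S w u" "(\<lambda>x. w' x - w x) \<in> Cvary0_perp S" "(\<lambda>x. w' x - w x) \<in> L2_pc S"
  shows "green_ret S w' u"
  using green_ret_add[OF assms(1) green_ret_perp[OF assms(2,3)]] by simp

lemma green_adv_cong_perp:
  assumes "green_adv S w u" "(\<lambda>x. w' x - w x) \<in> Cvary0_perp S" "(\<lambda>x. w' x - w x) \<in> L2_fc S"
  shows "green_adv S w' u"
  using green_adv_add[OF assms(1) green_adv_perp[OF assms(2,3)]] by simp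

lemma L2_null_iff: "\<psi> \<in> L2_null S \<longleftrightarrow> \<psi> \<in> L2_loc S \<and> (AE x in rho S. \<psi> x = 0)"
  by (simp add: L2_null_def)

lemma L2_null_D:
  assumes "\<psi> \<in> L2_null S"
  shows "\<psi> \<in> L2_loc S" "\<psi> \<in> L2_pc S" "\<psi> \<in> L2_fc S" "\<psi> \<in> Cvary0_perp S"
  using assms L2_pc_AE_zero L2_fc_AE_zero Cvary0_perp_AE_zero by (auto simp: L2_null_iff)

lemma L2_null_subspace: "wave_subspace (L2_null S)"
  unfolding wave_subspace_def
proof (intro conjI ballI allI)
  show "(\<lambda>x. 0) \<in> L2_null S" by (simp add: L2_null_iff L2_loc_zero)
  show "(\<lambda>x. \<psi> x + \<phi> x) \<in> L2_null S" if "\<psi> \<in> L2_null S" "\<phi> \<in> L2_null S" for \<psi> \<phi>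
  proof -
    have "AE x in rho S. \<psi> x = 0" "AE x in rho S. \<phi> x = 0" using that by (simp_all add: L2_null_iff)
    then have "AE x in rho S. \<psi> x + \<phi> x = 0" by eventually_elim simp
    then show ?thesis using that by (simp add: L2_null_iff L2_loc_add)
  qed
  show "(\<lambda>x. c *\<^sub>C \<psi> x) \<in> L2_null S" if "\<psi> \<in> L2_null S" for c \<psi>
  proof -
    have "AE x in rho S. \<psi> x = 0" using that by (simp add: L2_null_iff)
    then have "AE x in rho S. c *\<^sub>C \<psi> x = 0" by eventually_elim simp
    then show ?thesis using that by (simp add: L2_null_iff L2_loc_scaleC)
  qed
qed

lemma L2_null_if_AE_eq:
  "\<psi> \<in> L2_loc S \<Longrightarrow> \<phi> \<in> L2_loc S \<Longrightarrow> AE x in rho S. \<psi> x = \<phi> x \<Longrightarrow> (\<lambda>x. \<psi> x - \<phi> x) \<in> L2_null S"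
  by (simp add: L2_null_iff L2_loc_diff)

lemma Cvary_sc_zero: "(\<lambda>x. 0) \<in> Cvary_sc S"
  by (auto simp: Cvary_sc_def Cvary_zero intro!: exI[of _ "{}"])

lemma Cvary_sc_add:
  assumes "u \<in> Cvary_sc S" "v \<in> Cvary_sc S"
  shows "(\<lambda>x. u x + v x) \<in> Cvary_sc S"
proof -
  have "\<exists>K. compact K \<and> K \<subseteq> spacetime S \<and> (\<forall>x\<in>time_strip S t0 t1 - K. u x + v x = 0)" if "t0 < t1" for t0 t1
  proof -
    obtain K where K: "compact K" "K \<subseteq> spacetime S" "\<forall>x\<in>time_strip S t0 t1 - K. u x = 0"
      using assms(1) \<open>t0 < t1\<close> unfolding Cvary_sc_def by blast
    obtain L where L: "compact L" "L \<subseteq> spacetime S" "\<forall>x\<in>time_strip S t0 t1 - L. v x = 0"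
      using assms(2) \<open>t0 < t1\<close> unfolding Cvary_sc_def by blast
    show ?thesis
      using K L by (intro exI[of _ "K \<union> L"]) (auto simp: compact_Un)
  qed
  then show ?thesis using assms by (simp add: Cvary_sc_def Cvary_add)
qed

lemma Cvary_sc_scaleC:
  assumes "u \<in> Cvary_sc S"
  shows "(\<lambda>x. c *\<^sub>C u x) \<in> Cvary_sc S"
proof -
  have "\<exists>K. compact K \<and> K \<subseteq> spacetime S \<and> (\<forall>x\<in>time_strip S t0 t1 - K. c *\<^sub>C u x = 0)" if "t0 < t1" for t0 t1
  proof -
    obtain K where "compact K" "K \<subseteq> spacetime S" "\<forall>x\<in>time_strip S t0 t1 - K. u x = 0"
      using assms \<open>t0 < t1\<close> unfolding Cvary_sc_def by blast
    then show ?thesis by (intro exI[of _ K]) auto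
  qed
  then show ?thesis using assms by (simp add: Cvary_sc_def Cvary_scaleC)
qed

lemma Cvary_sc_minus: "u \<in> Cvary_sc S \<Longrightarrow> (\<lambda>x. - u x) \<in> Cvary_sc S"
  using Cvary_sc_scaleC[of u "-1"] by simp

lemma Cvary0_Cvary_sc: "\<phi> \<in> Cvary0 S \<Longrightarrow> \<phi> \<in> Cvary_sc S"
  unfolding Cvary0_def Cvary_sc_def by blast

lemma Cvary_AE_eq:
  assumes "u \<in> Cvary S" "v \<in> Cvary S" "AE x in rho S. u x = v x"
  shows "u = v"
proof -
  have "(\<lambda>x. u x + (-1) *\<^sub>C v x) \<in> Cvary S" by (intro Cvary_add Cvary_scaleC assms)
  moreover have "AE x in rho S. u x + (-1) *\<^sub>C v x = 0" using assms(3) by eventually_elim simp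
  ultimately have "(\<lambda>x. u x + (-1) *\<^sub>C v x) = (\<lambda>x. 0)" by (rule Cvary_AE_zero)
  then show ?thesis by (auto simp: fun_eq_iff)
qed

text \<open>A time compact function vanishes outside a time strip: where \<open>\<eta>\<^sub>t\<^sub>0 = 0\<close> and \<open>\<eta>\<^sub>t\<^sub>1 = 1\<close>,
  some \<open>\<theta>\<^sub>s\<close> with \<open>t0 < s < t1\<close> is positive.\<close>

lemma Cvary_sc_L2_tc_Cvary0:
  assumes u: "u \<in> Cvary_sc S" and tc: "u \<in> L2_pc S" "u \<in> L2_fc S"
  shows "u \<in> Cvary0 S"
proof -
  have uC: "u \<in> Cvary S" using u by (simp add: Cvary_sc_def)
  have wave: "wave_function S u" by (rule Cvary_wave[OF uC])
  obtain t0 t1 where t: "AE x in rho S. eta S t0 x *\<^sub>R u x = 0" "AE x in rho S. (1 - eta S t1 x) *\<^sub>R u x = 0"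
    using tc by (auto simp: L2_pc_def L2_fc_def)
  have eta01: "x \<in> spacetime S \<and> eta S t0 x = 0 \<and> eta S t1 x = 1" if nz: "u x \<noteq> 0" for x
  proof -
    have x: "x \<in> spacetime S" using nz wave_function_outside[OF wave] by blast
    \<comment> \<open>Past and future compactness are statements almost everywhere; continuity makes
      them pointwise, so that the support really becomes compact.\<close>
    have "eta S t0 x *\<^sub>R u x = 0" by (rule Cvary_scaled_AE_zero[OF uC eta_continuous t(1) x])
    moreover have "(1 - eta S t1 x) *\<^sub>R u x = 0"
      by (rule Cvary_scaled_AE_zero[OF uC _ t(2) x]) (intro continuous_intros eta_continuous)
    ultimately show ?thesis using nz x by simp
  qed
  have strip: "t0 < t1 \<and> x \<in> time_strip S t0 t1" if nz: "u x \<noteq> 0" for x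
  proof -
    have x: "x \<in> spacetime S" "eta S t0 x = 0" "eta S t1 x = 1" using eta01[OF nz] by auto
    have lt: "t0 < t1" using eta_mono[OF x(1), of t1 t0] x by (cases "t0 < t1") auto
    obtain s where s: "t0 < s" "s < t1" "eta S t1 x - eta S t0 x = (t1 - t0) * theta S s x"
      using eta_MVT[OF x(1) lt] by blast
    then have "theta S s x \<noteq> 0" using x by auto
    then have "x \<in> supp_on S (theta S s)" by (rule theta_imp_supp[OF x(1)])
    then show ?thesis using lt s(1,2) unfolding time_strip_def by (auto intro!: bexI[of _ s])
  qed
  show ?thesis
  proof (cases "t0 < t1")
    case True
    then obtain K where K: "compact K" "K \<subseteq> spacetime S" "\<forall>x\<in>time_strip S t0 t1 - K. u x = 0"
      using u unfolding Cvary_sc_def by blast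
    then show ?thesis using uC strip unfolding Cvary0_def by blast
  next
    case False
    \<comment> \<open>At a point where u is non-zero, \<open>eta\<close> grows from 0 at t0 to 1 at
      t1, which is impossible for t1 <= t0.\<close>
    then have "u = (\<lambda>x. 0)" using strip by auto
    then show ?thesis using Cvary0_zero by simp
  qed
qed

lemma Qdyn_add_null:
  "u \<in> L2_loc S \<Longrightarrow> v \<in> L2_loc S \<Longrightarrow> (\<lambda>x. Qdyn S (\<lambda>y. u y + v y) x - (Qdyn S u x + Qdyn S v x)) \<in> L2_null S"
  by (intro L2_null_if_AE_eq Qdyn_L2_loc L2_loc_add Qdyn_add_AE)

lemma Qdyn_scaleC_null:
  "u \<in> L2_loc S \<Longrightarrow> (\<lambda>x. Qdyn S (\<lambda>y. c *\<^sub>C u y) x - c *\<^sub>C Qdyn S u x) \<in> L2_null S"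
  by (intro L2_null_if_AE_eq Qdyn_L2_loc L2_loc_scaleC Qdyn_scaleC_AE)

lemma Qdyn_null: "u \<in> L2_null S \<Longrightarrow> Qdyn S u \<in> L2_null S"
  by (simp add: L2_null_iff Qdyn_L2_loc Qdyn_AE_zero)

section \<open>The spaces of the sequence as linear subspaces\<close>

lemma W0_space_D:
  assumes "\<psi> \<in> W0_space S"
  shows "\<psi> \<in> Cvary0 S" "\<psi> \<in> L2_loc S" "green_adv S (Qdyn S \<psi>) (\<lambda>x. - \<psi> x)" "green_ret S (Qdyn S \<psi>) (\<lambda>x. - \<psi> x)"
  using assms Cvary0_L2_loc by (auto simp: W0_space_def)

lemma W0_space_subspace: "wave_subspace (W0_space S)"
  unfolding wave_subspace_def
proof (intro conjI ballI allI)
  have "Qdyn S (\<lambda>x. 0) \<in> L2_null S" using wave_subspace_zero[OF L2_null_subspace] by (rule Qdyn_null)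
  from L2_null_D[OF this] show "(\<lambda>x. 0) \<in> W0_space S"
    by (simp add: W0_space_def Cvary0_zero green_ret_perp green_adv_perp)
next
  fix \<psi> \<phi> assume "\<psi> \<in> W0_space S" "\<phi> \<in> W0_space S"
  note p = W0_space_D[OF this(1)] and q = W0_space_D[OF this(2)]
  \<comment> \<open>The additivity defect of \<open>Qdyn\<close> is a null function, hence
    orthogonal to the test functions and both past and future compact; the Green's limits absorb
    it.\<close>
  note n = L2_null_D[OF Qdyn_add_null[OF p(2) q(2)]]
  have "green_adv S (Qdyn S (\<lambda>x. \<psi> x + \<phi> x)) (\<lambda>x. - \<psi> x + - \<phi> x)"
    by (rule green_adv_cong_perp[OF green_adv_add[OF p(3) q(3)] n(4,3)])
  moreover have "green_ret S (Qdyn S (\<lambda>x. \<psi> x + \<phi> x)) (\<lambda>x. - \<psi> x + - \<phi> x)"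
    by (rule green_ret_cong_perp[OF green_ret_add[OF p(4) q(4)] n(4,2)])
  ultimately show "(\<lambda>x. \<psi> x + \<phi> x) \<in> W0_space S"
    using p q by (simp add: W0_space_def Cvary0_add)
next
  fix c \<psi> assume "\<psi> \<in> W0_space S"
  note p = W0_space_D[OF this]
  note n = L2_null_D[OF Qdyn_scaleC_null[OF p(2), of c]]
  have "green_adv S (Qdyn S (\<lambda>x. c *\<^sub>C \<psi> x)) (\<lambda>x. c *\<^sub>C - \<psi> x)"
    by (rule green_adv_cong_perp[OF green_adv_scaleC[OF p(3)] n(4,3)])
  moreover have "green_ret S (Qdyn S (\<lambda>x. c *\<^sub>C \<psi> x)) (\<lambda>x. c *\<^sub>C - \<psi> x)"
    by (rule green_ret_cong_perp[OF green_ret_scaleC[OF p(4)] n(4,2)])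
  ultimately show "(\<lambda>x. c *\<^sub>C \<psi> x) \<in> W0_space S"
    using p by (simp add: W0_space_def Cvary0_scaleC complex_vector.scale_minus_right)
qed

lemma Wtc_space_I:
  assumes "green_adv S \<psi> u" "u \<in> Cvary_sc S" "green_ret S \<psi> v" "v \<in> Cvary_sc S"
  shows "\<psi> \<in> Wtc_space S"
  using assms green_adv_D(1) green_ret_D(1) by (auto simp: Wtc_space_def L2_tc_iff)

lemma Wtc_space_E:
  assumes "\<psi> \<in> Wtc_space S"
  obtains u v where "green_adv S \<psi> u" "u \<in> Cvary_sc S" "green_ret S \<psi> v" "v \<in> Cvary_sc S"
  using assms by (auto simp: Wtc_space_def)

lemma Wtc_space_subspace: "wave_subspace (Wtc_space S)"
  unfolding wave_subspace_def
proof (intro conjI ballI allI)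
  note n = L2_null_D[OF wave_subspace_zero[OF L2_null_subspace]]
  show "(\<lambda>x. 0) \<in> Wtc_space S"
    by (rule Wtc_space_I[OF green_adv_perp[OF n(4,3)] Cvary_sc_zero green_ret_perp[OF n(4,2)] Cvary_sc_zero])
next
  fix \<psi> \<phi> assume psi: "\<psi> \<in> Wtc_space S" and phi: "\<phi> \<in> Wtc_space S"
  obtain u v where uv: "green_adv S \<psi> u" "u \<in> Cvary_sc S" "green_ret S \<psi> v" "v \<in> Cvary_sc S"
    using Wtc_space_E[OF psi] .
  obtain u' v' where uv': "green_adv S \<phi> u'" "u' \<in> Cvary_sc S" "green_ret S \<phi> v'" "v' \<in> Cvary_sc S"
    using Wtc_space_E[OF phi] .
  show "(\<lambda>x. \<psi> x + \<phi> x) \<in> Wtc_space S"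
    by (rule Wtc_space_I[OF green_adv_add[OF uv(1) uv'(1)] Cvary_sc_add[OF uv(2) uv'(2)]
      green_ret_add[OF uv(3) uv'(3)] Cvary_sc_add[OF uv(4) uv'(4)]])
next
  fix c \<psi> assume psi: "\<psi> \<in> Wtc_space S"
  obtain u v where uv: "green_adv S \<psi> u" "u \<in> Cvary_sc S" "green_ret S \<psi> v" "v \<in> Cvary_sc S"
    using Wtc_space_E[OF psi] .
  show "(\<lambda>x. c *\<^sub>C \<psi> x) \<in> Wtc_space S"
    by (rule Wtc_space_I[OF green_adv_scaleC[OF uv(1)] Cvary_sc_scaleC[OF uv(2)]
      green_ret_scaleC[OF uv(3)] Cvary_sc_scaleC[OF uv(4)]])
qed

lemma Cvary0_perp_subspace: "wave_subspace (Cvary0_perp S)"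
  unfolding wave_subspace_def
  using L2_null_D(4)[OF wave_subspace_zero[OF L2_null_subspace]]
  by (auto intro: Cvary0_perp_add Cvary0_perp_scaleC)

lemma L2_pc_subspace: "wave_subspace (L2_pc S)" and L2_fc_subspace: "wave_subspace (L2_fc S)"
  unfolding wave_subspace_def
  using L2_null_D(2,3)[OF wave_subspace_zero[OF L2_null_subspace]]
  by (auto intro: L2_pc_add L2_pc_scaleC L2_fc_add L2_fc_scaleC)

lemma Wtc_null_subspace: "wave_subspace (Wtc_null S)"
  unfolding Wtc_null_def by (rule wave_subspace_Int[OF Wtc_space_subspace Cvary0_perp_subspace])

text \<open>Both Green's limits exist and are 0, which lies in \<open>Cvary_sc\<close>.\<close>

lemma Wtc_null_I:
  assumes "n \<in> Cvary0_perp S" "n \<in> L2_pc S" "n \<in> L2_fc S"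
  shows "n \<in> Wtc_null S"
  unfolding Wtc_null_def
  using assms Wtc_space_I[OF green_adv_perp[OF assms(1,3)] Cvary_sc_zero green_ret_perp[OF assms(1,2)] Cvary_sc_zero]
  by simp

lemma WE_space_I:
  assumes "\<zeta> \<in> L2_loc S" "green_adv S \<psi>1 u1" "u1 \<in> Cvary_sc S" "green_ret S \<psi>2 u2" "u2 \<in> Cvary_sc S"
    "AE x in rho S. \<zeta> x = u1 x + u2 x"
  shows "\<zeta> \<in> WE_space S"
  unfolding WE_space_def
  using assms green_adv_D(1)[OF assms(2)] green_ret_D(1)[OF assms(4)] by blast

lemma WE_space_E:
  assumes "\<zeta> \<in> WE_space S"
  obtains \<psi>1 \<psi>2 u1 u2 where "\<zeta> \<in> L2_loc S" "green_adv S \<psi>1 u1" "u1 \<in> Cvary_sc S"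
    "green_ret S \<psi>2 u2" "u2 \<in> Cvary_sc S" "AE x in rho S. \<zeta> x = u1 x + u2 x"
  using assms unfolding WE_space_def by blast

lemma L2_null_WE_space:
  assumes "\<zeta> \<in> L2_null S"
  shows "\<zeta> \<in> WE_space S"
proof -
  note n = L2_null_D[OF wave_subspace_zero[OF L2_null_subspace]]
  show ?thesis
    using assms by (intro WE_space_I[OF _ green_adv_perp[OF n(4,3)] Cvary_sc_zero green_ret_perp[OF n(4,2)] Cvary_sc_zero])
      (simp_all add: L2_null_iff)
qed

lemma WE_space_subspace: "wave_subspace (WE_space S)"
  unfolding wave_subspace_def
proof (intro conjI ballI allI)
  show "(\<lambda>x. 0) \<in> WE_space S"
    by (rule L2_null_WE_space[OF wave_subspace_zero[OF L2_null_subspace]])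
next
  fix \<zeta> \<xi> assume z: "\<zeta> \<in> WE_space S" and x: "\<xi> \<in> WE_space S"
  obtain \<psi>1 \<psi>2 u1 u2 where Z: "\<zeta> \<in> L2_loc S" "green_adv S \<psi>1 u1" "u1 \<in> Cvary_sc S"
    "green_ret S \<psi>2 u2" "u2 \<in> Cvary_sc S" "AE x in rho S. \<zeta> x = u1 x + u2 x"
    using WE_space_E[OF z] .
  obtain \<phi>1 \<phi>2 v1 v2 where X: "\<xi> \<in> L2_loc S" "green_adv S \<phi>1 v1" "v1 \<in> Cvary_sc S"
    "green_ret S \<phi>2 v2" "v2 \<in> Cvary_sc S" "AE x in rho S. \<xi> x = v1 x + v2 x"
    using WE_space_E[OF x] .
  show "(\<lambda>x. \<zeta> x + \<xi> x) \<in> WE_space S"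
  proof (rule WE_space_I[OF L2_loc_add[OF Z(1) X(1)] green_adv_add[OF Z(2) X(2)] Cvary_sc_add[OF Z(3) X(3)]
        green_ret_add[OF Z(4) X(4)] Cvary_sc_add[OF Z(5) X(5)]])
    show "AE x in rho S. \<zeta> x + \<xi> x = u1 x + v1 x + (u2 x + v2 x)"
      using Z(6) X(6) by eventually_elim simp
  qed
next
  fix c \<zeta> assume z: "\<zeta> \<in> WE_space S"
  obtain \<psi>1 \<psi>2 u1 u2 where Z: "\<zeta> \<in> L2_loc S" "green_adv S \<psi>1 u1" "u1 \<in> Cvary_sc S"
    "green_ret S \<psi>2 u2" "u2 \<in> Cvary_sc S" "AE x in rho S. \<zeta> x = u1 x + u2 x"
    using WE_space_E[OF z] .
  show "(\<lambda>x. c *\<^sub>C \<zeta> x) \<in> WE_space S"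
  proof (rule WE_space_I[OF L2_loc_scaleC[OF Z(1)] green_adv_scaleC[OF Z(2)] Cvary_sc_scaleC[OF Z(3)]
        green_ret_scaleC[OF Z(4)] Cvary_sc_scaleC[OF Z(5)]])
    show "AE x in rho S. c *\<^sub>C \<zeta> x = c *\<^sub>C u1 x + c *\<^sub>C u2 x"
      using Z(6) by eventually_elim (simp add: scaleC_add_right)
  qed
qed

lemma WE_star_space_I:
  "green_adv S \<psi>1 u1 \<Longrightarrow> u1 \<in> Cvary_sc S \<Longrightarrow> green_ret S \<psi>2 u2 \<Longrightarrow> u2 \<in> Cvary_sc S \<Longrightarrow>
    (\<lambda>x. \<psi>1 x + \<psi>2 x) \<in> WE_star_space S"
  unfolding WE_star_space_def using green_adv_D(1) green_ret_D(1) by blast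

lemma WE_star_space_E:
  assumes "\<omega> \<in> WE_star_space S"
  obtains \<psi>1 \<psi>2 u1 u2 where "\<omega> = (\<lambda>x. \<psi>1 x + \<psi>2 x)" "green_adv S \<psi>1 u1" "u1 \<in> Cvary_sc S"
    "green_ret S \<psi>2 u2" "u2 \<in> Cvary_sc S"
  using assms unfolding WE_star_space_def by blast

lemma WE_star_null_I:
  "n1 \<in> Cvary0_perp S \<Longrightarrow> n1 \<in> L2_fc S \<Longrightarrow> n2 \<in> Cvary0_perp S \<Longrightarrow> n2 \<in> L2_pc S \<Longrightarrow>
    (\<lambda>x. n1 x + n2 x) \<in> WE_star_null S"
  unfolding WE_star_null_def by blast

lemma WE_star_null_subspace: "wave_subspace (WE_star_null S)"
  unfolding WE_star_null_def
  by (intro wave_subspace_sum wave_subspace_Int Cvary0_perp_subspace L2_fc_subspace L2_pc_subspace)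

lemma WE_star_space_subspace: "wave_subspace (WE_star_space S)"
proof -
  define A where "A = {\<psi>. \<psi> \<in> L2_fc S \<and> (\<exists>u\<in>Cvary_sc S. green_adv S \<psi> u)}"
  define B where "B = {\<psi>. \<psi> \<in> L2_pc S \<and> (\<exists>u\<in>Cvary_sc S. green_ret S \<psi> u)}"
  have "wave_subspace A"
    unfolding wave_subspace_def A_def
    using L2_null_D(3,4)[OF wave_subspace_zero[OF L2_null_subspace]]
    by (auto intro: green_adv_perp green_adv_add green_adv_scaleC Cvary_sc_zero Cvary_sc_add Cvary_sc_scaleC
      L2_fc_add L2_fc_scaleC)
  moreover have "wave_subspace B"
    unfolding wave_subspace_def B_def
    using L2_null_D(2,4)[OF wave_subspace_zero[OF L2_null_subspace]]
    by (auto intro: green_ret_perp green_ret_add green_ret_scaleC Cvary_sc_zero Cvary_sc_add Cvary_sc_scaleC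
      L2_pc_add L2_pc_scaleC)
  moreover have "WE_star_space S = {(\<lambda>x. a x + b x) |a b. a \<in> A \<and> b \<in> B}"
    unfolding WE_star_space_def A_def B_def by blast
  ultimately show ?thesis
    using wave_subspace_sum by simp
qed

lemma WE_star_null_subset: "WE_star_null S \<subseteq> WE_star_space S"
  using WE_star_space_I[OF green_adv_perp Cvary_sc_zero green_ret_perp Cvary_sc_zero]
  unfolding WE_star_null_def by blast

lemma L2_null_WE_star_null: "n \<in> L2_null S \<Longrightarrow> n \<in> WE_star_null S"
  using WE_star_null_I[of n "\<lambda>x. 0"] L2_null_D[of n] L2_null_D[OF wave_subspace_zero[OF L2_null_subspace]]
  by simp

lemma L2_null_Wtc_null: "n \<in> L2_null S \<Longrightarrow> n \<in> Wtc_null S"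
  using L2_null_D[of n] by (simp add: Wtc_null_I)

section \<open>The induced maps are well defined\<close>

lemma quot_map_Q1: "quot_map (W0_space S) {\<lambda>x. 0} (Wtc_space S) (Wtc_null S) (Qdyn S)"
proof
  show "Wtc_null S \<subseteq> Wtc_space S" by (simp add: Wtc_null_def)
  show "{\<lambda>x. 0} \<subseteq> W0_space S" using wave_subspace_zero[OF W0_space_subspace] by simp
  show "Qdyn S \<psi> \<in> Wtc_space S" if "\<psi> \<in> W0_space S" for \<psi>
    using Cvary_sc_minus[OF Cvary0_Cvary_sc[OF W0_space_D(1)[OF that]]]
    by (intro Wtc_space_I[OF W0_space_D(3)[OF that] _ W0_space_D(4)[OF that]])
  show "Qdyn S \<psi> \<in> Wtc_null S" if "\<psi> \<in> {\<lambda>x. 0}" for \<psi>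
    using that wave_subspace_zero[OF L2_null_subspace] by (intro L2_null_Wtc_null Qdyn_null) auto
qed (auto intro: W0_space_subspace Wtc_space_subspace Wtc_null_subspace wave_subspace_singleton_zero
  L2_null_Wtc_null Qdyn_add_null Qdyn_scaleC_null W0_space_D(2))

text \<open>The chosen value is one of the admissible limits, so uniqueness identifies it with any
  given limit up to a null function.\<close>

lemma s_adv_eq:
  assumes "green_adv S \<psi> u"
  shows "green_adv S \<psi> (s_adv S \<psi>)" "AE x in rho S. s_adv S \<psi> x = u x"
proof -
  show *: "green_adv S \<psi> (s_adv S \<psi>)" unfolding s_adv_def by (rule someI[of "green_adv S \<psi>", OF assms])
  show "AE x in rho S. s_adv S \<psi> x = u x" by (rule green_adv_unique[OF * assms])
qed

lemma s_ret_eq: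
  assumes "green_ret S \<psi> u"
  shows "green_ret S \<psi> (s_ret S \<psi>)" "AE x in rho S. s_ret S \<psi> x = u x"
proof -
  show *: "green_ret S \<psi> (s_ret S \<psi>)" unfolding s_ret_def by (rule someI[of "green_ret S \<psi>", OF assms])
  show "AE x in rho S. s_ret S \<psi> x = u x" by (rule green_ret_unique[OF * assms])
qed

lemma causal_fundamental_solution_eq:
  assumes "green_adv S \<psi> u" "green_ret S \<psi> v"
  shows "causal_fundamental_solution S \<psi> \<in> L2_loc S"
    and "AE x in rho S. causal_fundamental_solution S \<psi> x = (\<i> / 2) *\<^sub>C (u x - v x)"
proof -
  show "causal_fundamental_solution S \<psi> \<in> L2_loc S"
    unfolding causal_fundamental_solution_def
    using green_adv_D(2)[OF s_adv_eq(1)[OF assms(1)]] green_ret_D(2)[OF s_ret_eq(1)[OF assms(2)]]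
    by (intro L2_loc_scaleC L2_loc_diff L2_fc_loc L2_pc_loc)
  show "AE x in rho S. causal_fundamental_solution S \<psi> x = (\<i> / 2) *\<^sub>C (u x - v x)"
    using s_adv_eq(2)[OF assms(1)] s_ret_eq(2)[OF assms(2)]
    by eventually_elim (simp add: causal_fundamental_solution_def)
qed

lemma quot_map_k: "quot_map (Wtc_space S) (Wtc_null S) (WE_space S) (L2_null S) (causal_fundamental_solution S)"
proof
  show "Wtc_null S \<subseteq> Wtc_space S" by (simp add: Wtc_null_def)
  show "L2_null S \<subseteq> WE_space S" using L2_null_WE_space by blast
  show "causal_fundamental_solution S \<psi> \<in> WE_space S" if psi: "\<psi> \<in> Wtc_space S" for \<psi>
  proof -
    obtain u v where uv: "green_adv S \<psi> u" "u \<in> Cvary_sc S" "green_ret S \<psi> v" "v \<in> Cvary_sc S"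
      using Wtc_space_E[OF psi] .
    note k = causal_fundamental_solution_eq[OF uv(1,3)]
    show ?thesis
    proof (rule WE_space_I[OF k(1) green_adv_scaleC[OF uv(1)] Cvary_sc_scaleC[OF uv(2)]
          green_ret_scaleC[OF uv(3)] Cvary_sc_scaleC[OF uv(4)]])
      show "AE x in rho S. causal_fundamental_solution S \<psi> x = (\<i> / 2) *\<^sub>C u x + (- (\<i> / 2)) *\<^sub>C v x"
        using k(2) by eventually_elim (simp add: scaleC_diff_right)
    qed
  qed
  show "(\<lambda>x. causal_fundamental_solution S (\<lambda>y. \<psi> y + \<phi> y) x
      - (causal_fundamental_solution S \<psi> x + causal_fundamental_solution S \<phi> x)) \<in> L2_null S"
    if psi: "\<psi> \<in> Wtc_space S" and phi: "\<phi> \<in> Wtc_space S" for \<psi> \<phi>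
  proof -
    obtain u v where uv: "green_adv S \<psi> u" "green_ret S \<psi> v" using psi unfolding Wtc_space_def by blast
    obtain u' v' where uv': "green_adv S \<phi> u'" "green_ret S \<phi> v'" using phi unfolding Wtc_space_def by blast
    note k = causal_fundamental_solution_eq[OF uv] and k' = causal_fundamental_solution_eq[OF uv']
    note K = causal_fundamental_solution_eq[OF green_adv_add[OF uv(1) uv'(1)] green_ret_add[OF uv(2) uv'(2)]]
    show ?thesis
    proof (rule L2_null_if_AE_eq[OF K(1) L2_loc_add[OF k(1) k'(1)]])
      show "AE x in rho S. causal_fundamental_solution S (\<lambda>y. \<psi> y + \<phi> y) x
          = causal_fundamental_solution S \<psi> x + causal_fundamental_solution S \<phi> x"
        using K(2) k(2) k'(2)
        by eventually_elim (simp add: scaleC_diff_right scaleC_add_right)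
    qed
  qed
  show "(\<lambda>x. causal_fundamental_solution S (\<lambda>y. c *\<^sub>C \<psi> y) x - c *\<^sub>C causal_fundamental_solution S \<psi> x) \<in> L2_null S"
    if psi: "\<psi> \<in> Wtc_space S" for c \<psi>
  proof -
    obtain u v where uv: "green_adv S \<psi> u" "green_ret S \<psi> v" using psi unfolding Wtc_space_def by blast
    note k = causal_fundamental_solution_eq[OF uv]
    note K = causal_fundamental_solution_eq[OF green_adv_scaleC[OF uv(1)] green_ret_scaleC[OF uv(2)]]
    show ?thesis
    proof (rule L2_null_if_AE_eq[OF K(1) L2_loc_scaleC[OF k(1)]])
      show "AE x in rho S. causal_fundamental_solution S (\<lambda>y. c *\<^sub>C \<psi> y) x = c *\<^sub>C causal_fundamental_solution S \<psi> x"
        using K(2) k(2) by eventually_elim (simp add: scaleC_diff_right scaleC_scaleC mult.commute)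
    qed
  qed
  show "causal_fundamental_solution S \<psi> \<in> L2_null S" if "\<psi> \<in> Wtc_null S" for \<psi>
  proof -
    have psi: "\<psi> \<in> Cvary0_perp S" "\<psi> \<in> L2_pc S" "\<psi> \<in> L2_fc S"
      using that by (auto simp: Wtc_null_def Wtc_space_def L2_tc_iff)
    show ?thesis
      using causal_fundamental_solution_eq[OF green_adv_perp[OF psi(1,3)] green_ret_perp[OF psi(1,2)]]
      by (simp add: L2_null_iff)
  qed
qed (rule Wtc_space_subspace Wtc_null_subspace WE_space_subspace L2_null_subspace)+

text \<open>Up to a null function, n1 and n2 are the errors in Q u1 = - psi1 and Q u2 = - psi2, so
  one is future compact and the other past compact. Exactness at \<open>W_E\<close> relies on this
  splitting.\<close>

lemma Qdyn_WE_space: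
  assumes "\<zeta> \<in> L2_loc S" "green_adv S \<psi>1 u1" "green_ret S \<psi>2 u2" "AE x in rho S. \<zeta> x = u1 x + u2 x"
  obtains n1 n2 where "n1 \<in> Cvary0_perp S" "n1 \<in> L2_fc S" "n2 \<in> Cvary0_perp S" "n2 \<in> L2_pc S"
    "Qdyn S \<zeta> = (\<lambda>x. (n1 x - \<psi>1 x) + (n2 x - \<psi>2 x))"
proof -
  have uL: "u1 \<in> L2_loc S" "u2 \<in> L2_loc S"
    using green_adv_D(2)[OF assms(2)] green_ret_D(2)[OF assms(3)] L2_fc_loc L2_pc_loc by auto
  have "AE x in rho S. Qdyn S \<zeta> x = Qdyn S u1 x + Qdyn S u2 x"
  proof -
    let ?d = "\<lambda>x. \<zeta> x - (u1 x + u2 x)"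
    have dn: "?d \<in> L2_null S" by (rule L2_null_if_AE_eq[OF assms(1) L2_loc_add[OF uL] assms(4)])
    have eq: "(\<lambda>x. (u1 x + u2 x) + ?d x) = \<zeta>" by simp
    have "AE x in rho S. Qdyn S (\<lambda>x. (u1 x + u2 x) + ?d x) x = Qdyn S (\<lambda>x. u1 x + u2 x) x + Qdyn S ?d x"
      by (rule Qdyn_add_AE[OF L2_loc_add[OF uL] L2_null_D(1)[OF dn]])
    moreover have "AE x in rho S. Qdyn S ?d x = 0" using Qdyn_null[OF dn] by (simp add: L2_null_iff)
    ultimately show ?thesis
      using Qdyn_add_AE[OF uL] unfolding eq by eventually_elim simp
  qed
  then have "(\<lambda>x. Qdyn S \<zeta> x - (Qdyn S u1 x + Qdyn S u2 x)) \<in> L2_null S"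
    by (intro L2_null_if_AE_eq Qdyn_L2_loc L2_loc_add assms(1) uL)
  note z = L2_null_D[OF this]
  show ?thesis
  proof (rule that)
    \<comment> \<open>The null function which makes up for zeta = u1 + u2 and the additivity of Q
      holding only almost everywhere is both past and future compact; it is put into n1.\<close>
    show "(\<lambda>x. (Qdyn S u1 x + \<psi>1 x) + (Qdyn S \<zeta> x - (Qdyn S u1 x + Qdyn S u2 x))) \<in> Cvary0_perp S"
      by (rule Cvary0_perp_add[OF green_adv_Qdyn(1)[OF assms(2)] z(4)])
    show "(\<lambda>x. (Qdyn S u1 x + \<psi>1 x) + (Qdyn S \<zeta> x - (Qdyn S u1 x + Qdyn S u2 x))) \<in> L2_fc S"
      by (rule L2_fc_add[OF green_adv_Qdyn(2)[OF assms(2)] z(3)])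
    show "(\<lambda>x. Qdyn S u2 x + \<psi>2 x) \<in> Cvary0_perp S" "(\<lambda>x. Qdyn S u2 x + \<psi>2 x) \<in> L2_pc S"
      by (rule green_ret_Qdyn[OF assms(3)])+
  qed (simp add: fun_eq_iff)
qed

lemma quot_map_Q2: "quot_map (WE_space S) (L2_null S) (WE_star_space S) (WE_star_null S) (Qdyn S)"
proof
  show "L2_null S \<subseteq> WE_space S" using L2_null_WE_space by blast
  show "WE_star_null S \<subseteq> WE_star_space S" by (rule WE_star_null_subset)
  have loc: "\<zeta> \<in> L2_loc S" if "\<zeta> \<in> WE_space S" for \<zeta> using that by (simp add: WE_space_def)
  show "(\<lambda>x. Qdyn S (\<lambda>y. \<psi> y + \<phi> y) x - (Qdyn S \<psi> x + Qdyn S \<phi> x)) \<in> WE_star_null S"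
    if "\<psi> \<in> WE_space S" "\<phi> \<in> WE_space S" for \<psi> \<phi>
    using that loc by (intro L2_null_WE_star_null Qdyn_add_null)
  show "(\<lambda>x. Qdyn S (\<lambda>y. c *\<^sub>C \<psi> y) x - c *\<^sub>C Qdyn S \<psi> x) \<in> WE_star_null S" if "\<psi> \<in> WE_space S" for c \<psi>
    using that loc by (intro L2_null_WE_star_null Qdyn_scaleC_null)
  show "Qdyn S \<zeta> \<in> WE_star_null S" if "\<zeta> \<in> L2_null S" for \<zeta>
    using that by (intro L2_null_WE_star_null Qdyn_null)
  show "Qdyn S \<zeta> \<in> WE_star_space S" if z: "\<zeta> \<in> WE_space S" for \<zeta>
  proof -
    obtain \<psi>1 \<psi>2 u1 u2 where Z: "\<zeta> \<in> L2_loc S" "green_adv S \<psi>1 u1" "u1 \<in> Cvary_sc S"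
      "green_ret S \<psi>2 u2" "u2 \<in> Cvary_sc S" "AE x in rho S. \<zeta> x = u1 x + u2 x"
      using WE_space_E[OF z] .
    obtain n1 n2 where n: "n1 \<in> Cvary0_perp S" "n1 \<in> L2_fc S" "n2 \<in> Cvary0_perp S" "n2 \<in> L2_pc S"
      "Qdyn S \<zeta> = (\<lambda>x. (n1 x - \<psi>1 x) + (n2 x - \<psi>2 x))"
      using Qdyn_WE_space[OF Z(1,2,4,6)] .
    \<comment> \<open>The error n1 is orthogonal and future compact, so - psi1 and n1 - psi1 have
      the same advanced limit.\<close>
    have adv: "green_adv S (\<lambda>x. n1 x - \<psi>1 x) (\<lambda>x. (-1) *\<^sub>C u1 x)"
      by (rule green_adv_cong_perp[OF green_adv_scaleC[OF Z(2)]]) (use n in simp_all)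
    have ret: "green_ret S (\<lambda>x. n2 x - \<psi>2 x) (\<lambda>x. (-1) *\<^sub>C u2 x)"
      by (rule green_ret_cong_perp[OF green_ret_scaleC[OF Z(4)]]) (use n in simp_all)
    show ?thesis
      unfolding n(5)
      by (rule WE_star_space_I[OF adv Cvary_sc_scaleC[OF Z(3)] ret Cvary_sc_scaleC[OF Z(5)]])
  qed
qed (rule WE_space_subspace L2_null_subspace WE_star_space_subspace WE_star_null_subspace)+

text \<open>The Green's limit of Q psi is 0 almost everywhere by orthogonality and - psi by the
  definition of \<open>W0_space\<close>; continuity does the rest.\<close>

lemma exact_at_W_0:
  assumes psi: "\<psi> \<in> W0_space S" and null: "Qdyn S \<psi> \<in> Wtc_null S"
  shows "\<psi> = (\<lambda>x. 0)"
proof -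
  have "AE x in rho S. - \<psi> x = 0"
    using green_ret_perp_AE_zero[OF _ W0_space_D(4)[OF psi]] null by (simp add: Wtc_null_def)
  then show ?thesis
    by (intro Cvary_AE_zero Cvary0_Cvary W0_space_D(1)[OF psi]) simp
qed

text \<open>If k phi vanishes, the advanced and the retarded solution coincide. Their common value u
  is future, past and spatially compact, hence in \<open>Cvary0\<close>, and Q u = - phi modulo the
  orthogonal complement makes - u the preimage.\<close>

lemma exact_at_W_tc_star:
  shows "\<psi> \<in> W0_space S \<Longrightarrow> causal_fundamental_solution S (Qdyn S \<psi>) \<in> L2_null S"
    and "\<phi> \<in> Wtc_space S \<Longrightarrow> causal_fundamental_solution S \<phi> \<in> L2_null S \<Longrightarrow>
      \<exists>\<psi>\<in>W0_space S. (\<lambda>x. \<phi> x - Qdyn S \<psi> x) \<in> Wtc_null S"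
proof -
  show "causal_fundamental_solution S (Qdyn S \<psi>) \<in> L2_null S" if "\<psi> \<in> W0_space S"
    using causal_fundamental_solution_eq[OF W0_space_D(3,4)[OF that]] by (simp add: L2_null_iff)
  assume phi: "\<phi> \<in> Wtc_space S" and k: "causal_fundamental_solution S \<phi> \<in> L2_null S"
  obtain u v where uv: "green_adv S \<phi> u" "u \<in> Cvary_sc S" "green_ret S \<phi> v" "v \<in> Cvary_sc S"
    using Wtc_space_E[OF phi] .
  have "AE x in rho S. causal_fundamental_solution S \<phi> x = 0" using k by (simp add: L2_null_iff)
  then have "AE x in rho S. u x = v x"
    using causal_fundamental_solution_eq(2)[OF uv(1,3)] by eventually_elim simp
  then have "u = v" using uv(2,4) by (intro Cvary_AE_eq) (simp_all add: Cvary_sc_def)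
  then have ret: "green_ret S \<phi> u" using uv(3) by simp
  have u0: "u \<in> Cvary0 S"
    by (rule Cvary_sc_L2_tc_Cvary0[OF uv(2) green_ret_D(2)[OF ret] green_adv_D(2)[OF uv(1)]])
  define \<psi> where "\<psi> = (\<lambda>x. (-1) *\<^sub>C u x)"
  have psi0: "\<psi> \<in> Cvary0 S" unfolding \<psi>_def by (rule Cvary0_scaleC[OF u0])
  note z = L2_null_D[OF Qdyn_scaleC_null[OF Cvary0_L2_loc[OF u0], of "-1"], folded \<psi>_def]
  have eq: "(\<lambda>x. (Qdyn S \<psi> x - (-1) *\<^sub>C Qdyn S u x) + (-1) *\<^sub>C (Qdyn S u x + \<phi> x)) = (\<lambda>x. Qdyn S \<psi> x - \<phi> x)"
    by (simp add: fun_eq_iff)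
  have d: "(\<lambda>x. Qdyn S \<psi> x - \<phi> x) \<in> Cvary0_perp S" "(\<lambda>x. Qdyn S \<psi> x - \<phi> x) \<in> L2_pc S"
    "(\<lambda>x. Qdyn S \<psi> x - \<phi> x) \<in> L2_fc S"
    unfolding eq[symmetric]
    by (intro Cvary0_perp_add Cvary0_perp_scaleC z(4) green_ret_Qdyn(1)[OF ret])
      (intro L2_pc_add L2_pc_scaleC z(2) green_ret_Qdyn(2)[OF ret],
       intro L2_fc_add L2_fc_scaleC z(3) green_adv_Qdyn(2)[OF uv(1)])
  \<comment> \<open>Q psi differs from phi by a time compact orthogonal function, so u remains its
    Green's limit on both sides; and u = - psi, as \<open>W0_space\<close> demands.\<close>
  have "green_adv S (Qdyn S \<psi>) u" "green_ret S (Qdyn S \<psi>) u"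
    by (rule green_adv_cong_perp[OF uv(1) d(1,3)], rule green_ret_cong_perp[OF ret d(1,2)])
  then have "\<psi> \<in> W0_space S" using psi0 by (simp add: W0_space_def \<psi>_def)
  moreover have "(\<lambda>x. \<phi> x - Qdyn S \<psi> x) \<in> Wtc_null S"
    using wave_subspace_minus[OF Wtc_null_subspace Wtc_null_I[OF d]] by simp
  ultimately show "\<exists>\<psi>\<in>W0_space S. (\<lambda>x. \<phi> x - Qdyn S \<psi> x) \<in> Wtc_null S" by blast
qed

text \<open>For the first claim the sources (i/2) psi and -(i/2) psi cancel in Q k psi, leaving the
  error terms. For the second, the vanishing of Q zeta makes psi1 and - psi2 agree up to errors, and
  this common function is future and past compact, hence, up to a factor, the required
  source.\<close>

lemma exact_at_W_E:
  shows "\<psi> \<in> Wtc_space S \<Longrightarrow> Qdyn S (causal_fundamental_solution S \<psi>) \<in> WE_star_null S"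
    and "\<zeta> \<in> WE_space S \<Longrightarrow> Qdyn S \<zeta> \<in> WE_star_null S \<Longrightarrow>
      \<exists>\<psi>\<in>Wtc_space S. (\<lambda>x. \<zeta> x - causal_fundamental_solution S \<psi> x) \<in> L2_null S"
proof -
  assume psi: "\<psi> \<in> Wtc_space S"
  obtain u v where uv: "green_adv S \<psi> u" "green_ret S \<psi> v" using psi unfolding Wtc_space_def by blast
  note k = causal_fundamental_solution_eq[OF uv]
  have "AE x in rho S. causal_fundamental_solution S \<psi> x = (\<i> / 2) *\<^sub>C u x + (- (\<i> / 2)) *\<^sub>C v x"
    using k(2) by eventually_elim (simp add: scaleC_diff_right)
  from Qdyn_WE_space[OF k(1) green_adv_scaleC[OF uv(1)] green_ret_scaleC[OF uv(2)] this]
  obtain n1 n2 where n: "n1 \<in> Cvary0_perp S" "n1 \<in> L2_fc S" "n2 \<in> Cvary0_perp S" "n2 \<in> L2_pc S"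
    "Qdyn S (causal_fundamental_solution S \<psi>) = (\<lambda>x. (n1 x - (\<i> / 2) *\<^sub>C \<psi> x) + (n2 x - (- (\<i> / 2)) *\<^sub>C \<psi> x))"
    by blast
  then have "Qdyn S (causal_fundamental_solution S \<psi>) = (\<lambda>x. n1 x + n2 x)"
    by simp
  then show "Qdyn S (causal_fundamental_solution S \<psi>) \<in> WE_star_null S"
    using n by (simp add: WE_star_null_I)
next
  assume zeta: "\<zeta> \<in> WE_space S" and Q: "Qdyn S \<zeta> \<in> WE_star_null S"
  obtain \<psi>1 \<psi>2 u1 u2 where Z: "\<zeta> \<in> L2_loc S" "green_adv S \<psi>1 u1" "u1 \<in> Cvary_sc S"
    "green_ret S \<psi>2 u2" "u2 \<in> Cvary_sc S" "AE x in rho S. \<zeta> x = u1 x + u2 x"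
    using WE_space_E[OF zeta] .
  obtain n1 n2 where n: "n1 \<in> Cvary0_perp S" "n1 \<in> L2_fc S" "n2 \<in> Cvary0_perp S" "n2 \<in> L2_pc S"
    "Qdyn S \<zeta> = (\<lambda>x. (n1 x - \<psi>1 x) + (n2 x - \<psi>2 x))"
    using Qdyn_WE_space[OF Z(1,2,4,6)] .
  obtain m1 m2 where m: "m1 \<in> Cvary0_perp S" "m1 \<in> L2_fc S" "m2 \<in> Cvary0_perp S" "m2 \<in> L2_pc S"
    "Qdyn S \<zeta> = (\<lambda>x. m1 x + m2 x)"
    using Q unfolding WE_star_null_def by blast
  \<comment> \<open>Comparing the two decompositions of Q zeta and collecting the future compact
    terms on one side gives omega; the other side shows that it is past compact too.\<close>
  define \<omega> where "\<omega> = (\<lambda>x. \<psi>1 x + (m1 x - n1 x))"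
  have chi: "\<omega> = (\<lambda>x. - (\<psi>2 x + (m2 x - n2 x)))"
  proof
    fix x
    have "(n1 x - \<psi>1 x) + (n2 x - \<psi>2 x) = m1 x + m2 x" using n(5) m(5) by (metis (no_types))
    then show "\<omega> x = - (\<psi>2 x + (m2 x - n2 x))" by (simp add: \<omega>_def algebra_simps)
  qed
  have adv: "green_adv S \<omega> u1"
    by (rule green_adv_cong_perp[OF Z(2)])
      (use wave_subspace_diff[OF Cvary0_perp_subspace m(1) n(1)] wave_subspace_diff[OF L2_fc_subspace m(2) n(2)]
        in \<open>simp_all add: \<omega>_def\<close>)
  have "green_ret S (\<lambda>x. \<psi>2 x + (m2 x - n2 x)) u2"
    by (rule green_ret_cong_perp[OF Z(4)])
      (use wave_subspace_diff[OF Cvary0_perp_subspace m(3) n(3)] wave_subspace_diff[OF L2_pc_subspace m(4) n(4)]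
        in simp_all)
  from green_ret_scaleC[OF this, of "-1"] have ret: "green_ret S \<omega> (\<lambda>x. (-1) *\<^sub>C u2 x)"
    by (simp add: chi)
  \<comment> \<open>The factor inverts the i/2 of k. The advanced limit of omega is u1 and the
    retarded one is - u2, so their difference is u1 + u2.\<close>
  define \<psi> where "\<psi> = (\<lambda>x. (- 2 * \<i>) *\<^sub>C \<omega> x)"
  note g = green_adv_scaleC[OF adv, of "- 2 * \<i>", folded \<psi>_def] green_ret_scaleC[OF ret, of "- 2 * \<i>", folded \<psi>_def]
  have "\<psi> \<in> Wtc_space S"
    by (rule Wtc_space_I[OF g(1) Cvary_sc_scaleC[OF Z(3)] g(2) Cvary_sc_scaleC[OF Cvary_sc_scaleC[OF Z(5)]]])
  moreover have "(\<lambda>x. \<zeta> x - causal_fundamental_solution S \<psi> x) \<in> L2_null S"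
  proof (rule L2_null_if_AE_eq[OF Z(1) causal_fundamental_solution_eq(1)[OF g]])
    show "AE x in rho S. \<zeta> x = causal_fundamental_solution S \<psi> x"
      using causal_fundamental_solution_eq(2)[OF g] Z(6)
      by eventually_elim (simp add: scaleC_diff_right scaleC_scaleC)
  qed
  ultimately show "\<exists>\<psi>\<in>Wtc_space S. (\<lambda>x. \<zeta> x - causal_fundamental_solution S \<psi> x) \<in> L2_null S" by blast
qed

text \<open>Since Q s = -1 modulo the space divided out, minus the sum of the Green's limits is a
  preimage.\<close>

lemma exact_at_W_E_star:
  assumes "\<omega> \<in> WE_star_space S"
  shows "\<exists>\<zeta>\<in>WE_space S. (\<lambda>x. \<omega> x - Qdyn S \<zeta> x) \<in> WE_star_null S"
proof -
  obtain \<psi>1 \<psi>2 u1 u2 where C: "\<omega> = (\<lambda>x. \<psi>1 x + \<psi>2 x)" "green_adv S \<psi>1 u1" "u1 \<in> Cvary_sc S"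
    "green_ret S \<psi>2 u2" "u2 \<in> Cvary_sc S"
    using WE_star_space_E[OF assms] .
  note g = green_adv_scaleC[OF C(2), of "-1"] green_ret_scaleC[OF C(4), of "-1"]
  define \<zeta> where "\<zeta> = (\<lambda>x. (-1) *\<^sub>C u1 x + (-1) *\<^sub>C u2 x)"
  have zL: "\<zeta> \<in> L2_loc S"
    unfolding \<zeta>_def using green_adv_D(2)[OF g(1)] green_ret_D(2)[OF g(2)]
    by (intro L2_loc_add L2_fc_loc L2_pc_loc)
  have ae: "AE x in rho S. \<zeta> x = (-1) *\<^sub>C u1 x + (-1) *\<^sub>C u2 x" by (simp add: \<zeta>_def)
  have "\<zeta> \<in> WE_space S"
    by (rule WE_space_I[OF zL g(1) Cvary_sc_scaleC[OF C(3)] g(2) Cvary_sc_scaleC[OF C(5)] ae])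
  moreover obtain n1 n2 where n: "n1 \<in> Cvary0_perp S" "n1 \<in> L2_fc S" "n2 \<in> Cvary0_perp S" "n2 \<in> L2_pc S"
    "Qdyn S \<zeta> = (\<lambda>x. (n1 x - (-1) *\<^sub>C \<psi>1 x) + (n2 x - (-1) *\<^sub>C \<psi>2 x))"
    using Qdyn_WE_space[OF zL g ae] .
  have "(\<lambda>x. \<omega> x - Qdyn S \<zeta> x) = (\<lambda>x. - (n1 x + n2 x))"
    by (simp add: n(5) C(1) fun_eq_iff)
  then have "(\<lambda>x. \<omega> x - Qdyn S \<zeta> x) \<in> WE_star_null S"
    using wave_subspace_minus[OF WE_star_null_subspace WE_star_null_I[OF n(1-4)]] by simp
  ultimately show ?thesis by blast
qed

theorem exact_sequence:
  "exact_seq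
    ([zero_space, W_E_star S, W_E S, W_tc_star S, W_0 S, zero_space],
     [\<lambda>_. {\<lambda>x. 0}, induced (Qdyn S) (WE_star_null S), induced (causal_fundamental_solution S) (L2_null S),
      induced (Qdyn S) (Wtc_null S), \<lambda>_. {\<lambda>x. 0}])"
proof -
  interpret Q1: quot_map "W0_space S" "{\<lambda>x. 0}" "Wtc_space S" "Wtc_null S" "Qdyn S" by (rule quot_map_Q1)
  interpret k: quot_map "Wtc_space S" "Wtc_null S" "WE_space S" "L2_null S" "causal_fundamental_solution S"
    by (rule quot_map_k)
  interpret Q2: quot_map "WE_space S" "L2_null S" "WE_star_space S" "WE_star_null S" "Qdyn S" by (rule quot_map_Q2)
  have groups: "group (W_0 S)" "group (W_tc_star S)" "group (W_E S)" "group (W_E_star S)"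
    "group (zero_space :: 'h wave set monoid)"
    by (intro group_quot Q1.X Q1.Y k.X k.Y Q2.X Q2.Y Q2.X' Q2.Y' wave_subspace_singleton_zero order_refl)+
  have trivial: "(\<lambda>_. {\<lambda>x. 0}) \<in> hom G H" if "group H" "one H = {\<lambda>x. 0}" for G H :: "'h wave set monoid"
    using group.is_monoid[OF that(1)] that(2) monoid.one_closed monoid.l_one by (fastforce simp: hom_def)
  have zero_carrier: "carrier (zero_space :: 'h wave set monoid) = {{\<lambda>x. 0}}"
    by (simp add: carrier_quot wave_coset_zero)
  \<comment> \<open>The sequence is built up from its left end, one group at a time; each extension
    contributes the kernel condition at the group that was last before.\<close>
  have e0: "exact_seq ([W_0 S, zero_space], [\<lambda>_. {\<lambda>x. 0}])"
    by (intro exact_seq.unity group_hom.intro group_hom_axioms.intro groups trivial) (simp add: one_quot)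
  have k0: "kernel (W_0 S) (W_tc_star S) (induced (Qdyn S) (Wtc_null S)) = (\<lambda>_. {\<lambda>x. 0}) ` carrier (zero_space :: 'h wave set monoid)"
  proof -
    have "{\<psi> \<in> W0_space S. Qdyn S \<psi> \<in> Wtc_null S} = {\<lambda>x. 0}"
    proof (intro equalityI subsetI)
      fix \<psi> assume "\<psi> \<in> {\<psi> \<in> W0_space S. Qdyn S \<psi> \<in> Wtc_null S}"
      then show "\<psi> \<in> {\<lambda>x. 0}" using exact_at_W_0[of \<psi>] by blast
    next
      fix \<psi> :: "'h wave" assume "\<psi> \<in> {\<lambda>x. 0}"
      then show "\<psi> \<in> {\<psi> \<in> W0_space S. Qdyn S \<psi> \<in> Wtc_null S}"
        using Q1.null[of \<psi>] Q1.Y(2) by blast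
    qed
    then show ?thesis by (simp add: Q1.kernel_induced zero_carrier wave_coset_zero)
  qed
  have e1: "exact_seq ([W_tc_star S, W_0 S, zero_space], [induced (Qdyn S) (Wtc_null S), \<lambda>_. {\<lambda>x. 0}])"
    by (rule exact_seq.extension[OF e0 groups(2) Q1.induced_hom k0])
  have k1: "kernel (W_tc_star S) (W_E S) (induced (causal_fundamental_solution S) (L2_null S))
      = induced (Qdyn S) (Wtc_null S) ` carrier (W_0 S)"
    by (rule kernel_eq_image_induced[OF quot_map_Q1 quot_map_k exact_at_W_tc_star])
  have e2: "exact_seq ([W_E S, W_tc_star S, W_0 S, zero_space],
      [induced (causal_fundamental_solution S) (L2_null S), induced (Qdyn S) (Wtc_null S), \<lambda>_. {\<lambda>x. 0}])"
    by (rule exact_seq.extension[OF e1 groups(3) k.induced_hom k1])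
  have k2: "kernel (W_E S) (W_E_star S) (induced (Qdyn S) (WE_star_null S))
      = induced (causal_fundamental_solution S) (L2_null S) ` carrier (W_tc_star S)"
    by (rule kernel_eq_image_induced[OF quot_map_k quot_map_Q2 exact_at_W_E])
  have e3: "exact_seq ([W_E_star S, W_E S, W_tc_star S, W_0 S, zero_space],
      [induced (Qdyn S) (WE_star_null S), induced (causal_fundamental_solution S) (L2_null S),
       induced (Qdyn S) (Wtc_null S), \<lambda>_. {\<lambda>x. 0}])"
    by (rule exact_seq.extension[OF e2 groups(4) Q2.induced_hom k2])
  have k3: "kernel (W_E_star S) (zero_space :: 'h wave set monoid) (\<lambda>_. {\<lambda>x. 0}) = induced (Qdyn S) (WE_star_null S) ` carrier (W_E S)"
  proof -
    \<comment> \<open>Every class lies in the kernel of the map to zero, so the claim is the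
      surjectivity of Q.\<close>
    have "kernel (W_E_star S) (zero_space :: 'h wave set monoid) (\<lambda>_. {\<lambda>x. 0}) = wave_coset (WE_star_null S) ` WE_star_space S"
      by (simp add: kernel_def one_quot carrier_quot)
    also have "\<dots> = wave_coset (WE_star_null S) ` Qdyn S ` WE_space S"
    proof (intro equalityI subsetI)
      fix A assume "A \<in> wave_coset (WE_star_null S) ` WE_star_space S"
      then obtain \<omega> where "\<omega> \<in> WE_star_space S" "A = wave_coset (WE_star_null S) \<omega>" by blast
      moreover from exact_at_W_E_star[OF this(1)] obtain \<zeta> where "\<zeta> \<in> WE_space S"
        "(\<lambda>x. \<omega> x - Qdyn S \<zeta> x) \<in> WE_star_null S" by blast
      ultimately show "A \<in> wave_coset (WE_star_null S) ` Qdyn S ` WE_space S"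
        by (auto simp: wave_coset_eq_iff[OF Q2.Y'(1)] intro!: image_eqI)
    qed (use Q2.maps in blast)
    finally show ?thesis by (simp add: Q2.image_induced)
  qed
  show ?thesis
    by (rule exact_seq.extension[OF e3 groups(5) trivial[OF groups(5) one_quot] k3])
qed

end

theorem theorem6p19:
  fixes S :: "'h::complex_hilbert wave_dynamics"
  assumes "wave_setting S"
    and "finite_time_range S"
    and "hyperbolicity_condition S"
    and "shielded_ret S" and "shielded_adv S"
  shows "let Q1 = induced (Qdyn S) (Wtc_null S);
             k = induced (causal_fundamental_solution S) (L2_null S);
             Q2 = induced (Qdyn S) (WE_star_null S)
         in exact_seq
              ([zero_space, W_E_star S, W_E S, W_tc_star S, W_0 S, zero_space],
               [\<lambda>_. {\<lambda>x. 0}, Q2, k, Q1, \<lambda>_. {\<lambda>x. 0}])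
            \<and> chomogeneous (W0_space S) {\<lambda>x. 0} (Wtc_space S) (Wtc_null S) Q1
            \<and> chomogeneous (Wtc_space S) (Wtc_null S) (WE_space S) (L2_null S) k
            \<and> chomogeneous (WE_space S) (L2_null S) (WE_star_space S) (WE_star_null S) Q2"
proof -
  interpret wave_dyn S by (rule wave_dyn_if_wave_setting[OF assms(1,2)])
  show ?thesis
    unfolding Let_def
    by (intro conjI exact_sequence quot_map.induced_homogeneous quot_map_Q1 quot_map_k quot_map_Q2)
qed

end
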